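(* Let $n\geq 2$ and let $X$ be a space with basepoint $x_0$. If $\{f_{i,j}\}_{(i,j)\in\mathbb{N}^2}$ and $\{g_{i,j}\}_{(i,j)\in\mathbb{N}^2}$ are elements of $\Omega^{n}_{\mathbb{N}^2}(X)$, then $\sum_{i=1}^{\infty}\left[\sum_{j=1}^{\infty}f_{i,j},\sum_{j=1}^{\infty}g_{i,j}\right]$ is an element of $\Omega^{2n-1}(X)$ that is image-relative homotopic to \[ \sum_{(i,j)\in\mathbb{N}^2}[f_{i,j},g_{i,j}]+ \sum_{(i,j)\in\mathbb{N}^2}\left[f_{i,j},\sum_{k>j}g_{i,k}\right]+(-1)^{n^2}\sum_{(i,j)\in\mathbb{N}^2}\left[g_{i,j},\sum_{k>j}f_{i,k}\right].\]
   Context: All spaces are Hausdorff and maps are continuous and based; $\mathbb{N}=\{1,2,3,\dots\}$. Loops and sums. $\Omega^m(X)=\Omega^m(X,x_0)$ is the set of maps $(I^m,\partial I^m)\to (X,x_0)$, $I=[0,1]$, identified with based maps $S^m\to X$ via a fixed homeomorphism $I^m/\partial I^m\cong S^m$. Finite sums are concatenations in the first coordinate, $-f(t_1,\dots,t_m)=f(1-t_1,t_2,\dots,t_m)$, and $(-1)^{e}f$ means $f$ or $-f$ according to the parity of $e$. For a countably infinite set $J$, $\Omega^m_J(X)$ is the set of families $\{f_j\}_{j\in J}$ in $\Omega^m(X,x_0)$ that cluster at $x_0$: for every neighborhood $U$ of $x_0$, $\operatorname{Im}(f_j)\subseteq U$ for all but finitely many $j\in J$. For $\{f_j\}\in\Omega^m_{\mathbb{N}}(X)$,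 $\sum_{j=1}^\infty f_j$ is the map that is $f_j$ (affinely rescaled) on $\left[\frac{j-1}{j},\frac{j}{j+1}\right]\times I^{m-1}$ for each $j$ and sends $\{1\}\times I^{m-1}$ to $x_0$. More generally, for a countable linearly ordered set $J$ fix pairwise-disjoint open intervals $(a_j,b_j)\subseteq I$, $j\in J$, with $a_j<a_{j'}$ whenever $j<j'$; for $\{f_j\}\in\Omega^m_J(X)$, $\sum_{j\in J}f_j$ is $f_j$ (rescaled) on $[a_j,b_j]\times I^{m-1}$ and $x_0$ elsewhere (the choice of intervals does not matter up to image-relative homotopy when $m\ge 2$). $\mathbb{N}^2$ has the lexicographic order; $\sum_{k>j}g_{i,k}$ is the sum over $\{k\in\mathbb{N}\mid k>j\}$. Whitehead products. $a_{p,q}:S^{p+q-1}\to S^p\vee S^q$ is the standard (surjective) attaching map of the $(p+q)$-cell of $S^p\times S^q$, i.e. the restriction of the product characteristic map $D^p\times D^q\to S^p\times S^q$ to the boundary, with the usual orientation conventions, for which the classical relation $[a,b]=(-1)^{pq}[b,a]$ holds for $a\in\pi_p$, $b\in\pi_q$. For $f\in\Omega^p(X)$, $g\in\Omega^q(X)$, $[f,g]=(f\vee g)\circ a_{p,q}\in\Omega^{p+q-1}(X)$. Image-relative homotopy. Based maps $f,g:Y\to X$ are image-relative homotopic if there is a based homotopy $H:Y\times I\to X$ from $f$ to $g$ with $\operatorname{Im}(H)=\operatorname{Im}(f)\cup\operatorname{Im}(g)$. *)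

theory Defs
  imports "HOL-Analysis.Analysis"
begin

text \<open>
  Dimensions vary inside a single statement, so \<open>I\<^sup>m\<close> is a subset of \<open>nat \<Rightarrow> real\<close> (with the product
  topology): the coordinates \<open>0, \<dots>, m - 1\<close> lie in \<open>[0,1]\<close> and the others vanish, as in
  \<^const>\<open>Euclidean_space\<close>. The first coordinate has index \<open>0\<close>.
\<close>

definition cube :: "nat \<Rightarrow> (nat \<Rightarrow> real) set" where
  "cube m = {t. (\<forall>i<m. 0 \<le> t i \<and> t i \<le> 1) \<and> (\<forall>i\<ge>m. t i = 0)}"

definition cube_boundary :: "nat \<Rightarrow> (nat \<Rightarrow> real) set" where
  "cube_boundary m = {t \<in> cube m. \<exists>i<m. t i = 0 \<or> t i = 1}"

text \<open>A loop is only relevant on \<open>I\<^sup>m\<close>; its values elsewhere are arbitrary.\<close>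

definition loops :: "nat \<Rightarrow> 'a topology \<Rightarrow> 'a \<Rightarrow> ((nat \<Rightarrow> real) \<Rightarrow> 'a) set" where
  "loops m X x0 =
     {f. continuous_map (top_of_set (cube m)) X f \<and> (\<forall>t\<in>cube_boundary m. f t = x0)}"

definition loop_families ::
    "nat \<Rightarrow> 'j set \<Rightarrow> 'a topology \<Rightarrow> 'a \<Rightarrow> ('j \<Rightarrow> (nat \<Rightarrow> real) \<Rightarrow> 'a) set" where
  "loop_families m J X x0 =
     {f. (\<forall>j\<in>J. f j \<in> loops m X x0) \<and>
         (\<forall>U. openin X U \<and> x0 \<in> U \<longrightarrow> finite {j \<in> J. \<not> f j ` cube m \<subseteq> U})}"

definition loop_add ::
    "((nat \<Rightarrow> real) \<Rightarrow> 'a) \<Rightarrow> ((nat \<Rightarrow> real) \<Rightarrow> 'a) \<Rightarrow> (nat \<Rightarrow> real) \<Rightarrow> 'a" where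
  "loop_add f g t = (if t 0 \<le> 1/2 then f (t(0 := 2 * t 0)) else g (t(0 := 2 * t 0 - 1)))"

definition loop_uminus :: "((nat \<Rightarrow> real) \<Rightarrow> 'a) \<Rightarrow> (nat \<Rightarrow> real) \<Rightarrow> 'a" where
  "loop_uminus f t = f (t(0 := 1 - t 0))"

text \<open>\<open>(-1)\<^sup>e f\<close>\<close>

definition loop_sign :: "nat \<Rightarrow> ((nat \<Rightarrow> real) \<Rightarrow> 'a) \<Rightarrow> (nat \<Rightarrow> real) \<Rightarrow> 'a" where
  "loop_sign e f = (if even e then f else loop_uminus f)"

text \<open>
  Admissible intervals \<open>(a j, b j)\<close> for the sum over the index set \<open>J\<close> with strict order \<open>r\<close>.
\<close>

definition interval_system ::
    "'j set \<Rightarrow> ('j \<times> 'j) set \<Rightarrow> ('j \<Rightarrow> real) \<Rightarrow> ('j \<Rightarrow> real) \<Rightarrow> bool" where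
  "interval_system J r a b \<longleftrightarrow>
     (\<forall>j\<in>J. 0 \<le> a j \<and> a j < b j \<and> b j \<le> 1) \<and>
     disjoint_family_on (\<lambda>j. {a j<..<b j}) J \<and>
     (\<forall>j\<in>J. \<forall>j'\<in>J. (j, j') \<in> r \<longrightarrow> a j < a j')"

text \<open>
  Open intervals make the index unique. For loops this agrees with rescaling \<open>f j\<close> to the closed
  interval, as \<open>f j\<close> is \<open>x0\<close> at both ends.
\<close>

definition interval_sum ::
    "'j set \<Rightarrow> ('j \<Rightarrow> real) \<Rightarrow> ('j \<Rightarrow> real) \<Rightarrow> 'a \<Rightarrow> ('j \<Rightarrow> (nat \<Rightarrow> real) \<Rightarrow> 'a) \<Rightarrow> (nat \<Rightarrow> real) \<Rightarrow> 'a"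
  where
  "interval_sum J a b x0 f t =
     (if \<exists>j\<in>J. a j < t 0 \<and> t 0 < b j
      then let j = (THE j. j \<in> J \<and> a j < t 0 \<and> t 0 < b j)
           in f j (t(0 := (t 0 - a j) / (b j - a j)))
      else x0)"

definition infinite_sum :: "'a \<Rightarrow> (nat \<Rightarrow> (nat \<Rightarrow> real) \<Rightarrow> 'a) \<Rightarrow> (nat \<Rightarrow> real) \<Rightarrow> 'a" where
  "infinite_sum = interval_sum {1..} (\<lambda>j. (real j - 1) / real j) (\<lambda>j. real j / (real j + 1))"

text \<open>
  The sphere \<open>S\<^sup>m\<close> is modelled as \<open>cube_boundary (Suc m)\<close>, based at the vertex \<open>0\<close>, and
  \<open>collapse m\<close> is the map \<open>I\<^sup>m \<rightarrow> S\<^sup>m\<close> inducing the fixed based homeomorphism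
  \<open>I\<^sup>m/\<partial>I\<^sup>m \<cong> S\<^sup>m\<close>; it is also the characteristic map of the \<open>m\<close>-cell of \<open>S\<^sup>m\<close>.

  The projection of \<open>\<real>\<^sup>m\<^sup>+\<^sup>1\<close> along the diagonal \<open>(1,\<dots>,1)\<close>, followed by \<open>x \<mapsto> (x\<^sub>i - x\<^sub>0)\<^sub>i\<^sub>\<ge>\<^sub>1\<close>,
  identifies each of \<open>{x \<in> I\<^sup>m\<^sup>+\<^sup>1. max x = 1}\<close> and \<open>{x \<in> I\<^sup>m\<^sup>+\<^sup>1. min x = 0}\<close>, whose union is
  \<open>\<partial>I\<^sup>m\<^sup>+\<^sup>1\<close> and which meet exactly where the oscillation \<open>max x - min x\<close> is \<open>1\<close>, with the unit
  ball of the norm \<open>z \<mapsto> max (0, z) - min (0, z)\<close> on \<open>\<real>\<^sup>m\<close>. The concentric cube of half the size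
  (\<open>r \<le> 1/2\<close>, where \<open>r\<close> is the maximum norm of \<open>2t - 1\<close>) covers the first ball radially; the rest
  covers the second one, with \<open>r = 1\<close> going to its centre, the vertex \<open>0\<close>. The centre
  (\<open>r = 0\<close>) goes to \<open>(1,\<dots>,1)\<close> since \<open>0 / 0 = 0\<close>.

  Where all \<open>t i \<le> 1/2\<close> and \<open>r \<le> 1/2\<close> the map is \<open>t \<mapsto> (1, 4t - 1)\<close>, so it preserves orientation when
  \<open>\<partial>I\<^sup>m\<^sup>+\<^sup>1\<close> is oriented as a boundary with the outward normal first.
\<close>

definition collapse :: "nat \<Rightarrow> (nat \<Rightarrow> real) \<Rightarrow> nat \<Rightarrow> real" where
  "collapse m t =
     (let z = (\<lambda>i. case i of 0 \<Rightarrow> 0 | Suc k \<Rightarrow> 2 * t k - 1);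
          r = Max ((\<lambda>i. \<bar>z i\<bar>) ` {..m});
          M = Max (z ` {..m});
          N = Min (z ` {..m})
      in (\<lambda>i. if m < i then 0
              else if r \<le> 1/2 then 1 + 2 * r * (z i - M) / (M - N)
              else 2 * (1 - r) * (z i - N) / (M - N)))"

text \<open>The based map \<open>S\<^sup>m \<rightarrow> X\<close> corresponding to \<open>f \<in> loops m X x0\<close>.\<close>

definition sphere_map :: "nat \<Rightarrow> ((nat \<Rightarrow> real) \<Rightarrow> 'a) \<Rightarrow> (nat \<Rightarrow> real) \<Rightarrow> 'a" where
  "sphere_map m f y = f (inv_into (cube m) (collapse m) y)"

text \<open>
  \<open>S\<^sup>p \<or> S\<^sup>q\<close> is the subspace of \<open>S\<^sup>p \<times> S\<^sup>q\<close> of all \<open>(x, y)\<close> with \<open>x = 0\<close> or \<open>y = 0\<close>. The map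
  \<open>attaching_map p q\<close> is the product characteristic map \<open>I\<^sup>p \<times> I\<^sup>q = I\<^sup>p\<^sup>+\<^sup>q \<rightarrow> S\<^sup>p \<times> S\<^sup>q\<close>, to be used on
  \<open>\<partial>I\<^sup>p\<^sup>+\<^sup>q\<close>, that is, on \<open>S\<^sup>p\<^sup>+\<^sup>q\<^sup>-\<^sup>1\<close>.
\<close>

definition attaching_map ::
    "nat \<Rightarrow> nat \<Rightarrow> (nat \<Rightarrow> real) \<Rightarrow> (nat \<Rightarrow> real) \<times> (nat \<Rightarrow> real)" where
  "attaching_map p q x =
     (collapse p (\<lambda>i. if i < p then x i else 0), collapse q (\<lambda>i. if i < q then x (p + i) else 0))"

definition wedge_map ::
    "((nat \<Rightarrow> real) \<Rightarrow> 'a) \<Rightarrow> ((nat \<Rightarrow> real) \<Rightarrow> 'a) \<Rightarrow> (nat \<Rightarrow> real) \<times> (nat \<Rightarrow> real) \<Rightarrow> 'a" where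
  "wedge_map f g = (\<lambda>(x, y). if y = (\<lambda>_. 0) then f x else g y)"

definition whitehead ::
    "nat \<Rightarrow> nat \<Rightarrow> ((nat \<Rightarrow> real) \<Rightarrow> 'a) \<Rightarrow> ((nat \<Rightarrow> real) \<Rightarrow> 'a) \<Rightarrow> (nat \<Rightarrow> real) \<Rightarrow> 'a" where
  "whitehead p q f g =
     wedge_map (sphere_map p f) (sphere_map q g) \<circ> attaching_map p q \<circ> collapse (p + q - 1)"

text \<open>
  Based homotopies of maps \<open>S\<^sup>m = I\<^sup>m/\<partial>I\<^sup>m \<rightarrow> X\<close> are homotopies on \<open>I\<^sup>m\<close> that are constantly \<open>x0\<close> on
  \<open>\<partial>I\<^sup>m\<close>.
\<close>

definition image_relative_homotopic ::
    "nat \<Rightarrow> 'a topology \<Rightarrow> 'a \<Rightarrow> ((nat \<Rightarrow> real) \<Rightarrow> 'a) \<Rightarrow> ((nat \<Rightarrow> real) \<Rightarrow> 'a) \<Rightarrow> bool" where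
  "image_relative_homotopic m X x0 f g \<longleftrightarrow>
     (\<exists>H. continuous_map (prod_topology (top_of_set (cube m)) (top_of_set {0..1::real})) X H \<and>
          (\<forall>t\<in>cube m. H (t, 0) = f t \<and> H (t, 1) = g t) \<and>
          (\<forall>t\<in>cube_boundary m. \<forall>s\<in>{0..1}. H (t, s) = x0) \<and>
          H ` (cube m \<times> {0..1}) = f ` cube m \<union> g ` cube m)"

end

theory Submission
  imports Defs
begin

text \<open>
  Every map in question sends a point \<open>t\<close> to the only nontrivial value among
  \<open>f\<^sub>i\<^sub>j (\<phi>\<^sub>i\<^sub>j t)\<close>, \<open>g\<^sub>i\<^sub>j (\<psi>\<^sub>i\<^sub>j t)\<close>, where \<open>\<phi>\<^sub>i\<^sub>j\<close> and \<open>\<psi>\<^sub>i\<^sub>j\<close> are maps to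
  \<open>I\<^sup>n/\<partial>I\<^sup>n\<close> that do not depend on \<open>X\<close>. As the loops cluster at \<open>x0\<close>, such a map is continuous as soon
  as every \<open>\<phi>\<^sub>i\<^sub>j\<close> and \<open>\<psi>\<^sub>i\<^sub>j\<close> is, so homotopies may be constructed for each index separately, and
  their images stay in the union of the images of the loops.

  For an infinite sum over disjoint boxes this gives homotopies that move the boxes. A Whitehead
  product \<open>[F, G]\<close> is the composite of the partial map \<open>(x, y) \<mapsto> F x\<close> or \<open>G y\<close>, defined on
  \<open>\<real>\<^sup>n \<times> \<real>\<^sup>n\<close> minus the product of the open cubes, with a map of \<open>I\<^sup>2\<^sup>n\<^sup>-\<^sup>1\<close> around this product. Take for the
  latter a tent, which is the graph of a height function in the direction of the sum of the second
  coordinate vectors of the factors and descends below the product outside of a neighbourhood of its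
  projection. If \<open>F\<close> and \<open>G\<close> are sums of loops over slots, only the products of slots have to be avoided.
  These are grouped into three families of pairwise separated boxes, \<open>j \<times> j\<close>, \<open>j \<times> {k > j}\<close> and \<open>{k > j} \<times> j\<close>,
  and the tent is lowered linearly to one small tent over each of them. The small tents are the
  three kinds of Whitehead products; in the third one the factors have to be exchanged.
\<close>

section \<open>Disjoint sums of maps\<close>

text \<open>Expanding the bracket of two infinite sums into all brackets [f_j, g_k] is impossible:
  for fixed j and growing k they do not cluster at the base point, because the image of f_j stays.
  The products of slots are therefore grouped so that a term with index j involves only loops with
  index at least j; such terms do cluster. The grouping is also geometric: each group is a
  rectangle, and the small tent over it has a base of twice its size, which is why the slots shrink
  by the factor 4.

  Two choices keep the homotopies elementary. In coordinates centred at the midpoint of the product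
  of cubes a homotopy can be scaled up until it only has to avoid one point, so linear homotopies
  are checked by showing that a linear map has trivial kernel. And the tent leaves alone the first
  coordinates of both factors, in which the sums are cut into slots; the second coordinates,
  available as n >= 2, carry the height.

  Images are bounded by a set that is fixed in advance. Only at the end is this set compared with
  the image of the left-hand side, which attains every value of every loop.\<close>

lemma continuous_map_compose_on:
  assumes "continuous_map (top_of_set A) X f" and "continuous_on B \<phi>" and "\<And>y. y \<in> B \<Longrightarrow> \<phi> y \<in> A"
  shows "continuous_map (top_of_set B) X (\<lambda>y. f (\<phi> y))"
proof -
  have "continuous_map (top_of_set B) (top_of_set A) \<phi>"
    using assms(2,3) by (auto simp: continuous_map_subtopology_eu)
  from continuous_map_compose[OF this assms(1)] show ?thesis by (simp add: o_def)
qed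

lemma continuous_on_component [continuous_intros]:
  "continuous_on S (\<lambda>t::nat \<Rightarrow> real. t i)"
  by (rule continuous_on_product_then_coordinatewise) (rule continuous_on_id)

lemma continuous_on_fst_component [continuous_intros]:
  "continuous_on S (\<lambda>p::(nat \<Rightarrow> real) \<times> 'b::topological_space. fst p i)"
  by (rule continuous_on_product_then_coordinatewise) (auto intro: continuous_intros)

text \<open>Formulated for bounding sets instead of maps, so that one clustering hypothesis controls
  every homotopy whose piece with index \<open>j\<close> stays in \<open>E j\<close>.\<close>

definition clusters :: "'j set \<Rightarrow> 'a topology \<Rightarrow> 'a \<Rightarrow> ('j \<Rightarrow> 'a set) \<Rightarrow> bool" where
  "clusters J X x0 E \<longleftrightarrow> (\<forall>U. openin X U \<and> x0 \<in> U \<longrightarrow> finite {j \<in> J. \<not> E j \<subseteq> U})"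

definition disjoint_sum :: "'j set \<Rightarrow> 'a \<Rightarrow> ('j \<Rightarrow> 'y \<Rightarrow> 'a) \<Rightarrow> 'y \<Rightarrow> 'a" where
  "disjoint_sum J x0 P y =
     (if \<exists>j\<in>J. P j y \<noteq> x0 then P (SOME j. j \<in> J \<and> P j y \<noteq> x0) y else x0)"

definition disjoint_at :: "'j set \<Rightarrow> 'a \<Rightarrow> ('j \<Rightarrow> 'y \<Rightarrow> 'a) \<Rightarrow> 'y \<Rightarrow> bool" where
  "disjoint_at J x0 P y \<longleftrightarrow> (\<forall>j\<in>J. \<forall>k\<in>J. P j y \<noteq> x0 \<longrightarrow> P k y \<noteq> x0 \<longrightarrow> j = k)"

lemma disjoint_sum_cases:
  "disjoint_sum J x0 P y = x0 \<or> (\<exists>j\<in>J. disjoint_sum J x0 P y = P j y)"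
proof (cases "\<exists>j\<in>J. P j y \<noteq> x0")
  case True
  then have "\<exists>j. j \<in> J \<and> P j y \<noteq> x0" by blast
  from someI_ex[OF this] show ?thesis using True unfolding disjoint_sum_def by auto
qed (simp add: disjoint_sum_def)

lemma disjoint_sum_cong:
  assumes "\<And>j. j \<in> J \<Longrightarrow> P j y = Q j z"
  shows "disjoint_sum J x0 P y = disjoint_sum J x0 Q z"
proof (cases "\<exists>j\<in>J. P j y \<noteq> x0")
  case True
  have eq: "(\<lambda>j. j \<in> J \<and> P j y \<noteq> x0) = (\<lambda>j. j \<in> J \<and> Q j z \<noteq> x0)" using assms by auto
  have "(SOME j. j \<in> J \<and> P j y \<noteq> x0) \<in> J"
    using True someI_ex[of "\<lambda>j. j \<in> J \<and> P j y \<noteq> x0"] by blast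
  then show ?thesis using True assms unfolding disjoint_sum_def eq by auto
qed (use assms in \<open>auto simp: disjoint_sum_def\<close>)

lemma disjoint_sum_eq:
  assumes "disjoint_at J x0 P y" "j \<in> J" "P j y \<noteq> x0"
  shows "disjoint_sum J x0 P y = P j y"
proof -
  have ex: "\<exists>j. j \<in> J \<and> P j y \<noteq> x0" using assms by blast
  from someI_ex[OF this] have "(SOME j. j \<in> J \<and> P j y \<noteq> x0) = j"
    using assms unfolding disjoint_at_def by blast
  then show ?thesis using ex unfolding disjoint_sum_def by auto
qed

lemma disjoint_sum_eq_iff:
  assumes "disjoint_at J x0 P y" "v \<noteq> x0"
  shows "disjoint_sum J x0 P y = v \<longleftrightarrow> (\<exists>j\<in>J. P j y = v)"
  using disjoint_sum_cases[of J x0 P y] disjoint_sum_eq[OF assms(1)] assms(2) by metis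

text \<open>Sums are compared through their values other than \<open>x0\<close>: there each kind of
  sum is characterised by the existence of an index, and equality of two sums becomes an equivalence
  of two existential statements.\<close>

lemma eq_by_nontrivial_values: "(\<And>v. v \<noteq> x0 \<Longrightarrow> a = v \<longleftrightarrow> b = v) \<Longrightarrow> a = b"
  by metis

text \<open>
  No local finiteness is needed: a neighbourhood of \<open>x0\<close> absorbs all but finitely many pieces, and
  at a point with value outside of it only one piece matters.
\<close>

lemma continuous_map_disjoint_sum:
  assumes cont: "\<And>j. j \<in> J \<Longrightarrow> continuous_map Y X (P j)"
    and disj: "\<And>y. y \<in> topspace Y \<Longrightarrow> disjoint_at J x0 P y"
    and img: "\<And>j y. j \<in> J \<Longrightarrow> y \<in> topspace Y \<Longrightarrow> P j y \<in> E j"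
    and cl: "clusters J X x0 E" and x0: "x0 \<in> topspace X"
  shows "continuous_map Y X (disjoint_sum J x0 P)"
  unfolding continuous_map
proof (intro conjI allI impI)
  have PX: "\<And>j y. j \<in> J \<Longrightarrow> y \<in> topspace Y \<Longrightarrow> P j y \<in> topspace X"
    using cont by (auto simp: continuous_map_def)
  show "disjoint_sum J x0 P ` topspace Y \<subseteq> topspace X"
  proof clarify
    fix y assume "y \<in> topspace Y"
    then show "disjoint_sum J x0 P y \<in> topspace X"
      using disjoint_sum_cases[of J x0 P y] PX x0 by metis
  qed
  fix U assume U: "openin X U"
  have op: "openin Y {y \<in> topspace Y. P j y \<in> U}" if "j \<in> J" for j
    using cont[OF that] U by (auto simp: continuous_map_def)
  show "openin Y {y \<in> topspace Y. disjoint_sum J x0 P y \<in> U}"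
  proof (cases "x0 \<in> U")
    case True
    define B where "B = {j \<in> J. \<not> E j \<subseteq> U}"
    have fin: "finite B" using cl True U unfolding clusters_def B_def by blast
    have good: "P j y \<in> U" if "j \<in> J" "j \<notin> B" "y \<in> topspace Y" for j y
      using that img[of j y] unfolding B_def by auto
    have "disjoint_sum J x0 P y \<in> U \<longleftrightarrow> (\<forall>j\<in>B. P j y \<in> U)" if y: "y \<in> topspace Y" for y
    proof
      assume "disjoint_sum J x0 P y \<in> U"
      then show "\<forall>j\<in>B. P j y \<in> U"
        using disjoint_sum_eq[OF disj[OF y]] True unfolding B_def by (metis (no_types, lifting) mem_Collect_eq)
    next
      assume "\<forall>j\<in>B. P j y \<in> U"
      then show "disjoint_sum J x0 P y \<in> U"
        using disjoint_sum_cases[of J x0 P y] good[OF _ _ y] True by metis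
    qed
    then have "{y \<in> topspace Y. disjoint_sum J x0 P y \<in> U} =
        topspace Y \<inter> (\<Inter>j\<in>B. {y \<in> topspace Y. P j y \<in> U})"
      by auto
    moreover have "openin Y (topspace Y \<inter> (\<Inter>j\<in>B. {y \<in> topspace Y. P j y \<in> U}))"
    proof (cases "B = {}")
      case False
      then show ?thesis
        by (intro openin_Int openin_INT2 fin) (auto simp: op B_def)
    qed simp
    ultimately show ?thesis by simp
  next
    case False
    have "{y \<in> topspace Y. disjoint_sum J x0 P y \<in> U} = (\<Union>j\<in>J. {y \<in> topspace Y. P j y \<in> U})"
    proof (intro set_eqI iffI)
      fix y assume "y \<in> {y \<in> topspace Y. disjoint_sum J x0 P y \<in> U}"
      then show "y \<in> (\<Union>j\<in>J. {y \<in> topspace Y. P j y \<in> U})"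
        using disjoint_sum_cases[of J x0 P y] False by auto
    next
      fix y assume "y \<in> (\<Union>j\<in>J. {y \<in> topspace Y. P j y \<in> U})"
      then show "y \<in> {y \<in> topspace Y. disjoint_sum J x0 P y \<in> U}"
        using disjoint_sum_eq[OF disj] False by (metis (no_types, lifting) UN_E mem_Collect_eq)
    qed
    then show ?thesis using op by auto
  qed
qed

section \<open>Loops extended by the base point\<close>

definition clamp_cube :: "nat \<Rightarrow> (nat \<Rightarrow> real) \<Rightarrow> nat \<Rightarrow> real" where
  "clamp_cube m u = (\<lambda>i. if i < m then max 0 (min 1 (u i)) else 0)"

definition open_cube :: "nat \<Rightarrow> (nat \<Rightarrow> real) set" where
  "open_cube m = {u. \<forall>i<m. 0 < u i \<and> u i < 1}"

lemma clamp_cube_in_cube [simp]: "clamp_cube m u \<in> cube m"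
  by (auto simp: clamp_cube_def cube_def)

lemma clamp_cube_id: "u \<in> cube m \<Longrightarrow> clamp_cube m u = u"
  by (auto simp: clamp_cube_def cube_def fun_eq_iff)

lemma clamp_cube_boundary: "u \<notin> open_cube m \<Longrightarrow> clamp_cube m u \<in> cube_boundary m"
proof -
  assume "u \<notin> open_cube m"
  then obtain i where i: "i < m" "u i \<le> 0 \<or> 1 \<le> u i" by (auto simp: open_cube_def not_less)
  then have "clamp_cube m u i = 0 \<or> clamp_cube m u i = 1" by (auto simp: clamp_cube_def)
  then show ?thesis using i unfolding cube_boundary_def by auto
qed

lemma cube_boundary_subset: "t \<in> cube_boundary m \<Longrightarrow> t \<in> cube m"
  by (simp add: cube_boundary_def)

lemma cube_boundary_not_open: "t \<in> cube_boundary m \<Longrightarrow> t \<notin> open_cube m"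
  by (auto simp: cube_boundary_def open_cube_def)

lemma cube_not_open: "t \<in> cube m \<Longrightarrow> t \<notin> open_cube m \<Longrightarrow> t \<in> cube_boundary m"
  using clamp_cube_boundary clamp_cube_id by metis

lemma cube_boundary_iff: "t \<in> cube m \<Longrightarrow> t \<in> cube_boundary m \<longleftrightarrow> t \<notin> open_cube m"
  using cube_boundary_not_open cube_not_open by blast

lemma continuous_on_clamp_cube [continuous_intros]:
  assumes "\<And>i. i < m \<Longrightarrow> continuous_on S (\<lambda>y. \<phi> y i)"
  shows "continuous_on S (\<lambda>y. clamp_cube m (\<phi> y))"
proof (rule continuous_on_coordinatewise_then_product)
  fix i show "continuous_on S (\<lambda>y. clamp_cube m (\<phi> y) i)"
    by (cases "i < m") (auto simp: clamp_cube_def intro!: continuous_intros assms)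
qed

lemma loopsD: "f \<in> loops m X x0 \<Longrightarrow> continuous_map (top_of_set (cube m)) X f"
  and loops_boundary: "f \<in> loops m X x0 \<Longrightarrow> t \<in> cube_boundary m \<Longrightarrow> f t = x0"
  by (auto simp: loops_def)

text \<open>Composition with \<open>clamp_cube\<close> extends a loop by \<open>x0\<close> to all of
  R^m. A map to I^m modulo its boundary can thus be given by any continuous map into R^m, wherever
  it leaves the cube.\<close>

lemma loop_clamp_trivial: "f \<in> loops m X x0 \<Longrightarrow> u \<notin> open_cube m \<Longrightarrow> f (clamp_cube m u) = x0"
  using clamp_cube_boundary loops_boundary by metis

section \<open>Homotopies with image in a prescribed set\<close>

text \<open>Fixing the bound \<open>E\<close> in advance makes homotopies composable, although the
  maps in between may have larger images than the two ends. Image-relative homotopy is recovered in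
  \<open>image_relative_homotopicI\<close>, once \<open>E\<close> lies in the image of one
  end.\<close>

definition homotopic_within ::
    "nat \<Rightarrow> 'a topology \<Rightarrow> 'a \<Rightarrow> 'a set \<Rightarrow> ((nat \<Rightarrow> real) \<Rightarrow> 'a) \<Rightarrow> ((nat \<Rightarrow> real) \<Rightarrow> 'a) \<Rightarrow> bool" where
  "homotopic_within m X x0 E f g \<longleftrightarrow>
     (\<exists>H. continuous_map (top_of_set (cube m \<times> {0..1::real})) X H \<and>
          (\<forall>t\<in>cube m. H (t, 0) = f t \<and> H (t, 1) = g t) \<and>
          (\<forall>t\<in>cube_boundary m. \<forall>s\<in>{0..1}. H (t, s) = x0) \<and>
          H ` (cube m \<times> {0..1}) \<subseteq> E)"

lemma homotopic_withinI:
  assumes "continuous_map (top_of_set (cube m \<times> {0..1::real})) X H"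
    and "\<And>t. t \<in> cube m \<Longrightarrow> H (t, 0) = f t" and "\<And>t. t \<in> cube m \<Longrightarrow> H (t, 1) = g t"
    and "\<And>t s. t \<in> cube_boundary m \<Longrightarrow> s \<in> {0..1} \<Longrightarrow> H (t, s) = x0"
    and "\<And>t s. t \<in> cube m \<Longrightarrow> s \<in> {0..1} \<Longrightarrow> H (t, s) \<in> E"
  shows "homotopic_within m X x0 E f g"
  unfolding homotopic_within_def using assms by (intro exI[of _ H]) auto

lemma homotopic_withinE:
  assumes "homotopic_within m X x0 E f g"
  obtains H where "continuous_map (top_of_set (cube m \<times> {0..1::real})) X H"
    and "\<And>t. t \<in> cube m \<Longrightarrow> H (t, 0) = f t" and "\<And>t. t \<in> cube m \<Longrightarrow> H (t, 1) = g t"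
    and "\<And>t s. t \<in> cube_boundary m \<Longrightarrow> s \<in> {0..1} \<Longrightarrow> H (t, s) = x0"
    and "\<And>t s. t \<in> cube m \<Longrightarrow> s \<in> {0..1} \<Longrightarrow> H (t, s) \<in> E"
  using assms unfolding homotopic_within_def by (auto simp: image_subset_iff)

lemma homotopic_within_mono:
  "homotopic_within m X x0 E f g \<Longrightarrow> E \<subseteq> E' \<Longrightarrow> homotopic_within m X x0 E' f g"
  unfolding homotopic_within_def by (meson order_trans)

lemma homotopic_within_cong:
  assumes "homotopic_within m X x0 E f g"
    and "\<And>t. t \<in> cube m \<Longrightarrow> f t = f' t" and "\<And>t. t \<in> cube m \<Longrightarrow> g t = g' t"
  shows "homotopic_within m X x0 E f' g'"
  using assms unfolding homotopic_within_def by metis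

lemma homotopic_within_refl:
  assumes "f \<in> loops m X x0" "f ` cube m \<subseteq> E"
  shows "homotopic_within m X x0 E f f"
proof (rule homotopic_withinI[where H = "\<lambda>p. f (fst p)"])
  show "continuous_map (top_of_set (cube m \<times> {0..1::real})) X (\<lambda>p. f (fst p))"
    by (rule continuous_map_compose_on[OF loopsD[OF assms(1)]]) (auto intro: continuous_on_fst)
qed (use assms in \<open>auto simp: loops_def\<close>)

lemma homotopic_within_sym:
  assumes "homotopic_within m X x0 E f g"
  shows "homotopic_within m X x0 E g f"
proof -
  obtain H where H: "continuous_map (top_of_set (cube m \<times> {0..1::real})) X H"
    "\<And>t. t \<in> cube m \<Longrightarrow> H (t, 0) = f t" "\<And>t. t \<in> cube m \<Longrightarrow> H (t, 1) = g t"
    "\<And>t s. t \<in> cube_boundary m \<Longrightarrow> s \<in> {0..1} \<Longrightarrow> H (t, s) = x0"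
    "\<And>t s. t \<in> cube m \<Longrightarrow> s \<in> {0..1} \<Longrightarrow> H (t, s) \<in> E"
    using assms by (rule homotopic_withinE) blast
  show ?thesis
  proof (rule homotopic_withinI[where H = "\<lambda>p. H (fst p, 1 - snd p)"])
    show "continuous_map (top_of_set (cube m \<times> {0..1::real})) X (\<lambda>p. H (fst p, 1 - snd p))"
      by (rule continuous_map_compose_on[OF H(1)]) (auto intro!: continuous_intros)
  qed (auto simp: H)
qed

lemma homotopic_within_trans [trans]:
  assumes "homotopic_within m X x0 E f g" "homotopic_within m X x0 E g h"
  shows "homotopic_within m X x0 E f h"
proof -
  obtain H where H: "continuous_map (top_of_set (cube m \<times> {0..1::real})) X H"
    "\<And>t. t \<in> cube m \<Longrightarrow> H (t, 0) = f t" "\<And>t. t \<in> cube m \<Longrightarrow> H (t, 1) = g t"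
    "\<And>t s. t \<in> cube_boundary m \<Longrightarrow> s \<in> {0..1} \<Longrightarrow> H (t, s) = x0"
    "\<And>t s. t \<in> cube m \<Longrightarrow> s \<in> {0..1} \<Longrightarrow> H (t, s) \<in> E"
    using assms(1) by (rule homotopic_withinE) blast
  obtain K where K: "continuous_map (top_of_set (cube m \<times> {0..1::real})) X K"
    "\<And>t. t \<in> cube m \<Longrightarrow> K (t, 0) = g t" "\<And>t. t \<in> cube m \<Longrightarrow> K (t, 1) = h t"
    "\<And>t s. t \<in> cube_boundary m \<Longrightarrow> s \<in> {0..1} \<Longrightarrow> K (t, s) = x0"
    "\<And>t s. t \<in> cube m \<Longrightarrow> s \<in> {0..1} \<Longrightarrow> K (t, s) \<in> E"
    using assms(2) by (rule homotopic_withinE) blast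
  let ?Y = "top_of_set (cube m \<times> {0..1::real})"
  let ?L = "\<lambda>p. if snd p \<le> 1/2 then H (fst p, 2 * snd p) else K (fst p, 2 * snd p - 1)"
  have "continuous_map ?Y X ?L"
  proof (rule continuous_map_cases_le)
    show "continuous_map ?Y euclideanreal snd" "continuous_map ?Y euclideanreal (\<lambda>p. 1/2)"
      by (auto intro!: continuous_intros)
    have *: "subtopology ?Y {p \<in> topspace ?Y. snd p \<le> 1/2} = top_of_set (cube m \<times> {0..1/2})"
      by (auto simp: subtopology_subtopology intro!: arg_cong[where f="subtopology euclidean"])
    show "continuous_map (subtopology ?Y {p \<in> topspace ?Y. snd p \<le> 1/2}) X (\<lambda>p. H (fst p, 2 * snd p))"
      unfolding * by (rule continuous_map_compose_on[OF H(1)]) (auto intro!: continuous_intros)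
    have *: "subtopology ?Y {p \<in> topspace ?Y. 1/2 \<le> snd p} = top_of_set (cube m \<times> {1/2..1})"
      by (auto simp: subtopology_subtopology intro!: arg_cong[where f="subtopology euclidean"])
    show "continuous_map (subtopology ?Y {p \<in> topspace ?Y. 1/2 \<le> snd p}) X (\<lambda>p. K (fst p, 2 * snd p - 1))"
      unfolding * by (rule continuous_map_compose_on[OF K(1)]) (auto intro!: continuous_intros)
    show "H (fst p, 2 * snd p) = K (fst p, 2 * snd p - 1)" if "p \<in> topspace ?Y" "snd p = 1/2" for p
    proof -
      have "2 * snd p = 1" using that(2) by simp
      then show ?thesis using that(1) by (auto simp: H K)
    qed
  qed
  then show ?thesis
    by (rule homotopic_withinI[where H = ?L]) (auto simp: H K)
qed

text \<open>The ends of a homotopy are loops with image in \<open>E\<close>; for most composite maps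
  this is how continuity is obtained.\<close>

lemma homotopic_within_loops1:
  assumes "homotopic_within m X x0 E f g" shows "f \<in> loops m X x0"
proof -
  obtain H where H: "continuous_map (top_of_set (cube m \<times> {0..1::real})) X H"
    "\<And>t. t \<in> cube m \<Longrightarrow> H (t, 0) = f t"
    "\<And>t s. t \<in> cube_boundary m \<Longrightarrow> s \<in> {0..1} \<Longrightarrow> H (t, s) = x0"
    using assms by (rule homotopic_withinE) blast
  have "continuous_map (top_of_set (cube m)) X (\<lambda>t. H (t, 0))"
    by (rule continuous_map_compose_on[OF H(1)]) (auto intro!: continuous_intros)
  then have "continuous_map (top_of_set (cube m)) X f"
    by (rule continuous_map_eq) (auto simp: H)
  then show ?thesis using H(2,3) cube_boundary_subset unfolding loops_def by fastforce
qed

lemma homotopic_within_image1: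
  assumes "homotopic_within m X x0 E f g" shows "f ` cube m \<subseteq> E"
  using assms by (rule homotopic_withinE) (metis atLeastAtMost_iff dual_order.refl image_subsetI zero_le_one)

lemma homotopic_within_loops2: "homotopic_within m X x0 E f g \<Longrightarrow> g \<in> loops m X x0"
  and homotopic_within_image2: "homotopic_within m X x0 E f g \<Longrightarrow> g ` cube m \<subseteq> E"
  using homotopic_within_sym homotopic_within_loops1 homotopic_within_image1 by metis+

text \<open>The common form of all homotopies of sums: one continuous piece for each index, at most
  one of them nontrivial at each point and time, glued by
  \<open>continuous_map_disjoint_sum\<close>.\<close>

lemma homotopic_within_disjoint_sum:
  assumes cont: "\<And>j. j \<in> J \<Longrightarrow> continuous_map (top_of_set (cube m \<times> {0..1::real})) X (P j)"
    and disj: "\<And>t s. t \<in> cube m \<Longrightarrow> s \<in> {0..1} \<Longrightarrow> disjoint_at J x0 P (t, s)"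
    and img: "\<And>j t s. j \<in> J \<Longrightarrow> t \<in> cube m \<Longrightarrow> s \<in> {0..1} \<Longrightarrow> P j (t, s) \<in> E j"
    and cl: "clusters J X x0 E" and x0: "x0 \<in> topspace X"
    and bd: "\<And>j t s. j \<in> J \<Longrightarrow> t \<in> cube_boundary m \<Longrightarrow> s \<in> {0..1} \<Longrightarrow> P j (t, s) = x0"
    and "\<And>t. t \<in> cube m \<Longrightarrow> disjoint_sum J x0 P (t, 0) = f t"
    and "\<And>t. t \<in> cube m \<Longrightarrow> disjoint_sum J x0 P (t, 1) = g t"
  shows "homotopic_within m X x0 (insert x0 (\<Union>j\<in>J. E j)) f g"
proof (rule homotopic_withinI[where H = "disjoint_sum J x0 P"])
  show "continuous_map (top_of_set (cube m \<times> {0..1::real})) X (disjoint_sum J x0 P)"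
    by (rule continuous_map_disjoint_sum[OF cont _ _ cl x0]) (auto simp: disj img)
  show "disjoint_sum J x0 P (t, s) = x0" if "t \<in> cube_boundary m" "s \<in> {0..1}" for t s
    using disjoint_sum_cases[of J x0 P "(t, s)"] bd that by metis
  show "disjoint_sum J x0 P (t, s) \<in> insert x0 (\<Union>j\<in>J. E j)" if "t \<in> cube m" "s \<in> {0..1}" for t s
    using disjoint_sum_cases[of J x0 P "(t, s)"] img[OF _ that] by (metis UN_I insertCI)
qed (use assms in auto)

section \<open>Sums over disjoint boxes\<close>

definition rescale :: "(nat \<Rightarrow> real) \<Rightarrow> (nat \<Rightarrow> real) \<Rightarrow> (nat \<Rightarrow> real) \<Rightarrow> nat \<Rightarrow> real" where
  "rescale l u t = (\<lambda>i. (t i - l i) / (u i - l i))"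

definition box_sum ::
    "nat \<Rightarrow> 'j set \<Rightarrow> ('j \<Rightarrow> nat \<Rightarrow> real) \<Rightarrow> ('j \<Rightarrow> nat \<Rightarrow> real) \<Rightarrow> 'a \<Rightarrow> ('j \<Rightarrow> (nat \<Rightarrow> real) \<Rightarrow> 'a) \<Rightarrow> (nat \<Rightarrow> real) \<Rightarrow> 'a"
  where "box_sum m J lo hi x0 h = disjoint_sum J x0 (\<lambda>j t. h j (clamp_cube m (rescale (lo j) (hi j) t)))"

lemma rescale_in_open_cube:
  assumes "\<And>i. i < m \<Longrightarrow> l i < u i"
  shows "rescale l u t \<in> open_cube m \<longleftrightarrow> (\<forall>i<m. l i < t i \<and> t i < u i)"
proof -
  have "0 < rescale l u t i \<and> rescale l u t i < 1 \<longleftrightarrow> l i < t i \<and> t i < u i" if "i < m" for i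
    using assms[OF that] by (simp add: rescale_def zero_less_divide_iff divide_less_eq)
  then show ?thesis by (auto simp: open_cube_def)
qed

lemma disjoint_at_boxes:
  assumes h: "\<And>j. j \<in> J \<Longrightarrow> h j \<in> loops m X x0"
    and box: "\<And>j i. j \<in> J \<Longrightarrow> i < m \<Longrightarrow> lo j i < hi j i"
    and sep: "\<And>j k. j \<in> J \<Longrightarrow> k \<in> J \<Longrightarrow> j \<noteq> k \<Longrightarrow> \<exists>i<m. hi j i \<le> lo k i \<or> hi k i \<le> lo j i"
  shows "disjoint_at J x0 (\<lambda>j t. h j (clamp_cube m (rescale (lo j) (hi j) t))) t"
  unfolding disjoint_at_def
proof (intro ballI impI, rule ccontr)
  fix j k assume jk: "j \<in> J" "k \<in> J" "j \<noteq> k"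
    and "h j (clamp_cube m (rescale (lo j) (hi j) t)) \<noteq> x0" "h k (clamp_cube m (rescale (lo k) (hi k) t)) \<noteq> x0"
  then have "rescale (lo j) (hi j) t \<in> open_cube m" "rescale (lo k) (hi k) t \<in> open_cube m"
    using h loop_clamp_trivial by metis+
  then have "\<forall>i<m. lo j i < t i \<and> t i < hi j i" "\<forall>i<m. lo k i < t i \<and> t i < hi k i"
    using rescale_in_open_cube[of m "lo j" "hi j" t] rescale_in_open_cube[of m "lo k" "hi k" t] box jk by auto
  then show False using sep[OF jk] by fastforce
qed

text \<open>The corners of the boxes move linearly while the loops inside are deformed. Two boxes
  must be separated in the same coordinate and in the same order at both ends; by convexity they are
  then separated at all times.\<close>

lemma homotopic_box_sums:
  assumes hom: "\<And>j. j \<in> J \<Longrightarrow> homotopic_within m X x0 (E j) (h j) (h' j)"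
    and cl: "clusters J X x0 E" and x0: "x0 \<in> topspace X"
    and box0: "\<And>j i. j \<in> J \<Longrightarrow> i < m \<Longrightarrow> 0 \<le> lo j i \<and> lo j i < hi j i \<and> hi j i \<le> 1"
    and box1: "\<And>j i. j \<in> J \<Longrightarrow> i < m \<Longrightarrow> 0 \<le> lo' j i \<and> lo' j i < hi' j i \<and> hi' j i \<le> 1"
    and sep: "\<And>j k. j \<in> J \<Longrightarrow> k \<in> J \<Longrightarrow> j \<noteq> k \<Longrightarrow>
      \<exists>i<m. (hi j i \<le> lo k i \<and> hi' j i \<le> lo' k i) \<or> (hi k i \<le> lo j i \<and> hi' k i \<le> lo' j i)"
  shows "homotopic_within m X x0 (insert x0 (\<Union>j\<in>J. E j)) (box_sum m J lo hi x0 h) (box_sum m J lo' hi' x0 h')"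
proof -
  have "\<forall>j\<in>J. \<exists>H. continuous_map (top_of_set (cube m \<times> {0..1::real})) X H \<and>
    (\<forall>t\<in>cube m. H (t, 0) = h j t \<and> H (t, 1) = h' j t) \<and>
          (\<forall>t\<in>cube_boundary m. \<forall>s\<in>{0..1}. H (t, s) = x0) \<and>
          H ` (cube m \<times> {0..1}) \<subseteq> E j"
    using hom unfolding homotopic_within_def by blast
  then obtain H where H0: "\<forall>j\<in>J. continuous_map (top_of_set (cube m \<times> {0..1::real})) X (H j) \<and>
    (\<forall>t\<in>cube m. H j (t, 0) = h j t \<and> H j (t, 1) = h' j t) \<and>
          (\<forall>t\<in>cube_boundary m. \<forall>s\<in>{0..1}. H j (t, s) = x0) \<and>
          H j ` (cube m \<times> {0..1}) \<subseteq> E j"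
    by (rule bchoice[THEN exE])
  have H: "\<And>j. j \<in> J \<Longrightarrow> continuous_map (top_of_set (cube m \<times> {0..1::real})) X (H j)"
    "\<And>j t. j \<in> J \<Longrightarrow> t \<in> cube m \<Longrightarrow> H j (t, 0) = h j t"
    "\<And>j t. j \<in> J \<Longrightarrow> t \<in> cube m \<Longrightarrow> H j (t, 1) = h' j t"
    "\<And>j t s. j \<in> J \<Longrightarrow> t \<in> cube_boundary m \<Longrightarrow> s \<in> {0..1} \<Longrightarrow> H j (t, s) = x0"
    "\<And>j. j \<in> J \<Longrightarrow> H j ` (cube m \<times> {0..1}) \<subseteq> E j"
    using H0 by simp_all
  define L where "L j s i = (1 - s) * lo j i + s * lo' j i" for j and s :: real and i
  define R where "R j s i = (1 - s) * hi j i + s * hi' j i" for j and s :: real and i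
  define P where "P j p = H j (clamp_cube m (rescale (L j (snd p)) (R j (snd p)) (fst p)), snd p)" for j p
  have mix: "(1 - s) * a + s * b \<le> (1 - s) * c + s * d" if "a \<le> c" "b \<le> d" "s \<in> {0..1}" for a b c d s :: real
    using that by (intro add_mono mult_left_mono) auto
  have LR: "L j s i < R j s i" if "j \<in> J" "i < m" "s \<in> {0..1}" for j s i
  proof (cases "s = 0")
    case False
    then have "s * lo' j i < s * hi' j i" using box1[OF that(1,2)] that(3) by auto
    moreover have "(1 - s) * lo j i \<le> (1 - s) * hi j i" using box0[OF that(1,2)] that(3) by (auto intro: mult_left_mono)
    ultimately show ?thesis unfolding L_def R_def by linarith
  qed (use box0[OF that(1,2)] in \<open>simp add: L_def R_def\<close>)
  have nontriv: "L j s i < t i \<and> t i < R j s i"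
    if "j \<in> J" "s \<in> {0..1}" "P j (t, s) \<noteq> x0" "i < m" for j t s i
  proof -
    have "clamp_cube m (rescale (L j s) (R j s) t) \<notin> cube_boundary m"
      using that H(4)[of j _ s] unfolding P_def by auto
    then have "rescale (L j s) (R j s) t \<in> open_cube m" using clamp_cube_boundary by blast
    then show ?thesis using rescale_in_open_cube[of m "L j s" "R j s" t] LR that by auto
  qed
  show ?thesis
  proof (rule homotopic_within_disjoint_sum[where P = P, OF _ _ _ cl x0])
    fix j assume j: "j \<in> J"
    show "continuous_map (top_of_set (cube m \<times> {0..1::real})) X (P j)"
      unfolding P_def
    proof (rule continuous_map_compose_on[OF H(1)[OF j]])
      show "continuous_on (cube m \<times> {0..1::real}) (\<lambda>p. (clamp_cube m (rescale (L j (snd p)) (R j (snd p)) (fst p)), snd p))"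
      proof (rule continuous_on_Pair[OF continuous_on_clamp_cube])
        fix i assume i: "i < m"
        have "\<forall>p\<in>cube m \<times> {0..1::real}. R j (snd p) i - L j (snd p) i \<noteq> 0"
          using LR[OF j i] by fastforce
        moreover have "continuous_on (cube m \<times> {0..1::real}) (\<lambda>p. fst p i - L j (snd p) i)"
          "continuous_on (cube m \<times> {0..1::real}) (\<lambda>p. R j (snd p) i - L j (snd p) i)"
          unfolding L_def R_def by (intro continuous_intros)+
        ultimately show "continuous_on (cube m \<times> {0..1::real}) (\<lambda>p. rescale (L j (snd p)) (R j (snd p)) (fst p) i)"
          unfolding rescale_def by (intro continuous_on_divide)
      qed (intro continuous_intros)
    qed auto
    show "P j (t, s) \<in> E j" if "t \<in> cube m" "s \<in> {0..1}" for t s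
      using H(5)[OF j] that unfolding P_def by (auto simp: image_subset_iff)
    show "P j (t, s) = x0" if t: "t \<in> cube_boundary m" and s: "s \<in> {0..1}" for t s
    proof (rule ccontr)
      assume n: "P j (t, s) \<noteq> x0"
      obtain i where i: "i < m" "t i = 0 \<or> t i = 1" using t by (auto simp: cube_boundary_def)
      have "0 \<le> L j s i" "R j s i \<le> 1"
        using mix[of 0 "lo j i" 0 "lo' j i" s] mix[of "hi j i" 1 "hi' j i" 1 s] box0[OF j i(1)] box1[OF j i(1)] s
        by (auto simp: L_def R_def)
      then show False using nontriv[OF j s n i(1)] i(2) by auto
    qed
  next
    fix t :: "nat \<Rightarrow> real" and s :: real assume ts: "t \<in> cube m" "s \<in> {0..1}"
    show "disjoint_at J x0 P (t, s)" unfolding disjoint_at_def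
    proof (intro ballI impI, rule ccontr)
      fix j k assume jk: "j \<in> J" "k \<in> J" "P j (t, s) \<noteq> x0" "P k (t, s) \<noteq> x0" "j \<noteq> k"
      obtain i where i: "i < m" "(hi j i \<le> lo k i \<and> hi' j i \<le> lo' k i) \<or> (hi k i \<le> lo j i \<and> hi' k i \<le> lo' j i)"
        using sep[OF jk(1,2,5)] by blast
      have "R j s i \<le> L k s i \<or> R k s i \<le> L j s i"
        using mix[of "hi j i" "lo k i" "hi' j i" "lo' k i" s] mix[of "hi k i" "lo j i" "hi' k i" "lo' j i" s] i ts(2)
        by (auto simp: L_def R_def)
      then show False using nontriv[OF jk(1) ts(2) jk(3) i(1)] nontriv[OF jk(2) ts(2) jk(4) i(1)] by auto
    qed
  next
    fix t :: "nat \<Rightarrow> real" assume t: "t \<in> cube m"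
    have "P j (t, 0) = h j (clamp_cube m (rescale (lo j) (hi j) t))" if "j \<in> J" for j
      using that by (simp add: P_def H(2) L_def R_def rescale_def)
    then show "disjoint_sum J x0 P (t, 0) = box_sum m J lo hi x0 h t"
      unfolding box_sum_def by (intro disjoint_sum_cong) simp
    have "P j (t, 1) = h' j (clamp_cube m (rescale (lo' j) (hi' j) t))" if "j \<in> J" for j
      using that by (simp add: P_def H(3) L_def R_def rescale_def)
    then show "disjoint_sum J x0 P (t, 1) = box_sum m J lo' hi' x0 h' t"
      unfolding box_sum_def by (intro disjoint_sum_cong) simp
  qed
qed

section \<open>Sums over families of intervals\<close>

text \<open>\<open>interval_system\<close> without the order of the intervals: by
  \<open>homotopic_interval_sums\<close> any rearrangement gives a homotopic sum in dimension at
  least 2.\<close>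

definition disjoint_intervals :: "'j set \<Rightarrow> ('j \<Rightarrow> real) \<Rightarrow> ('j \<Rightarrow> real) \<Rightarrow> bool" where
  "disjoint_intervals J a b \<longleftrightarrow>
     (\<forall>j\<in>J. 0 \<le> a j \<and> a j < b j \<and> b j \<le> 1) \<and>
     (\<forall>j\<in>J. \<forall>k\<in>J. j \<noteq> k \<longrightarrow> b j \<le> a k \<or> b k \<le> a j)"

lemma disjoint_intervalsD:
  assumes "disjoint_intervals J a b" "j \<in> J"
  shows "0 \<le> a j" "a j < b j" "b j \<le> 1"
  using assms by (auto simp: disjoint_intervals_def)

lemma interval_system_disjoint:
  assumes "interval_system J r a b" shows "disjoint_intervals J a b"
  unfolding disjoint_intervals_def
proof (intro conjI ballI impI)
  fix j k assume jk: "j \<in> J" "k \<in> J" "j \<noteq> k"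
  have disj: "{a j<..<b j} \<inter> {a k<..<b k} = {}"
    using assms jk unfolding interval_system_def disjoint_family_on_def by blast
  show "b j \<le> a k \<or> b k \<le> a j"
  proof (rule ccontr)
    assume "\<not> (b j \<le> a k \<or> b k \<le> a j)"
    moreover have "a j < b j" "a k < b k" using assms jk unfolding interval_system_def by auto
    ultimately have "max (a j) (a k) < min (b j) (b k)" by auto
    then obtain x where "max (a j) (a k) < x" "x < min (b j) (b k)" using dense by blast
    then have "x \<in> {a j<..<b j} \<inter> {a k<..<b k}" by auto
    then show False using disj by blast
  qed
qed (use assms in \<open>auto simp: interval_system_def\<close>)

lemma interval_sum_eq_iff:
  assumes "disjoint_intervals J a b" "v \<noteq> x0"
  shows "interval_sum J a b x0 f t = v \<longleftrightarrow>
    (\<exists>j\<in>J. a j < t 0 \<and> t 0 < b j \<and> f j (t(0 := (t 0 - a j) / (b j - a j))) = v)"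
proof (cases "\<exists>j\<in>J. a j < t 0 \<and> t 0 < b j")
  case True
  then obtain j where j: "j \<in> J" "a j < t 0" "t 0 < b j" by blast
  have uniq: "k = j" if "k \<in> J" "a k < t 0" "t 0 < b k" for k
    using assms(1) that j unfolding disjoint_intervals_def by (metis less_asym less_le_trans)
  then have "(THE j. j \<in> J \<and> a j < t 0 \<and> t 0 < b j) = j" using j by blast
  then have "interval_sum J a b x0 f t = f j (t(0 := (t 0 - a j) / (b j - a j)))"
    using True unfolding interval_sum_def by (simp add: Let_def)
  then show ?thesis using j uniq by metis
next
  case False
  then show ?thesis using assms(2) unfolding interval_sum_def by auto
qed

lemma interval_sum_cong:
  assumes ab: "disjoint_intervals J a b" and "\<And>j. j \<in> J \<Longrightarrow> f j = g j"
  shows "interval_sum J a b x0 f t = interval_sum J a b x0 g t"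
  by (rule eq_by_nontrivial_values[where ?x0.0 = x0]) (simp add: interval_sum_eq_iff[OF ab] assms(2))

text \<open>The interval conditions of \<open>interval_sum_eq_iff\<close> disappear after clamping:
  outside of its interval the rescaled point leaves the open cube, where the clamped loop is
  \<open>x0\<close>.\<close>

lemma interval_sum_clamp_eq_iff:
  assumes "disjoint_intervals J a b" "v \<noteq> x0" "\<And>j. j \<in> J \<Longrightarrow> f j \<in> loops m X x0" "0 < m"
  shows "interval_sum J a b x0 f (clamp_cube m u) = v \<longleftrightarrow>
    (\<exists>j\<in>J. f j (clamp_cube m (u(0 := (u 0 - a j) / (b j - a j)))) = v)"
  unfolding interval_sum_eq_iff[OF assms(1,2)]
proof (intro bex_cong refl)
  fix j assume j: "j \<in> J"
  note ab = disjoint_intervalsD[OF assms(1) j]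
  let ?w = "u(0 := (u 0 - a j) / (b j - a j))" and ?c = "clamp_cube m u"
  have eq: "?c(0 := (?c 0 - a j) / (b j - a j)) = clamp_cube m ?w" if "a j < u 0" "u 0 < b j"
  proof -
    have "0 < (u 0 - a j) / (b j - a j)" "(u 0 - a j) / (b j - a j) < 1" using that by auto
    then show ?thesis using that ab assms(4) by (auto simp: clamp_cube_def fun_eq_iff)
  qed
  have "a j < ?c 0 \<and> ?c 0 < b j \<longleftrightarrow> a j < u 0 \<and> u 0 < b j"
    using ab assms(4) by (auto simp: clamp_cube_def)
  moreover have "a j < u 0 \<and> u 0 < b j" if "f j (clamp_cube m ?w) = v"
  proof -
    have "?w \<in> open_cube m" using that loop_clamp_trivial[OF assms(3)[OF j]] assms(2) by metis
    then have "0 < (u 0 - a j) / (b j - a j) \<and> (u 0 - a j) / (b j - a j) < 1"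
      using assms(4) by (auto simp: open_cube_def dest: spec[of _ 0])
    then show ?thesis using ab by (simp add: zero_less_divide_iff divide_less_eq)
  qed
  ultimately show "(a j < ?c 0 \<and> ?c 0 < b j \<and> f j (?c(0 := (?c 0 - a j) / (b j - a j))) = v) \<longleftrightarrow>
      f j (clamp_cube m ?w) = v"
    using eq by metis
qed

definition slab_lo :: "('j \<Rightarrow> real) \<Rightarrow> 'j \<Rightarrow> nat \<Rightarrow> real" where
  "slab_lo a j i = (if i = 0 then a j else 0)"

definition slab_hi :: "('j \<Rightarrow> real) \<Rightarrow> 'j \<Rightarrow> nat \<Rightarrow> real" where
  "slab_hi b j i = (if i = 0 then b j else 1)"

lemma interval_sum_eq_box_sum:
  assumes "disjoint_intervals J a b" "\<And>j. j \<in> J \<Longrightarrow> h j \<in> loops m X x0" "0 < m" "t \<in> cube m"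
  shows "interval_sum J a b x0 h t = box_sum m J (slab_lo a) (slab_hi b) x0 h t"
proof (rule eq_by_nontrivial_values[where ?x0.0 = x0])
  fix v assume v: "v \<noteq> x0"
  have "disjoint_at J x0 (\<lambda>j t. h j (clamp_cube m (rescale (slab_lo a j) (slab_hi b j) t))) t"
  proof (rule disjoint_at_boxes[OF assms(2)])
    show "slab_lo a j i < slab_hi b j i" if "j \<in> J" for j i
      using disjoint_intervalsD[OF assms(1) that] by (auto simp: slab_lo_def slab_hi_def)
    show "\<exists>i<m. slab_hi b j i \<le> slab_lo a k i \<or> slab_hi b k i \<le> slab_lo a j i"
      if "j \<in> J" "k \<in> J" "j \<noteq> k" for j k
      using assms(1,3) that by (auto simp: slab_lo_def slab_hi_def disjoint_intervals_def intro!: exI[of _ 0])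
  qed
  note box = disjoint_sum_eq_iff[OF this v]
  have resc: "rescale (slab_lo a j) (slab_hi b j) t = t(0 := (t 0 - a j) / (b j - a j))" for j
    by (auto simp: rescale_def slab_lo_def slab_hi_def)
  show "interval_sum J a b x0 h t = v \<longleftrightarrow> box_sum m J (slab_lo a) (slab_hi b) x0 h t = v"
    using interval_sum_clamp_eq_iff[OF assms(1) v assms(2,3), where u = t]
    unfolding box_sum_def box resc clamp_cube_id[OF assms(4)] by simp
qed

text \<open>
  The intermediate boxes have pairwise disjoint projections to the coordinate \<open>1\<close>, so that their
  projections to the coordinate \<open>0\<close> can be moved independently.
\<close>

lemma homotopic_interval_sums:
  assumes m: "2 \<le> m" and J: "countable J"
    and ab: "disjoint_intervals J a b" and ab': "disjoint_intervals J a' b'"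
    and hom: "\<And>j. j \<in> J \<Longrightarrow> homotopic_within m X x0 (E j) (h j) (h' j)"
    and cl: "clusters J X x0 E" and x0: "x0 \<in> topspace X"
  shows "homotopic_within m X x0 (insert x0 (\<Union>j\<in>J. E j))
    (interval_sum J a b x0 h) (interval_sum J a' b' x0 h')"
proof -
  \<comment> \<open>The element number k of \<open>J\<close> gets the interval from k/(k+1) to
    (k+1)/(k+2) in the coordinate \<open>1\<close>.\<close>
  define u where "u j = real (to_nat_on J j) / (real (to_nat_on J j) + 1)" for j
  define v where "v j = (real (to_nat_on J j) + 1) / (real (to_nat_on J j) + 2)" for j
  have uv: "0 \<le> u j \<and> u j < v j \<and> v j \<le> 1" for j
    by (auto simp: u_def v_def field_simps)
  have "v j \<le> u k" if "to_nat_on J j < to_nat_on J k" for j k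
  proof -
    have "real (to_nat_on J j) + 1 \<le> real (to_nat_on J k)" using that by linarith
    then show ?thesis unfolding u_def v_def by (simp add: field_simps)
  qed
  then have sepuv: "v j \<le> u k \<or> v k \<le> u j" if "j \<in> J" "k \<in> J" "j \<noteq> k" for j k
    using that inj_on_to_nat_on[OF J] by (metis inj_onD linorder_neqE_nat)
  define lo where "lo a j i = (if i = 0 then a j else if i = 1 then u j else 0)" for a :: "'a \<Rightarrow> real" and j and i :: nat
  define hi where "hi b j i = (if i = 0 then b j else if i = 1 then v j else 1)" for b :: "'a \<Rightarrow> real" and j and i :: nat
  have sep: "b j \<le> a k \<or> b k \<le> a j" if "disjoint_intervals J a b" "j \<in> J" "k \<in> J" "j \<noteq> k" for a b j k
    using that by (auto simp: disjoint_intervals_def)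
  have slab: "0 \<le> slab_lo a j i \<and> slab_lo a j i < slab_hi b j i \<and> slab_hi b j i \<le> 1"
    if "disjoint_intervals J a b" "j \<in> J" for a b j i
    using disjoint_intervalsD[OF that] by (auto simp: slab_lo_def slab_hi_def)
  have thin: "0 \<le> lo a j i \<and> lo a j i < hi b j i \<and> hi b j i \<le> 1"
    if "disjoint_intervals J a b" "j \<in> J" for a b j i
    using disjoint_intervalsD[OF that] uv by (auto simp: lo_def hi_def)
  have h: "homotopic_within m X x0 (E j) (h j) (h j)" if "j \<in> J" for j
    using homotopic_within_trans[OF hom homotopic_within_sym[OF hom]] that by blast
  have h': "homotopic_within m X x0 (E j) (h' j) (h' j)" if "j \<in> J" for j
    using homotopic_within_trans[OF homotopic_within_sym[OF hom] hom] that by blast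
  let ?E = "insert x0 (\<Union>j\<in>J. E j)"
  have 1: "homotopic_within m X x0 ?E (box_sum m J (slab_lo a) (slab_hi b) x0 h) (box_sum m J (lo a) (hi b) x0 h)"
    using sep[OF ab] m
    by (intro homotopic_box_sums h cl x0 slab[OF ab] thin[OF ab])
       (auto simp: slab_lo_def slab_hi_def lo_def hi_def intro!: exI[of _ 0])
  have 2: "homotopic_within m X x0 ?E (box_sum m J (lo a) (hi b) x0 h) (box_sum m J (lo a') (hi b') x0 h')"
    using sepuv m
    by (intro homotopic_box_sums hom cl x0 thin[OF ab] thin[OF ab'])
       (auto simp: lo_def hi_def intro!: exI[of _ 1])
  have 3: "homotopic_within m X x0 ?E (box_sum m J (lo a') (hi b') x0 h') (box_sum m J (slab_lo a') (slab_hi b') x0 h')"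
    using sep[OF ab'] m
    by (intro homotopic_box_sums h' cl x0 slab[OF ab'] thin[OF ab'])
       (auto simp: slab_lo_def slab_hi_def lo_def hi_def intro!: exI[of _ 0])
  have "homotopic_within m X x0 ?E (box_sum m J (slab_lo a) (slab_hi b) x0 h) (box_sum m J (slab_lo a') (slab_hi b') x0 h')"
    using homotopic_within_trans[OF homotopic_within_trans[OF 1 2] 3] .
  then show ?thesis
  proof (rule homotopic_within_cong)
    fix t assume t: "t \<in> cube m"
    show "box_sum m J (slab_lo a) (slab_hi b) x0 h t = interval_sum J a b x0 h t"
      using interval_sum_eq_box_sum[OF ab homotopic_within_loops1[OF hom] _ t] m by force
    show "box_sum m J (slab_lo a') (slab_hi b') x0 h' t = interval_sum J a' b' x0 h' t"
      using interval_sum_eq_box_sum[OF ab' homotopic_within_loops2[OF hom] _ t] m by force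
  qed
qed

section \<open>The map from the cube to the sphere\<close>

lemma continuous_on_Max_family [continuous_intros]:
  fixes f :: "'i \<Rightarrow> 'b::topological_space \<Rightarrow> real"
  assumes "finite I" "I \<noteq> {}" "\<And>i. i \<in> I \<Longrightarrow> continuous_on S (f i)"
  shows "continuous_on S (\<lambda>y. Max ((\<lambda>i. f i y) ` I))"
  using assms
proof (induction I rule: finite_ne_induct)
  case (insert j I)
  then have "(\<lambda>y. Max ((\<lambda>i. f i y) ` insert j I)) = (\<lambda>y. max (f j y) (Max ((\<lambda>i. f i y) ` I)))"
    by (auto simp: fun_eq_iff)
  then show ?case using insert by (auto intro!: continuous_intros)
qed simp

text \<open>
  The vector \<open>z\<close> and the numbers \<open>r\<close>, \<open>M\<close>, \<open>N\<close> of the definition of \<^const>\<open>collapse\<close>.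
\<close>

definition cvec :: "(nat \<Rightarrow> real) \<Rightarrow> nat \<Rightarrow> real" where
  "cvec t i = (case i of 0 \<Rightarrow> 0 | Suc k \<Rightarrow> 2 * t k - 1)"

definition crad :: "nat \<Rightarrow> (nat \<Rightarrow> real) \<Rightarrow> real" where
  "crad m t = Max ((\<lambda>i. \<bar>cvec t i\<bar>) ` {..m})"

definition cmax :: "nat \<Rightarrow> (nat \<Rightarrow> real) \<Rightarrow> real" where
  "cmax m t = Max (cvec t ` {..m})"

definition cmin :: "nat \<Rightarrow> (nat \<Rightarrow> real) \<Rightarrow> real" where
  "cmin m t = Min (cvec t ` {..m})"

lemma cvec_simps [simp]: "cvec t 0 = 0" "cvec t (Suc k) = 2 * t k - 1"
  by (auto simp: cvec_def)

lemma collapse_alt: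
  "collapse m t i = (if m < i then 0
     else if crad m t \<le> 1/2 then 1 + 2 * crad m t * (cvec t i - cmax m t) / (cmax m t - cmin m t)
     else 2 * (1 - crad m t) * (cvec t i - cmin m t) / (cmax m t - cmin m t))"
proof -
  have "(\<lambda>i. case i of 0 \<Rightarrow> 0 | Suc k \<Rightarrow> 2 * t k - 1) = cvec t"
    by (auto simp: cvec_def fun_eq_iff split: nat.splits)
  then show ?thesis unfolding collapse_def Let_def crad_def cmax_def cmin_def by simp
qed

lemma cvec_le_crad: "i \<le> m \<Longrightarrow> \<bar>cvec t i\<bar> \<le> crad m t"
  and cvec_le_cmax: "i \<le> m \<Longrightarrow> cvec t i \<le> cmax m t"
  and cmin_le_cvec: "i \<le> m \<Longrightarrow> cmin m t \<le> cvec t i"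
  unfolding crad_def cmax_def cmin_def by (auto intro!: Max_ge Min_le)

lemma crad_attained: "\<exists>i\<le>m. \<bar>cvec t i\<bar> = crad m t"
  and cmax_attained: "\<exists>i\<le>m. cvec t i = cmax m t"
  and cmin_attained: "\<exists>i\<le>m. cvec t i = cmin m t"
proof -
  have "crad m t \<in> (\<lambda>i. \<bar>cvec t i\<bar>) ` {..m}" "cmax m t \<in> cvec t ` {..m}" "cmin m t \<in> cvec t ` {..m}"
    unfolding crad_def cmax_def cmin_def by (rule Max_in Min_in; simp)+
  then show "\<exists>i\<le>m. \<bar>cvec t i\<bar> = crad m t" "\<exists>i\<le>m. cvec t i = cmax m t" "\<exists>i\<le>m. cvec t i = cmin m t"
    by (metis (no_types, lifting) atMost_iff imageE)+
qed

lemma crad_nonneg: "0 \<le> crad m t"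
  using cvec_le_crad[of 0 m t] by simp

lemma cmax_nonneg: "0 \<le> cmax m t" and cmin_nonpos: "cmin m t \<le> 0"
  using cvec_le_cmax[of 0 m t] cmin_le_cvec[of 0 m t] by auto

lemma crad_le_diff: "crad m t \<le> cmax m t - cmin m t"
proof -
  obtain i where i: "i \<le> m" "\<bar>cvec t i\<bar> = crad m t" using crad_attained by blast
  show ?thesis
    using i(2) cvec_le_cmax[OF i(1), of t] cmin_le_cvec[OF i(1), of t] cmax_nonneg[of m t] cmin_nonpos[of m t]
    by linarith
qed

lemma crad_eq_0D: "crad m t = 0 \<Longrightarrow> i \<le> m \<Longrightarrow> cvec t i = 0"
  using cvec_le_crad[of i m t] by simp

lemma crad_le_1: assumes "t \<in> cube m" shows "crad m t \<le> 1"
proof -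
  obtain i where i: "i \<le> m" "\<bar>cvec t i\<bar> = crad m t" using crad_attained by blast
  show ?thesis
  proof (cases i)
    case (Suc k)
    then have "0 \<le> t k" "t k \<le> 1" using assms i(1) by (auto simp: cube_def)
    then show ?thesis using i(2) Suc by auto
  qed (use i in auto)
qed

lemma crad_boundary: assumes "t \<in> cube_boundary m" shows "crad m t = 1"
proof -
  obtain i where "i < m" "t i = 0 \<or> t i = 1" using assms by (auto simp: cube_boundary_def)
  then have "1 \<le> crad m t" using cvec_le_crad[of "Suc i" m t] by auto
  then show ?thesis using crad_le_1[of t m] assms cube_boundary_subset by force
qed

lemma crad_less_1: assumes "t \<in> open_cube m" shows "crad m t < 1"
proof -
  obtain i where i: "i \<le> m" "\<bar>cvec t i\<bar> = crad m t" using crad_attained by blast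
  show ?thesis
  proof (cases i)
    case (Suc k)
    then have "0 < t k" "t k < 1" using assms i(1) by (auto simp: open_cube_def)
    then show ?thesis using i(2) Suc by auto
  qed (use i in auto)
qed

lemma continuous_on_cvec [continuous_intros]: "continuous_on S (\<lambda>t. cvec t i)"
  by (cases i) (auto intro!: continuous_intros)

lemma continuous_on_crad [continuous_intros]: "continuous_on S (crad m)"
  unfolding crad_def[abs_def] by (intro continuous_intros) auto

lemma continuous_on_cmax: "continuous_on S (cmax m)"
  unfolding cmax_def[abs_def] by (intro continuous_intros) auto

lemma continuous_on_cmin: "continuous_on S (cmin m)"
proof -
  have "cmin m t = - Max ((\<lambda>i. - cvec t i) ` {..m})" for t
  proof -
    have "Max ((\<lambda>i. - cvec t i) ` {..m}) = - cmin m t"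
    proof (rule Max_eqI)
      show "- cmin m t \<in> (\<lambda>i. - cvec t i) ` {..m}" using cmin_attained[of m t] by force
    qed (use cmin_le_cvec in auto)
    then show ?thesis by simp
  qed
  then have "cmin m = (\<lambda>t. - Max ((\<lambda>i. - cvec t i) ` {..m}))" by auto
  then show ?thesis by (simp only:) (intro continuous_intros, auto)
qed

text \<open>Both branches of \<open>collapse\<close> in one formula: for radius at most 1/2 the
  second factor is 1, for larger radius the first one is the quotient of the second branch.
  Continuity is thereby reduced to that of the radius times a quotient in [0,1].\<close>

lemma collapse_product:
  assumes "i \<le> m"
  shows "collapse m t i =
    (1 - 2 * (min (crad m t) (1/2) * ((cmax m t - cvec t i) / (cmax m t - cmin m t)))) * (2 * (1 - max (crad m t) (1/2)))"
proof (cases "crad m t \<le> 1/2")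
  case True
  define Q where "Q = (cmax m t - cvec t i) / (cmax m t - cmin m t)"
  have "2 * crad m t * (cvec t i - cmax m t) / (cmax m t - cmin m t) = - (2 * crad m t * Q)"
    unfolding Q_def by (simp flip: minus_divide_left minus_mult_right add: minus_divide_left minus_mult_right)
  then show ?thesis using True assms unfolding Q_def[symmetric] by (simp add: collapse_alt)
next
  case False
  then have "0 < cmax m t - cmin m t" using crad_le_diff[of m t] by linarith
  then show ?thesis using False assms by (simp add: collapse_alt field_simps)
qed

lemma continuous_on_collapse [continuous_intros]:
  "continuous_on S (collapse m)"
proof (rule continuous_on_coordinatewise_then_product)
  fix i
  define q where "q t = (cmax m t - cvec t i) / (cmax m t - cmin m t)" for t
  show "continuous_on S (\<lambda>t. collapse m t i)"
  proof (cases "i \<le> m")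
    case True
    have "continuous_on UNIV (\<lambda>t. min (crad m t) (1/2) * q t)"
      unfolding continuous_on_eq_continuous_at[OF open_UNIV]
    proof
      fix t
      have rt: "isCont (crad m) t" "isCont (cmax m) t" "isCont (cmin m) t" "isCont (\<lambda>t. cvec t i) t"
        using continuous_on_crad[of UNIV m] continuous_on_cmax[of UNIV m] continuous_on_cmin[of UNIV m]
          continuous_on_cvec[of UNIV i]
        by (auto simp: continuous_on_eq_continuous_at)
      show "isCont (\<lambda>t. min (crad m t) (1/2) * q t) t"
      proof (cases "crad m t = 0")
        case False
        then have "cmax m t - cmin m t \<noteq> 0" using crad_le_diff[of m t] crad_nonneg[of m t] by linarith
        then show ?thesis unfolding q_def using rt by (intro continuous_intros) auto
      next
        case r0: True
        \<comment> \<open>At the centre the quotient has no limit, but it lies in [0,1], so its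
          product with the radius tends to 0.\<close>
        have bound: "norm (min (crad m u) (1/2) * q u) \<le> crad m u" for u
        proof -
          have "0 \<le> q u" "q u \<le> 1"
            using cvec_le_cmax[OF True, of u] cmin_le_cvec[OF True, of u]
            by (auto simp: q_def divide_le_eq_1)
          then have "min (crad m u) (1/2) * q u \<le> crad m u * 1"
            using crad_nonneg[of m u] by (intro mult_mono) auto
          then show ?thesis using \<open>0 \<le> q u\<close> crad_nonneg[of m u] by simp
        qed
        have "(crad m \<longlongrightarrow> 0) (at t)" using rt(1) r0 by (simp add: isCont_def)
        then have "((\<lambda>u. min (crad m u) (1/2) * q u) \<longlongrightarrow> 0) (at t)"
          by (rule Lim_null_comparison[rotated]) (intro always_eventually allI bound)
        then show ?thesis using r0 by (simp add: isCont_def)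
      qed
    qed
    then have w: "continuous_on S (\<lambda>t. min (crad m t) (1/2) * q t)" by (rule continuous_on_subset) simp
    have "continuous_on S (\<lambda>t. (1 - 2 * (min (crad m t) (1/2) * q t)) * (2 * (1 - max (crad m t) (1/2))))"
      by (rule continuous_on_mult[OF continuous_on_diff[OF continuous_on_const continuous_on_mult[OF continuous_on_const w]]])
         (intro continuous_on_mult continuous_on_diff continuous_on_const continuous_on_max continuous_on_crad)
    then show ?thesis using collapse_product[OF True] by (simp add: q_def)
  next
    case False
    then show ?thesis by (simp add: collapse_alt)
  qed
qed

text \<open>For fixed \<open>t\<close> all coordinates are the same affine function of those of
  \<open>cvec t\<close>: \<open>collapse\<close> only scales this vector and moves it along the
  diagonal. Injectivity and the deformation to the graph over \<open>cvec\<close> rest on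
  this.\<close>

lemma collapse_affine:
  obtains \<alpha> \<beta> where "\<And>i. i \<le> m \<Longrightarrow> collapse m t i = \<alpha> * cvec t i + \<beta>"
    and "t \<in> cube m \<Longrightarrow> 0 \<le> \<alpha>" and "0 < crad m t \<Longrightarrow> crad m t < 1 \<Longrightarrow> 0 < \<alpha>"
proof (cases "crad m t \<le> 1/2")
  case True
  have D: "crad m t \<le> cmax m t - cmin m t" by (rule crad_le_diff)
  show thesis
    by (rule that[of "2 * crad m t / (cmax m t - cmin m t)" "1 - 2 * crad m t / (cmax m t - cmin m t) * cmax m t"])
       (use True D crad_nonneg[of m t] in \<open>auto simp: collapse_alt diff_divide_distrib right_diff_distrib\<close>)
next
  case False
  have D: "0 < cmax m t - cmin m t" using crad_le_diff[of m t] False by linarith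
  define \<alpha> where "\<alpha> = 2 * (1 - crad m t) / (cmax m t - cmin m t)"
  show thesis
  proof (rule that[of \<alpha> "- (\<alpha> * cmin m t)"])
    show "collapse m t i = \<alpha> * cvec t i + - (\<alpha> * cmin m t)" if "i \<le> m" for i
    proof -
      have "collapse m t i = \<alpha> * (cvec t i - cmin m t)"
        using that False by (simp add: collapse_alt \<alpha>_def)
      then show ?thesis by (simp add: right_diff_distrib)
    qed
    show "0 \<le> \<alpha>" if "t \<in> cube m" using crad_le_1[OF that] D by (simp add: \<alpha>_def)
    show "0 < \<alpha>" if "crad m t < 1" using that D by (simp add: \<alpha>_def)
  qed
qed

lemma collapse_upper:
  assumes "crad m t \<le> 1/2"
  shows "i \<le> m \<Longrightarrow> collapse m t i \<le> 1" "i \<le> m \<Longrightarrow> 1 - 2 * crad m t \<le> collapse m t i"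
    "\<exists>i\<le>m. collapse m t i = 1" "\<exists>i\<le>m. collapse m t i = 1 - 2 * crad m t"
proof -
  let ?q = "\<lambda>i. (cvec t i - cmax m t) / (cmax m t - cmin m t)"
  have c: "collapse m t i = 1 + 2 * crad m t * ?q i" if "i \<le> m" for i
    using that assms by (simp add: collapse_alt)
  have q: "-1 \<le> ?q i" "?q i \<le> 0" if "i \<le> m" for i
    using cvec_le_cmax[OF that, of t] cmin_le_cvec[OF that, of t]
    by (auto simp: le_divide_eq divide_le_0_iff)
  have r: "0 \<le> 2 * crad m t" using crad_nonneg[of m t] by simp
  show "i \<le> m \<Longrightarrow> collapse m t i \<le> 1" using c[of i] mult_nonneg_nonpos[OF r q(2)[of i]] by simp
  show "i \<le> m \<Longrightarrow> 1 - 2 * crad m t \<le> collapse m t i"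
    using c[of i] mult_left_mono[OF q(1) r, of i] by simp
  obtain i j where ij: "i \<le> m" "cvec t i = cmax m t" "j \<le> m" "cvec t j = cmin m t"
    using cmax_attained cmin_attained by metis
  show "\<exists>i\<le>m. collapse m t i = 1" using ij c[of i] by auto
  have "collapse m t j = 1 - 2 * crad m t"
  proof (cases "crad m t = 0")
    case False
    then have "cmax m t - cmin m t > 0" using crad_le_diff[of m t] crad_nonneg[of m t] by linarith
    then have "?q j = -1" using ij by (simp add: divide_eq_eq)
    then show ?thesis using c[OF ij(3)] by simp
  qed (use c[OF ij(3)] in simp)
  then show "\<exists>i\<le>m. collapse m t i = 1 - 2 * crad m t" using ij(3) by blast
qed

lemma collapse_lower:
  assumes "\<not> crad m t \<le> 1/2" "crad m t \<le> 1"
  shows "i \<le> m \<Longrightarrow> 0 \<le> collapse m t i" "i \<le> m \<Longrightarrow> collapse m t i \<le> 2 * (1 - crad m t)"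
    "\<exists>i\<le>m. collapse m t i = 0" "\<exists>i\<le>m. collapse m t i = 2 * (1 - crad m t)"
proof -
  let ?q = "\<lambda>i. (cvec t i - cmin m t) / (cmax m t - cmin m t)"
  have c: "collapse m t i = 2 * (1 - crad m t) * ?q i" if "i \<le> m" for i
    using that assms by (simp add: collapse_alt)
  have D: "cmax m t - cmin m t > 0" using crad_le_diff[of m t] assms(1) by linarith
  have q: "0 \<le> ?q i" "?q i \<le> 1" if "i \<le> m" for i
    using cvec_le_cmax[OF that, of t] cmin_le_cvec[OF that, of t]
    by (auto simp: divide_le_eq_1)
  have r: "0 \<le> 2 * (1 - crad m t)" using assms by simp
  show "i \<le> m \<Longrightarrow> 0 \<le> collapse m t i" using c[of i] mult_nonneg_nonneg[OF r q(1)[of i]] by simp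
  show "i \<le> m \<Longrightarrow> collapse m t i \<le> 2 * (1 - crad m t)"
    using c[of i] mult_left_mono[OF q(2) r, of i] by simp
  obtain i j where ij: "i \<le> m" "cvec t i = cmax m t" "j \<le> m" "cvec t j = cmin m t"
    using cmax_attained cmin_attained by metis
  show "\<exists>i\<le>m. collapse m t i = 0" using ij c[of j] by auto
  have "?q i = 1" using D ij by simp
  then have "collapse m t i = 2 * (1 - crad m t)" using c[OF ij(1)] by simp
  then show "\<exists>i\<le>m. collapse m t i = 2 * (1 - crad m t)" using ij(1) by blast
qed

lemma collapse_in_boundary:
  assumes t: "t \<in> cube m" shows "collapse m t \<in> cube_boundary (Suc m)"
proof (cases "crad m t \<le> 1/2")
  case True
  then have "0 \<le> collapse m t i \<and> collapse m t i \<le> 1" if "i \<le> m" for i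
    using collapse_upper(1,2)[OF True that] by linarith
  then have "collapse m t \<in> cube (Suc m)" by (simp add: cube_def less_Suc_eq_le) (simp add: collapse_alt)
  then show ?thesis
    using collapse_upper(3)[OF True] by (auto simp: cube_boundary_def less_Suc_eq_le)
next
  case False
  then have "0 \<le> collapse m t i \<and> collapse m t i \<le> 1" if "i \<le> m" for i
    using collapse_lower(1,2)[OF False crad_le_1[OF t] that] False by auto
  then have "collapse m t \<in> cube (Suc m)" by (simp add: cube_def less_Suc_eq_le) (simp add: collapse_alt)
  then show ?thesis
    using collapse_lower(3)[OF False crad_le_1[OF t]] by (auto simp: cube_boundary_def less_Suc_eq_le)
qed

lemma collapse_boundary: "t \<in> cube_boundary m \<Longrightarrow> collapse m t = (\<lambda>_. 0)"
  using crad_boundary[of t m] by (auto simp: collapse_alt fun_eq_iff)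

lemma collapse_eq_0_iff:
  assumes t: "t \<in> cube m" shows "collapse m t = (\<lambda>_. 0) \<longleftrightarrow> t \<in> cube_boundary m"
proof
  assume 0: "collapse m t = (\<lambda>_. 0)"
  show "t \<in> cube_boundary m"
  proof (rule ccontr)
    assume "t \<notin> cube_boundary m"
    then have r: "crad m t < 1" using cube_boundary_iff[OF t] crad_less_1 by blast
    show False
    proof (cases "crad m t \<le> 1/2")
      case True
      from collapse_upper(3)[OF this] 0 show False by simp
    next
      case False
      from collapse_lower(4)[OF this] r 0 show False by auto
    qed
  qed
qed (rule collapse_boundary)

text \<open>The radius is visible in the image. A largest coordinate 1 marks the inner cube, where
  the smallest one is 1 - 2r; otherwise the largest one is 2(1 - r) < 1.\<close>

lemma crad_collapse:
  assumes t: "t \<in> cube m"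
  shows "crad m t = (let M = Max (collapse m t ` {..m}) in
    if M = 1 then (1 - Min (collapse m t ` {..m})) / 2 else 1 - M / 2)"
proof (cases "crad m t \<le> 1/2")
  case True
  have "Max (collapse m t ` {..m}) = 1" "Min (collapse m t ` {..m}) = 1 - 2 * crad m t"
    using collapse_upper[OF True] by (auto intro!: Max_eqI Min_eqI) (metis atMost_iff imageI)+
  then show ?thesis by simp
next
  case False
  have "Max (collapse m t ` {..m}) = 2 * (1 - crad m t)"
    using collapse_lower[OF False crad_le_1[OF t]] by (auto intro!: Max_eqI) (metis atMost_iff imageI)+
  then show ?thesis using False by (simp add: field_simps)
qed

text \<open>The radii agree by \<open>crad_collapse\<close>. As \<open>cvec\<close> vanishes at
  index 0, the additive constants of \<open>collapse_affine\<close> agree, so the two vectors are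
  positive multiples of each other; having the same radius, they are equal.\<close>

lemma collapse_inj:
  assumes t: "t \<in> cube m" and u: "u \<in> cube m" and eq: "collapse m t = collapse m u"
    and "t \<notin> cube_boundary m"
  shows "t = u"
proof -
  have r: "crad m t = crad m u" using crad_collapse[OF t] crad_collapse[OF u] eq by simp
  have r1: "crad m t < 1" using assms cube_boundary_iff[OF t] crad_less_1 by blast
  have z: "cvec t i = cvec u i" if i: "i \<le> m" for i
  proof (cases "crad m t = 0")
    case True
    then show ?thesis using r crad_eq_0D[OF _ i] by metis
  next
    case False
    then have r0: "0 < crad m t" using crad_nonneg[of m t] by linarith
    obtain \<alpha> \<beta> where a: "\<And>i. i \<le> m \<Longrightarrow> collapse m t i = \<alpha> * cvec t i + \<beta>" "0 < \<alpha>"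
      using collapse_affine[of m t] r0 r1 by metis
    obtain \<gamma> \<delta> where c: "\<And>i. i \<le> m \<Longrightarrow> collapse m u i = \<gamma> * cvec u i + \<delta>" "0 < \<gamma>"
      using collapse_affine[of m u] r0 r1 unfolding r by metis
    have "\<beta> = \<delta>" using a(1)[of 0] c(1)[of 0] eq by simp
    then have *: "\<alpha> * cvec t i = \<gamma> * cvec u i" if "i \<le> m" for i
      using a(1)[OF that] c(1)[OF that] eq by simp
    obtain i' where i': "i' \<le> m" "\<bar>cvec t i'\<bar> = crad m t" using crad_attained by blast
    obtain j' where j': "j' \<le> m" "\<bar>cvec u j'\<bar> = crad m u" using crad_attained by blast
    have abs: "\<alpha> * \<bar>cvec t i\<bar> = \<gamma> * \<bar>cvec u i\<bar>" if "i \<le> m" for i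
      using *[OF that] a(2) c(2) by (metis abs_mult abs_of_pos)
    have "\<alpha> * crad m t \<le> \<gamma> * crad m t"
      using abs[OF i'(1)] i'(2) cvec_le_crad[OF i'(1), of u] c(2) r by simp
    moreover have "\<gamma> * crad m t \<le> \<alpha> * crad m t"
      using abs[OF j'(1)] j'(2) cvec_le_crad[OF j'(1), of t] a(2) r by (metis less_imp_le mult_left_mono)
    ultimately have "\<alpha> = \<gamma>" using r0 by simp
    then show ?thesis using *[OF i] a(2) by simp
  qed
  show ?thesis
  proof
    fix i show "t i = u i"
    proof (cases "i < m")
      case True then show ?thesis using z[of "Suc i"] by simp
    next
      case False then show ?thesis using t u by (simp add: cube_def)
    qed
  qed
qed

text \<open>The inverse of \<open>collapse\<close> on the faces with a coordinate 1. The radius must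
  be (1 - min c)/2 by \<open>collapse_upper\<close>, and \<open>cvec t\<close> must be proportional
  to c i - c 0, since its entry at index 0 is 0; \<open>l\<close> normalises this vector. This part
  of the sphere contains all points used in \<open>whitehead_attains\<close>.\<close>

lemma collapse_onto_upper:
  assumes c: "c \<in> cube (Suc m)" and i1: "i1 \<le> m" "c i1 = 1" and i0: "i0 \<le> m" "c i0 < 1"
  obtains t where "t \<in> cube m" "collapse m t = c"
proof -
  define mn where "mn = Min (c ` {..m})"
  define l where "l = Max ((\<lambda>i. \<bar>c i - c 0\<bar>) ` {..m})"
  have mn: "mn \<le> c i" if "i \<le> m" for i using that by (auto simp: mn_def)
  have "mn \<in> c ` {..m}" unfolding mn_def by (rule Min_in) auto
  then obtain k where k: "k \<le> m" "c k = mn" by auto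
  have l: "\<bar>c i - c 0\<bar> \<le> l" if "i \<le> m" for i using that by (auto simp: l_def)
  have "l \<in> (\<lambda>i. \<bar>c i - c 0\<bar>) ` {..m}" unfolding l_def by (rule Max_in) auto
  then obtain p where p: "p \<le> m" "\<bar>c p - c 0\<bar> = l" by auto
  have l0: "0 < l" using l[OF i1(1)] l[OF i0(1)] i1 i0 by linarith
  have c01: "0 \<le> c i" "c i \<le> 1" if "i \<le> m" for i using c that by (auto simp: cube_def)
  have mn1: "mn < 1" "0 \<le> mn" using mn[OF i0(1)] i0 k c01[of k] by auto
  define r where "r = (1 - mn) / 2"
  have r: "0 < r" "r \<le> 1/2" using mn1 by (auto simp: r_def)
  define t where "t i = (if i < m then (r * (c (Suc i) - c 0) / l + 1) / 2 else 0)" for i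
  have z: "cvec t i = r * (c i - c 0) / l" if "i \<le> m" for i
    using that by (cases i) (auto simp: t_def add_divide_distrib)
  have zr: "\<bar>cvec t i\<bar> \<le> r" if "i \<le> m" for i
  proof -
    have "\<bar>cvec t i\<bar> = r * (\<bar>c i - c 0\<bar> / l)" using z[OF that] r l0 by (simp add: abs_mult)
    also have "\<dots> \<le> r * 1" using l[OF that] l0 r by (intro mult_left_mono) auto
    finally show ?thesis by simp
  qed
  have tc: "t \<in> cube m"
  proof -
    have "0 \<le> t i \<and> t i \<le> 1" if "i < m" for i
      using zr[of "Suc i"] r that by auto
    then show ?thesis by (auto simp: cube_def t_def)
  qed
  have rad: "crad m t = r"
    unfolding crad_def
  proof (rule Max_eqI)
    have "\<bar>cvec t p\<bar> = r" using z[OF p(1)] p(2) r l0 by (simp add: abs_mult)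
    then show "r \<in> (\<lambda>i. \<bar>cvec t i\<bar>) ` {..m}" using p(1) by force
  qed (use zr in auto)
  have mx: "cmax m t = r * (1 - c 0) / l"
    unfolding cmax_def
  proof (rule Max_eqI)
    show "r * (1 - c 0) / l \<in> cvec t ` {..m}" using z[OF i1(1)] i1 by force
    show "y \<le> r * (1 - c 0) / l" if "y \<in> cvec t ` {..m}" for y
      using that z c01 r l0 by (auto simp: divide_right_mono)
  qed simp
  have mi: "cmin m t = r * (mn - c 0) / l"
    unfolding cmin_def
  proof (rule Min_eqI)
    show "r * (mn - c 0) / l \<in> cvec t ` {..m}" using z[OF k(1)] k by force
    show "r * (mn - c 0) / l \<le> y" if "y \<in> cvec t ` {..m}" for y
      using that z mn r l0 by (auto simp: divide_right_mono)
  qed simp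
  have "collapse m t i = c i" for i
  proof (cases "i \<le> m")
    case True
    have "cmax m t - cmin m t = r * (1 - mn) / l"
      unfolding mx mi by (simp add: diff_divide_distrib[symmetric] right_diff_distrib)
    moreover have "cvec t i - cmax m t = r * (c i - 1) / l"
      unfolding mx z[OF True] by (simp add: diff_divide_distrib[symmetric] right_diff_distrib)
    ultimately have "(cvec t i - cmax m t) / (cmax m t - cmin m t) = (c i - 1) / (1 - mn)"
      using r l0 by simp
    then have "2 * r * (cvec t i - cmax m t) / (cmax m t - cmin m t) = 2 * r * ((c i - 1) / (1 - mn))"
      by (metis times_divide_eq_right)
    then have "collapse m t i = 1 + 2 * r * ((c i - 1) / (1 - mn))"
      using True r rad by (simp add: collapse_alt)
    then show ?thesis using mn1 by (simp add: r_def)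
  next
    case False
    then show ?thesis using c by (simp add: collapse_alt cube_def)
  qed
  then show thesis using that tc by blast
qed

text \<open>The preimage picked by \<open>inv_into\<close> is unique by \<open>collapse_inj\<close>,
  except over the base vertex, whose preimages are the boundary points; there the loop is
  \<open>x0\<close>.\<close>

lemma sphere_map_collapse:
  assumes f: "f \<in> loops m X x0" and t: "t \<in> cube m"
  shows "sphere_map m f (collapse m t) = f t"
proof -
  define u where "u = inv_into (cube m) (collapse m) (collapse m t)"
  have u: "u \<in> cube m" "collapse m u = collapse m t"
    unfolding u_def using imageI[OF t, of "collapse m"] by (rule inv_into_into, rule f_inv_into_f)
  have "f u = f t"
  proof (cases "t \<in> cube_boundary m")
    case True
    then have "u \<in> cube_boundary m" using u collapse_boundary[OF True] collapse_eq_0_iff[OF u(1)] by simp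
    then show ?thesis using True f loops_boundary by metis
  next
    case False
    then show ?thesis using collapse_inj[OF t u(1)] u(2) by auto
  qed
  then show ?thesis by (simp add: sphere_map_def u_def)
qed

text \<open>
  \<open>f\<close> and \<open>g\<close> glued along \<open>\<real>\<^sup>n \<times> \<real>\<^sup>n\<close> minus the product of the open cubes, where at most one of them
  is nontrivial.
\<close>

definition wedge_ext :: "nat \<Rightarrow> 'a \<Rightarrow> ((nat \<Rightarrow> real) \<Rightarrow> 'a) \<Rightarrow> ((nat \<Rightarrow> real) \<Rightarrow> 'a) \<Rightarrow> (nat \<Rightarrow> real) \<Rightarrow> 'a" where
  "wedge_ext n x0 f g q =
     (if f (clamp_cube n q) \<noteq> x0 then f (clamp_cube n q) else g (clamp_cube n (\<lambda>i. q (n + i))))"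

text \<open>One half of a boundary point of the 2n-cube lies in the boundary of the n-cube, where
  its loop is trivial. Hence testing whether \<open>y\<close> collapses to the base vertex and
  testing whether \<open>f\<close> is nontrivial select the same value.\<close>

lemma whitehead_eq_wedge_ext:
  assumes f: "f \<in> loops n X x0" and g: "g \<in> loops n X x0" and t: "t \<in> cube (2 * n - 1)" and n: "0 < n"
  shows "whitehead n n f g t = wedge_ext n x0 f g (collapse (2 * n - 1) t)"
proof -
  define c where "c = collapse (2 * n - 1) t"
  have c: "c \<in> cube_boundary (2 * n)" using collapse_in_boundary[OF t] n by (simp add: c_def)
  define x where "x = (\<lambda>i. if i < n then c i else 0)"
  define y where "y = (\<lambda>i. if i < n then c (n + i) else 0)"
  have xc: "x \<in> cube n" and yc: "y \<in> cube n" using c by (auto simp: x_def y_def cube_boundary_def cube_def)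
  have x: "clamp_cube n c = x" using xc by (auto simp: clamp_cube_def x_def cube_def fun_eq_iff)
  have y: "clamp_cube n (\<lambda>i. c (n + i)) = y" using yc by (auto simp: clamp_cube_def y_def cube_def fun_eq_iff)
  have bd: "x \<in> cube_boundary n \<or> y \<in> cube_boundary n"
  proof -
    obtain i where i: "i < 2 * n" "c i = 0 \<or> c i = 1" using c by (auto simp: cube_boundary_def)
    show ?thesis
    proof (cases "i < n")
      case True
      then show ?thesis using i xc by (auto simp: x_def cube_boundary_def)
    next
      case False
      then have "i - n < n" "y (i - n) = 0 \<or> y (i - n) = 1" using i by (auto simp: y_def)
      then show ?thesis using yc by (auto simp: cube_boundary_def)
    qed
  qed
  have "whitehead n n f g t = (if collapse n y = (\<lambda>_. 0) then f x else g y)"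
  proof -
    have nn: "n + n - 1 = 2 * n - 1" by simp
    show ?thesis
      unfolding whitehead_def wedge_map_def attaching_map_def o_def nn c_def[symmetric] x_def[symmetric] y_def[symmetric]
      by (simp add: sphere_map_collapse[OF f xc] sphere_map_collapse[OF g yc])
  qed
  also have "\<dots> = wedge_ext n x0 f g c"
    using bd collapse_eq_0_iff[OF yc] loops_boundary[OF f] loops_boundary[OF g]
    unfolding wedge_ext_def x y by auto
  finally show ?thesis by (simp add: c_def)
qed

section \<open>Whitehead products as maps into a punctured Euclidean space\<close>

lemma continuous_on_if_const [continuous_intros]:
  "(c \<Longrightarrow> continuous_on S f) \<Longrightarrow> (\<not> c \<Longrightarrow> continuous_on S g) \<Longrightarrow> continuous_on S (\<lambda>p. if c then f p else g p)"
  by (cases c) simp_all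

lemma continuous_on_fst_cvec [continuous_intros]: "continuous_on S (\<lambda>p. cvec (fst p) i)"
  by (rule continuous_on_compose2[OF continuous_on_cvec continuous_on_fst[OF continuous_on_id] subset_refl])

lemma continuous_on_fst_crad [continuous_intros]: "continuous_on S (\<lambda>p. crad m (fst p))"
  by (rule continuous_on_compose2[OF continuous_on_crad continuous_on_fst[OF continuous_on_id] subset_refl])

lemma continuous_on_fst_collapse [continuous_intros]: "continuous_on S (\<lambda>p. collapse m (fst p) i)"
proof -
  have "continuous_on UNIV (\<lambda>t. collapse m t i)"
    by (rule continuous_on_product_then_coordinatewise) (rule continuous_on_collapse)
  then show ?thesis by (rule continuous_on_compose2[OF _ continuous_on_fst[OF continuous_on_id] subset_UNIV])
qed

lemma compact_cube: "compact (cube m)"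
proof -
  have eq: "cube m = PiE UNIV (\<lambda>i. if i < m then {0..1} else {0})"
  proof (rule set_eqI)
    fix t :: "nat \<Rightarrow> real"
    have "t i \<in> (if i < m then {0..1} else {0}) \<longleftrightarrow> (i < m \<longrightarrow> 0 \<le> t i \<and> t i \<le> 1) \<and> (m \<le> i \<longrightarrow> t i = 0)" for i
      by (cases "i < m") auto
    then show "t \<in> cube m \<longleftrightarrow> t \<in> PiE UNIV (\<lambda>i. if i < m then {0..1} else {0})"
      unfolding PiE_UNIV_domain Pi_iff cube_def by blast
  qed
  have "compactin (product_topology (\<lambda>i. euclidean :: real topology) UNIV) (PiE UNIV (\<lambda>i. if i < m then {0..1} else {0}))"
    unfolding compactin_PiE by auto
  then show ?thesis unfolding eq euclidean_product_topology by (simp add: compactin_euclidean_iff)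
qed

lemma open_cube_double:
  "q \<in> open_cube (2 * n) \<longleftrightarrow> q \<in> open_cube n \<and> (\<lambda>i. q (n + i)) \<in> open_cube n"
proof
  assume r: "q \<in> open_cube n \<and> (\<lambda>i. q (n + i)) \<in> open_cube n"
  have "0 < q k \<and> q k < 1" if "k < 2 * n" for k
  proof (cases "k < n")
    case False
    then have "k - n < n" "n + (k - n) = k" using that by auto
    then show ?thesis using r unfolding open_cube_def by (metis (mono_tags, lifting) mem_Collect_eq)
  qed (use r in \<open>auto simp: open_cube_def\<close>)
  then show "q \<in> open_cube (2 * n)" by (simp add: open_cube_def)
qed (auto simp: open_cube_def)

lemma wedge_ext_cong:
  assumes "\<And>k. k < 2 * n \<Longrightarrow> q k = q' k" shows "wedge_ext n x0 f g q = wedge_ext n x0 f g q'"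
proof -
  have "clamp_cube n q = clamp_cube n q'" "clamp_cube n (\<lambda>i. q (n + i)) = clamp_cube n (\<lambda>i. q' (n + i))"
    using assms by (auto simp: clamp_cube_def fun_eq_iff)
  then show ?thesis by (simp add: wedge_ext_def)
qed

lemma wedge_ext_eq_iff:
  assumes "f \<in> loops n X x0" "g \<in> loops n X x0" "q \<notin> open_cube (2 * n)" "v \<noteq> x0"
  shows "wedge_ext n x0 f g q = v \<longleftrightarrow> f (clamp_cube n q) = v \<or> g (clamp_cube n (\<lambda>i. q (n + i))) = v"
  using assms loop_clamp_trivial[OF assms(1)] loop_clamp_trivial[OF assms(2)]
  unfolding open_cube_double wedge_ext_def by metis

text \<open>Off the product of the open cubes the two loops are never nontrivial together, so the
  composite along \<open>K\<close> is a disjoint sum of two pieces, indexed by the factor. Over the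
  boundary both factors have to be outside of their cubes.\<close>

lemma homotopic_wedge_ext:
  assumes K: "continuous_on (cube m \<times> {0..1::real}) K"
    and off: "\<And>t s. t \<in> cube m \<Longrightarrow> s \<in> {0..1} \<Longrightarrow> K (t, s) \<notin> open_cube (2 * n)"
    and bd: "\<And>t s. t \<in> cube_boundary m \<Longrightarrow> s \<in> {0..1} \<Longrightarrow>
      K (t, s) \<notin> open_cube n \<and> (\<lambda>i. K (t, s) (n + i)) \<notin> open_cube n"
    and hf: "homotopic_within n X x0 E f f'" and hg: "homotopic_within n X x0 E g g'" and x0: "x0 \<in> topspace X"
  shows "homotopic_within m X x0 (insert x0 E) (\<lambda>t. wedge_ext n x0 f g (K (t, 0))) (\<lambda>t. wedge_ext n x0 f' g' (K (t, 1)))"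
proof -
  obtain F where F: "continuous_map (top_of_set (cube n \<times> {0..1::real})) X F"
    "\<And>t. t \<in> cube n \<Longrightarrow> F (t, 0) = f t" "\<And>t. t \<in> cube n \<Longrightarrow> F (t, 1) = f' t"
    "\<And>t s. t \<in> cube_boundary n \<Longrightarrow> s \<in> {0..1} \<Longrightarrow> F (t, s) = x0"
    "\<And>t s. t \<in> cube n \<Longrightarrow> s \<in> {0..1} \<Longrightarrow> F (t, s) \<in> E"
    using hf by (rule homotopic_withinE) blast
  obtain G where G: "continuous_map (top_of_set (cube n \<times> {0..1::real})) X G"
    "\<And>t. t \<in> cube n \<Longrightarrow> G (t, 0) = g t" "\<And>t. t \<in> cube n \<Longrightarrow> G (t, 1) = g' t"
    "\<And>t s. t \<in> cube_boundary n \<Longrightarrow> s \<in> {0..1} \<Longrightarrow> G (t, s) = x0"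
    "\<And>t s. t \<in> cube n \<Longrightarrow> s \<in> {0..1} \<Longrightarrow> G (t, s) \<in> E"
    using hg by (rule homotopic_withinE) blast
  define P where "P b p = (if b then F (clamp_cube n (K p), snd p) else G (clamp_cube n (\<lambda>i. K p (n + i)), snd p))" for b p
  have Ftriv: "F (clamp_cube n u, s) = x0" if "u \<notin> open_cube n" "s \<in> {0..1}" for u s
    using F(4) clamp_cube_boundary that by blast
  have Gtriv: "G (clamp_cube n u, s) = x0" if "u \<notin> open_cube n" "s \<in> {0..1}" for u s
    using G(4) clamp_cube_boundary that by blast
  have dj: "disjoint_at UNIV x0 P (t, s)" if ts: "t \<in> cube m" "s \<in> {0..1}" for t s
  proof -
    have "P True (t, s) = x0 \<or> P False (t, s) = x0"
      using off[OF ts] Ftriv[OF _ ts(2)] Gtriv[OF _ ts(2)] unfolding open_cube_double P_def by auto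
    then show ?thesis unfolding disjoint_at_def by (metis (full_types))
  qed
  have "homotopic_within m X x0 (insert x0 (\<Union>b\<in>(UNIV::bool set). E))
    (\<lambda>t. wedge_ext n x0 f g (K (t, 0))) (\<lambda>t. wedge_ext n x0 f' g' (K (t, 1)))"
  proof (rule homotopic_within_disjoint_sum[where P = P, OF _ dj _ _ x0])
    fix b :: bool
    have Kc: "continuous_on (cube m \<times> {0..1::real}) (\<lambda>p. K p i)" for i
      using continuous_on_product_then_coordinatewise[OF K] .
    have "continuous_map (top_of_set (cube m \<times> {0..1::real})) X (\<lambda>p. F (clamp_cube n (K p), snd p))"
      by (rule continuous_map_compose_on[OF F(1)]) (intro continuous_on_Pair continuous_on_clamp_cube Kc continuous_intros, auto)
    moreover have "continuous_map (top_of_set (cube m \<times> {0..1::real})) X (\<lambda>p. G (clamp_cube n (\<lambda>i. K p (n + i)), snd p))"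
      by (rule continuous_map_compose_on[OF G(1)]) (intro continuous_on_Pair continuous_on_clamp_cube Kc continuous_intros, auto)
    ultimately show "continuous_map (top_of_set (cube m \<times> {0..1::real})) X (P b)"
      by (cases b) (simp_all add: P_def[abs_def])
    show "P b (t, s) \<in> E" if "t \<in> cube m" "s \<in> {0..1}" for t s
      using that by (simp add: P_def F(5) G(5))
    show "P b (t, s) = x0" if "t \<in> cube_boundary m" "s \<in> {0..1}" for t s
      using bd[OF that] Ftriv[OF _ that(2)] Gtriv[OF _ that(2)] by (simp add: P_def)
  next
    fix t assume t: "t \<in> cube m"
    have 01: "(0::real) \<in> {0..1}" "(1::real) \<in> {0..1}" by auto
    show "disjoint_sum UNIV x0 P (t, 0) = wedge_ext n x0 f g (K (t, 0))"
    proof (rule eq_by_nontrivial_values[where ?x0.0 = x0])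
      fix v assume v: "v \<noteq> x0"
      show "disjoint_sum UNIV x0 P (t, 0) = v \<longleftrightarrow> wedge_ext n x0 f g (K (t, 0)) = v"
        unfolding disjoint_sum_eq_iff[OF dj[OF t 01(1)] v]
          wedge_ext_eq_iff[OF homotopic_within_loops1[OF hf] homotopic_within_loops1[OF hg] off[OF t 01(1)] v]
        by (auto simp: P_def F G)
    qed
    show "disjoint_sum UNIV x0 P (t, 1) = wedge_ext n x0 f' g' (K (t, 1))"
    proof (rule eq_by_nontrivial_values[where ?x0.0 = x0])
      fix v assume v: "v \<noteq> x0"
      show "disjoint_sum UNIV x0 P (t, 1) = v \<longleftrightarrow> wedge_ext n x0 f' g' (K (t, 1)) = v"
        unfolding disjoint_sum_eq_iff[OF dj[OF t 01(2)] v]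
          wedge_ext_eq_iff[OF homotopic_within_loops2[OF hf] homotopic_within_loops2[OF hg] off[OF t 01(2)] v]
        by (auto simp: P_def F G)
    qed
  qed (auto simp: clusters_def)
  then show ?thesis by simp
qed

text \<open>\<open>q\<close> is given in coordinates centred at the midpoint of the cube.\<close>

definition centred :: "real \<Rightarrow> (nat \<Rightarrow> real) \<Rightarrow> nat \<Rightarrow> real" where
  "centred c q k = 1/2 + c * q k"

text \<open>
  After scaling up, a homotopy only has to avoid the midpoint, instead of the open cube.
\<close>

lemma homotopic_wedge_ext_centred:
  assumes K: "continuous_on (cube m \<times> {0..1::real}) K" and n: "2 \<le> n"
    and nonzero: "\<And>t s. t \<in> cube m \<Longrightarrow> s \<in> {0..1} \<Longrightarrow> \<exists>k<2 * n. K (t, s) k \<noteq> 0"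
    and bd: "\<And>t s. t \<in> cube_boundary m \<Longrightarrow> s \<in> {0..1} \<Longrightarrow> K (t, s) 1 \<le> -1/2 \<and> K (t, s) (n + 1) \<le> -1/2"
    and f: "f \<in> loops n X x0" "f ` cube n \<subseteq> E" and g: "g \<in> loops n X x0" "g ` cube n \<subseteq> E"
    and x0: "x0 \<in> topspace X"
  shows "\<forall>\<^sub>F c in at_top. homotopic_within m X x0 (insert x0 E)
    (\<lambda>t. wedge_ext n x0 f g (centred c (K (t, 0)))) (\<lambda>t. wedge_ext n x0 f g (centred c (K (t, 1))))"
proof -
  \<comment> \<open>The sum norm of the point, bounded below by compactness. Inside the open cube
    the 2n scaled coordinates have absolute value below 1/2, hence scaled norm below n, which c >= n
    / min N excludes.\<close>
  define N where "N p = (\<Sum>k<2*n. \<bar>K p k\<bar>)" for p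
  have Kc: "continuous_on (cube m \<times> {0..1::real}) (\<lambda>p. K p i)" for i
    using continuous_on_product_then_coordinatewise[OF K] .
  have "continuous_on (cube m \<times> {0..1::real}) N"
    unfolding N_def by (intro continuous_on_sum continuous_on_rabs Kc)
  moreover have "compact (cube m \<times> {0..1::real})" by (intro compact_Times compact_cube compact_Icc)
  moreover have "(\<lambda>_. 0, 0) \<in> cube m \<times> {0..1::real}" by (auto simp: cube_def)
  ultimately obtain p where p: "p \<in> cube m \<times> {0..1::real}" "\<And>q. q \<in> cube m \<times> {0..1::real} \<Longrightarrow> N p \<le> N q"
    using continuous_attains_inf[of "cube m \<times> {0..1::real}" N] by blast
  have Np: "0 < N p"
  proof -
    obtain k where "k < 2 * n" "K p k \<noteq> 0" using nonzero[of "fst p" "snd p"] p(1) by auto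
    then show ?thesis unfolding N_def by (intro sum_pos2[of _ k]) auto
  qed
  have main: "homotopic_within m X x0 (insert x0 E)
    (\<lambda>t. wedge_ext n x0 f g (centred c (K (t, 0)))) (\<lambda>t. wedge_ext n x0 f g (centred c (K (t, 1))))"
    if c: "max 1 (real n / N p) \<le> c" for c
  proof -
    have c1: "1 \<le> c" "real n / N p \<le> c" using c by auto
    then have cN: "real n \<le> c * N p" using Np by (simp add: divide_le_eq)
    \<comment> \<open>A coordinate that is at most -1/2 before scaling stays outside of the open
      cube at every scale c >= 1.\<close>
    have small: "centred c q k \<le> 0" if "q k \<le> -1/2" for q k
    proof -
      have "c * q k \<le> 1 * (-1/2)" using mult_mono'[of 1 c "1/2" "- q k"] that c1(1) by simp
      then show ?thesis by (simp add: centred_def)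
    qed
    show ?thesis
    proof (rule homotopic_wedge_ext[where K = "\<lambda>p. centred c (K p)", OF _ _ _ homotopic_within_refl[OF f] homotopic_within_refl[OF g] x0])
      show "continuous_on (cube m \<times> {0..1::real}) (\<lambda>p. centred c (K p))"
        unfolding centred_def[abs_def]
        by (rule continuous_on_coordinatewise_then_product) (intro continuous_intros Kc)
      show "centred c (K (t, s)) \<notin> open_cube (2 * n)" if ts: "t \<in> cube m" "s \<in> {0..1}" for t s
      proof
        assume "centred c (K (t, s)) \<in> open_cube (2 * n)"
        then have lt: "\<bar>c * K (t, s) k\<bar> < 1/2" if "k < 2 * n" for k
          using that unfolding open_cube_def centred_def by (auto simp: abs_less_iff dest!: spec[of _ k])
        have "c * N (t, s) = (\<Sum>k<2*n. \<bar>c * K (t, s) k\<bar>)"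
          using c1(1) by (simp add: N_def sum_distrib_left abs_mult)
        also have "\<dots> < (\<Sum>k<2*n. 1/2)" by (rule sum_strict_mono) (use lt n in \<open>auto simp: lessThan_empty_iff\<close>)
        also have "\<dots> = real n" by simp
        also have "\<dots> \<le> c * N p" by (rule cN)
        also have "\<dots> \<le> c * N (t, s)" using p(2)[of "(t, s)"] ts c1(1) by (intro mult_left_mono) auto
        finally show False by simp
      qed
      show "centred c (K (t, s)) \<notin> open_cube n \<and> (\<lambda>i. centred c (K (t, s)) (n + i)) \<notin> open_cube n"
        if ts: "t \<in> cube_boundary m" "s \<in> {0..1}" for t s
        using small[of "K (t, s)" 1] small[of "K (t, s)" "n + 1"] bd[OF ts] n unfolding open_cube_def
        by (auto intro!: exI[of _ 1] simp: not_less)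
    qed
  qed
  show ?thesis unfolding eventually_at_top_linorder using main by blast
qed

text \<open>
  Greater than \<open>1\<close> over the concentric cube of half the size (\<open>crad m t < 1/2\<close>), which is the shadow of
  the product of the cubes, and low enough on the boundary to absorb the linear terms that are
  added to it below.
\<close>

definition height :: "nat \<Rightarrow> (nat \<Rightarrow> real) \<Rightarrow> real" where
  "height m t = 6 - 10 * crad m t"

lemma continuous_on_height: "continuous_on S (height m)"
  unfolding height_def[abs_def] by (intro continuous_intros)

lemma continuous_on_fst_height [continuous_intros]: "continuous_on S (\<lambda>p. height m (fst p))"
  unfolding height_def by (intro continuous_intros)

lemma height_boundary: "t \<in> cube_boundary m \<Longrightarrow> height m t = -4"
  by (simp add: height_def crad_boundary)

lemma cvec_cube: "t \<in> cube m \<Longrightarrow> i \<le> m \<Longrightarrow> \<bar>cvec t i\<bar> \<le> 1"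
  using cvec_le_crad[of i m t] crad_le_1[of t m] by linarith

lemma height_eq_6: "(\<And>i. i \<le> m \<Longrightarrow> cvec t i = 0) \<Longrightarrow> height m t = 6"
  using crad_attained[of m t] by (auto simp: height_def)

text \<open>The coordinates 1 and n + 1 have half-sum \<open>height\<close> and half-difference
  \<open>cvec t (n + 1)\<close>: this is the graph of the height in the direction of the sum of the
  two second coordinate vectors. Position 0, where \<open>cvec\<close> is 0, receives
  \<open>cvec t 1\<close>. So the first coordinates of the factors, at positions 0 and n, depend on
  one cube coordinate each and not on the height.\<close>

definition tent :: "nat \<Rightarrow> (nat \<Rightarrow> real) \<Rightarrow> nat \<Rightarrow> real" where
  "tent n t k =
     (if k = 0 then cvec t 1
      else if k = 1 then cvec t (n + 1) + height (2 * n - 1) t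
      else if k = n + 1 then - cvec t (n + 1) + height (2 * n - 1) t
      else cvec t k)"

text \<open>After scaling, the boundary of the cube is deformed linearly to a graph over the
  hyperplane of \<open>cvec\<close> in the diagonal direction. By \<open>collapse_affine\<close> the
  point is always A * cvec t + B on the diagonal.\<close>

lemma homotopic_whitehead_cvec:
  assumes n: "2 \<le> n" and x0: "x0 \<in> topspace X"
    and f: "f \<in> loops n X x0" "f ` cube n \<subseteq> E" and g: "g \<in> loops n X x0" "g ` cube n \<subseteq> E"
  shows "\<forall>\<^sub>F c in at_top. homotopic_within (2 * n - 1) X x0 (insert x0 E) (whitehead n n f g)
      (\<lambda>t. wedge_ext n x0 f g (centred c (\<lambda>k. cvec t k + height (2 * n - 1) t)))"
proof -
  define m where "m = 2 * n - 1"
  have m: "2 * n = Suc m" using n by (simp add: m_def)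
  have scale: "homotopic_within m X x0 (insert x0 E) (whitehead n n f g)
      (\<lambda>t. wedge_ext n x0 f g (centred c (\<lambda>k. collapse m t k - 1/2)))" if c: "1 \<le> c" for c
  proof -
    define K where "K p = centred (1 + snd p * (c - 1)) (\<lambda>k. collapse m (fst p) k - 1/2)"
      for p :: "(nat \<Rightarrow> real) \<times> real"
    have ge1: "1 \<le> 1 + s * (c - 1)" if "s \<in> {0..1}" for s using that c by simp
    have "homotopic_within m X x0 (insert x0 E) (\<lambda>t. wedge_ext n x0 f g (K (t, 0))) (\<lambda>t. wedge_ext n x0 f g (K (t, 1)))"
    proof (rule homotopic_wedge_ext[OF _ _ _ homotopic_within_refl[OF f] homotopic_within_refl[OF g] x0])
      show "continuous_on (cube m \<times> {0..1::real}) K"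
        unfolding K_def[abs_def] centred_def[abs_def]
        by (rule continuous_on_coordinatewise_then_product) (intro continuous_intros)
      show "K (t, s) \<notin> open_cube (2 * n)" if ts: "t \<in> cube m" "s \<in> {0..1}" for t s
      proof -
        obtain k where k: "k < 2 * n" "collapse m t k = 0 \<or> collapse m t k = 1"
          using collapse_in_boundary[OF ts(1)] unfolding m cube_boundary_def by auto
        have "K (t, s) k \<le> 0 \<or> 1 \<le> K (t, s) k"
          using k(2)
        proof
          assume "collapse m t k = 0"
          then show ?thesis using ge1[OF ts(2)] by (simp add: K_def centred_def)
        next
          assume "collapse m t k = 1"
          then have "K (t, s) k = 1/2 + (1 + s * (c - 1)) / 2" by (simp add: K_def centred_def)
          moreover have "1 \<le> 1/2 + d / 2" if "1 \<le> d" for d :: real using that by simp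
          ultimately show ?thesis using ge1[OF ts(2)] by metis
        qed
        then show ?thesis using k(1) unfolding open_cube_def by force
      qed
      show "K (t, s) \<notin> open_cube n \<and> (\<lambda>i. K (t, s) (n + i)) \<notin> open_cube n"
        if ts: "t \<in> cube_boundary m" "s \<in> {0..1}" for t s
      proof -
        have "K (t, s) k \<le> 0" for k using collapse_boundary[OF ts(1)] ge1[OF ts(2)] by (simp add: K_def centred_def)
        then show ?thesis using n unfolding open_cube_def by (auto intro!: exI[of _ 0] simp: not_less)
      qed
    qed
    then show ?thesis
    proof (rule homotopic_within_cong)
      fix t assume "t \<in> cube m"
      then show "wedge_ext n x0 f g (K (t, 0)) = whitehead n n f g t"
        using whitehead_eq_wedge_ext[OF f(1) g(1), of t] n by (simp add: K_def centred_def[abs_def] m_def)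
    qed (simp add: K_def)
  qed
  define K where "K p k = (1 - snd p) * (collapse m (fst p) k - 1/2) + snd p * (cvec (fst p) k + height m (fst p))"
    for p :: "(nat \<Rightarrow> real) \<times> real" and k
  have "\<forall>\<^sub>F c in at_top. homotopic_within m X x0 (insert x0 E)
    (\<lambda>t. wedge_ext n x0 f g (centred c (K (t, 0)))) (\<lambda>t. wedge_ext n x0 f g (centred c (K (t, 1))))"
  proof (rule homotopic_wedge_ext_centred[OF _ n _ _ f g x0])
    show "continuous_on (cube m \<times> {0..1::real}) K"
      unfolding K_def[abs_def] by (rule continuous_on_coordinatewise_then_product) (intro continuous_intros)
    show "\<exists>k<2 * n. K (t, s) k \<noteq> 0" if ts: "t \<in> cube m" "s \<in> {0..1}" for t s
    proof (rule ccontr)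
      assume "\<not> ?thesis"
      then have 0: "K (t, s) k = 0" if "k \<le> m" for k using that m by auto
      obtain \<alpha> \<beta> where a: "\<And>i. i \<le> m \<Longrightarrow> collapse m t i = \<alpha> * cvec t i + \<beta>" "0 \<le> \<alpha>"
        "0 < crad m t \<Longrightarrow> crad m t < 1 \<Longrightarrow> 0 < \<alpha>"
        using collapse_affine[of m t] ts(1) by metis
      define A where "A = (1 - s) * \<alpha> + s"
      define B where "B = (1 - s) * (\<beta> - 1/2) + s * height m t"
      have AB: "K (t, s) k = A * cvec t k + B" if "k \<le> m" for k
        using a(1)[OF that] by (simp add: K_def A_def B_def algebra_simps)
      \<comment> \<open>The entry of \<open>cvec\<close> at index 0 is 0, so coordinate 0 is
        \<open>B\<close> itself. It remains to exclude A = 0, which would force a boundary point at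
        s = 0, and the centre, where both ends are positive.\<close>
      then have "B = 0" using 0[of 0] by simp
      then have Az: "A * cvec t k = 0" if "k \<le> m" for k using AB[OF that] 0[OF that] by simp
      have r0: "crad m t \<noteq> 0"
      proof
        assume r: "crad m t = 0"
        then have "K (t, s) 0 = (1 - s) / 2 + s * 6" by (simp add: K_def collapse_alt height_def)
        moreover have "0 \<le> s" "s \<le> 1" using ts(2) by auto
        ultimately show False using 0[of 0] by (simp add: field_simps)
      qed
      have "A \<noteq> 0"
      proof
        assume "A = 0"
        then have s: "s = 0" "\<alpha> = 0"
          using ts(2) a(2) unfolding A_def by (auto simp: add_nonneg_eq_0_iff)
        then have "crad m t = 1" using a(3) r0 crad_nonneg[of m t] crad_le_1[OF ts(1)] by fastforce
        then have "K (t, s) 0 = -1/2" using s by (simp add: K_def collapse_alt)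
        then show False using 0[of 0] by simp
      qed
      then have "cvec t k = 0" if "k \<le> m" for k using Az[OF that] by simp
      then show False using r0 crad_attained[of m t] by auto
    qed
    show "K (t, s) 1 \<le> -1/2 \<and> K (t, s) (n + 1) \<le> -1/2" if ts: "t \<in> cube_boundary m" "s \<in> {0..1}" for t s
    proof -
      have "K (t, s) k \<le> -1/2" if "k \<le> m" for k
      proof -
        have z: "cvec t k \<le> 1" using cvec_cube[OF cube_boundary_subset[OF ts(1)] that] by simp
        have "s * (cvec t k - 4) \<le> s * (-1/2)" using ts(2) z by (intro mult_left_mono) auto
        moreover have "K (t, s) k = (1 - s) * (-1/2) + s * (cvec t k - 4)"
          using collapse_boundary[OF ts(1)] height_boundary[OF ts(1)] by (simp add: K_def)
        moreover have "(1 - s) * (-1/2) + s * (-1/2) = -1/2" by (simp add: algebra_simps)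
        ultimately show ?thesis by linarith
      qed
      then show ?thesis using n by (simp add: m_def)
    qed
  qed
  moreover have "\<forall>\<^sub>F c in at_top. (1::real) \<le> c" by (rule eventually_ge_at_top)
  ultimately show ?thesis unfolding m_def[symmetric]
  proof eventually_elim
    case (elim c)
    have "homotopic_within m X x0 (insert x0 E) (\<lambda>t. wedge_ext n x0 f g (centred c (\<lambda>k. collapse m t k - 1/2)))
       (\<lambda>t. wedge_ext n x0 f g (centred c (\<lambda>k. cvec t k + height m t)))"
      using elim(1) by (simp add: K_def[abs_def])
    then show ?case using homotopic_within_trans[OF scale[OF elim(2)]] by blast
  qed
qed

text \<open>For s at most 1/2, s^3 <= s^2/2 leaves 1 - 5s + 7s^2, which has negative discriminant;
  for larger s, s^3 <= s^2 leaves (2s - 1)(3s - 1).\<close>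

lemma tent_det_pos: fixes s :: real assumes "s \<in> {0..1}" shows "0 < 1 - 5 * s + 8 * s^2 - 2 * s^3"
proof (cases "s \<le> 1/2")
  case True
  have "s^2 * s \<le> s^2 * (1/2)" using True by (intro mult_left_mono) auto
  moreover have "1 - 5 * s + 7 * s^2 = 7 * (s - 5/14)^2 + 3/28" by (simp add: power2_eq_square algebra_simps)
  moreover have "0 \<le> (s - 5/14)^2" by simp
  moreover have "s^3 = s^2 * s" by (simp add: power3_eq_cube power2_eq_square)
  ultimately show ?thesis by linarith
next
  case False
  have "s^2 * s \<le> s^2 * 1" using assms by (intro mult_left_mono) auto
  moreover have "1 - 5 * s + 6 * s^2 = (2 * s - 1) * (3 * s - 1)" by (simp add: power2_eq_square algebra_simps)
  moreover have "0 < (2 * s - 1) * (3 * s - 1)" using False by (intro mult_pos_pos) auto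
  moreover have "s^3 = s^2 * s" by (simp add: power3_eq_cube power2_eq_square)
  ultimately show ?thesis by linarith
qed

text \<open>In the open cube all entries of \<open>cvec t\<close> would be below 1/2 in absolute
  value, so the height would exceed 1, while it is the half-sum of two coordinates of absolute value
  below 1/2.\<close>

lemma centred_tent_off_cube:
  assumes n: "2 \<le> n" and d: "1 \<le> d"
  shows "centred d (tent n t) \<notin> open_cube (2 * n)"
proof
  define m where "m = 2 * n - 1"
  have m: "2 * n = Suc m" using n by (simp add: m_def)
  assume "centred d (tent n t) \<in> open_cube (2 * n)"
  then have lt: "\<bar>d * tent n t k\<bar> < 1/2" if "k < 2 * n" for k
    using that unfolding open_cube_def centred_def by (auto simp: abs_less_iff dest!: spec[of _ k])
  have lt': "\<bar>tent n t k\<bar> < 1/2" if "k < 2 * n" for k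
  proof -
    have "1 * \<bar>tent n t k\<bar> \<le> d * \<bar>tent n t k\<bar>" using d by (intro mult_right_mono) auto
    then show ?thesis using lt[OF that] d by (simp add: abs_mult)
  qed
  have X: "\<bar>cvec t (n + 1) + height m t\<bar> < 1/2" "\<bar>- cvec t (n + 1) + height m t\<bar> < 1/2"
    using lt'[of 1] lt'[of "n + 1"] n by (auto simp: tent_def m_def)
  have "\<bar>cvec t k\<bar> < 1/2" if k: "k \<le> m" for k
  proof (cases "k = 0 \<or> k = 1 \<or> k = n + 1")
    case True
    moreover have "\<bar>cvec t (n + 1)\<bar> < 1/2" using X by linarith
    moreover have "\<bar>cvec t 1\<bar> < 1/2" using lt'[of 0] n by (simp add: tent_def)
    moreover have "\<bar>cvec t 0\<bar> < 1/2" by simp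
    ultimately show ?thesis using True by metis
  next
    case False
    then show ?thesis using lt'[of k] k m by (auto simp: tent_def)
  qed
  then have "crad m t < 1/2" using crad_attained[of m t] by metis
  then have "1 < height m t" by (simp add: height_def)
  then show False using X by linarith
qed

text \<open>
  The linear homotopy is nonzero because its determinant in the variables
  \<open>cvec t 1\<close>, \<open>cvec t (n + 1)\<close> and \<open>height\<close> is \<open>1 - 5s + 8s\<^sup>2 - 2s\<^sup>3\<close>.
\<close>

lemma homotopic_whitehead_tent:
  assumes n: "2 \<le> n" and x0: "x0 \<in> topspace X"
    and f: "f \<in> loops n X x0" "f ` cube n \<subseteq> E" and g: "g \<in> loops n X x0" "g ` cube n \<subseteq> E"
  shows "homotopic_within (2 * n - 1) X x0 (insert x0 E) (whitehead n n f g)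
      (\<lambda>t. wedge_ext n x0 f g (centred 1 (tent n t)))"
proof -
  define m where "m = 2 * n - 1"
  have m: "2 * n = Suc m" using n by (simp add: m_def)
  define K where "K p k = (1 - snd p) * (cvec (fst p) k + height m (fst p)) + snd p * tent n (fst p) k"
    for p :: "(nat \<Rightarrow> real) \<times> real" and k
  have "\<forall>\<^sub>F c in at_top. homotopic_within m X x0 (insert x0 E)
    (\<lambda>t. wedge_ext n x0 f g (centred c (K (t, 0)))) (\<lambda>t. wedge_ext n x0 f g (centred c (K (t, 1))))"
  proof (rule homotopic_wedge_ext_centred[OF _ n _ _ f g x0])
    show "continuous_on (cube m \<times> {0..1::real}) K"
      unfolding K_def[abs_def] tent_def[abs_def]
      by (rule continuous_on_coordinatewise_then_product) (intro continuous_intros)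
    show "\<exists>k<2 * n. K (t, s) k \<noteq> 0" if ts: "t \<in> cube m" "s \<in> {0..1}" for t s
    proof (rule ccontr)
      assume "\<not> ?thesis"
      then have 0: "K (t, s) k = 0" if "k \<le> m" for k using that m by auto
      define h a b where "h = height m t" and "a = cvec t 1" and "b = cvec t (n + 1)"
      have e0: "(1 - s) * h + s * a = 0" using 0[of 0] by (simp add: K_def tent_def h_def a_def)
      have e1: "(1 - s) * (a + h) + s * (b + h) = 0"
        using 0[of 1] n by (simp add: K_def tent_def h_def a_def b_def m_def)
      have e2: "(1 - s) * (b + h) + s * (- b + h) = 0"
        using 0[of "n + 1"] n by (simp add: K_def tent_def h_def b_def m_def)
      have h: "h = - ((1 - 2 * s) * b)" using e2 by (simp add: algebra_simps)
      have sa: "s * a = (1 - s) * (1 - 2 * s) * b" using e0 unfolding h by (simp add: algebra_simps)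
      have sa': "(1 - s) * a = (1 - 3 * s) * b" using e1 unfolding h by (simp add: algebra_simps)
      have "s * ((1 - s) * a) = (1 - s) * (s * a)" by simp
      then have "b * (1 - 5 * s + 8 * s^2 - 2 * s^3) = 0"
        unfolding sa sa' by (simp add: algebra_simps power2_eq_square power3_eq_cube)
      then have b0: "b = 0" using tent_det_pos[OF ts(2)] by auto
      have h0: "h = 0" using h b0 by simp
      have a0: "a = 0" using sa sa' b0 by (cases "s = 0") auto
      have "cvec t k = 0" if k: "k \<le> m" for k
      proof (cases "k = 1 \<or> k = n + 1")
        case True then show ?thesis using a0 b0 by (auto simp: a_def b_def)
      next
        case False
        then show ?thesis
          using 0[OF k] h0 by (cases "k = 0") (auto simp: K_def tent_def h_def algebra_simps)
      qed
      then have "h = 6" unfolding h_def by (rule height_eq_6)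
      then show False using h0 by simp
    qed
    show "K (t, s) 1 \<le> -1/2 \<and> K (t, s) (n + 1) \<le> -1/2" if ts: "t \<in> cube_boundary m" "s \<in> {0..1}" for t s
    proof -
      have z: "\<bar>cvec t 1\<bar> \<le> 1" "\<bar>cvec t (n + 1)\<bar> \<le> 1"
        by (rule cvec_cube[OF cube_boundary_subset[OF ts(1)]], use n in \<open>simp add: m_def\<close>)+
      have "(1 - s) * u + s * v \<le> -1/2" if "u \<le> -3" "v \<le> -3" for u v :: real
      proof -
        have "(1 - s) * u + s * v \<le> (1 - s) * (-3) + s * (-3)"
          using ts(2) that by (intro add_mono mult_left_mono) auto
        then show ?thesis by simp
      qed
      from this[of "cvec t 1 - 4" "cvec t (n + 1) - 4"] this[of "cvec t (n + 1) - 4" "- cvec t (n + 1) - 4"]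
      show ?thesis using z height_boundary[OF ts(1)] n by (simp add: K_def tent_def m_def)
    qed
  qed
  moreover have "\<forall>\<^sub>F c in at_top. (1::real) \<le> c" by (rule eventually_ge_at_top)
  moreover note homotopic_whitehead_cvec[OF n x0 f g]
  ultimately have "\<forall>\<^sub>F c in at_top. 1 \<le> c \<and> homotopic_within m X x0 (insert x0 E) (whitehead n n f g)
      (\<lambda>t. wedge_ext n x0 f g (centred c (tent n t)))"
    unfolding m_def[symmetric]
  proof eventually_elim
    case (elim c)
    have "homotopic_within m X x0 (insert x0 E) (\<lambda>t. wedge_ext n x0 f g (centred c (\<lambda>k. cvec t k + height m t)))
       (\<lambda>t. wedge_ext n x0 f g (centred c (tent n t)))"
      using elim(1) by (simp add: K_def[abs_def])
    then show ?case using homotopic_within_trans[OF elim(3)] elim(2) by blast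
  qed
  then obtain c where c: "1 \<le> c" and hom: "homotopic_within m X x0 (insert x0 E) (whitehead n n f g)
      (\<lambda>t. wedge_ext n x0 f g (centred c (tent n t)))"
    using eventually_happens[of _ "at_top :: real filter"] by (auto simp: trivial_limit_at_top_linorder)
  \<comment> \<open>Here the scaling is undone: unlike the intermediate stages, the tent avoids the
    cube at every scale from 1 on.\<close>
  define L where "L p = centred (1 + (1 - snd p) * (c - 1)) (tent n (fst p))" for p :: "(nat \<Rightarrow> real) \<times> real"
  have ge1: "1 \<le> 1 + (1 - s) * (c - 1)" if "s \<in> {0..1}" for s using that c by simp
  have "homotopic_within m X x0 (insert x0 E) (\<lambda>t. wedge_ext n x0 f g (L (t, 0))) (\<lambda>t. wedge_ext n x0 f g (L (t, 1)))"
  proof (rule homotopic_wedge_ext[OF _ _ _ homotopic_within_refl[OF f] homotopic_within_refl[OF g] x0])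
    show "continuous_on (cube m \<times> {0..1::real}) L"
      unfolding L_def[abs_def] centred_def[abs_def] tent_def[abs_def]
      by (rule continuous_on_coordinatewise_then_product) (intro continuous_intros)
    show "L (t, s) \<notin> open_cube (2 * n)" if ts: "t \<in> cube m" "s \<in> {0..1}" for t s
      unfolding L_def using centred_tent_off_cube[OF n ge1[OF ts(2)]] by simp
    show "L (t, s) \<notin> open_cube n \<and> (\<lambda>i. L (t, s) (n + i)) \<notin> open_cube n"
      if ts: "t \<in> cube_boundary m" "s \<in> {0..1}" for t s
    proof -
      define d where "d = 1 + (1 - s) * (c - 1)"
      have d: "1 \<le> d" using ge1[OF ts(2)] by (simp add: d_def)
      have z: "\<bar>cvec t (n + 1)\<bar> \<le> 1"
        by (rule cvec_cube[OF cube_boundary_subset[OF ts(1)]]) (use n in \<open>simp add: m_def\<close>)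
      have "tent n t 1 \<le> -1" "tent n t (n + 1) \<le> -1"
        using z height_boundary[OF ts(1)] n by (auto simp: tent_def m_def)
      then have "d * tent n t 1 \<le> 1 * (-1)" "d * tent n t (n + 1) \<le> 1 * (-1)"
        using d mult_mono'[of 1 d 1 "- tent n t 1"] mult_mono'[of 1 d 1 "- tent n t (n + 1)"] by auto
      then have "L (t, s) 1 \<le> 0" "L (t, s) (n + 1) \<le> 0" by (auto simp: L_def centred_def d_def)
      then show ?thesis using n unfolding open_cube_def by (auto intro!: exI[of _ 1] simp: not_less)
    qed
  qed
  then have "homotopic_within m X x0 (insert x0 E) (\<lambda>t. wedge_ext n x0 f g (centred c (tent n t)))
     (\<lambda>t. wedge_ext n x0 f g (centred 1 (tent n t)))"
    by (simp add: L_def)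
  then show ?thesis using homotopic_within_trans[OF hom] by (simp add: m_def)
qed

section \<open>Exchanging the factors of a Whitehead product\<close>

text \<open>Pairs off the coordinates whose signs are to be reversed, so that a half turn in the
  plane of each pair reverses two of them.\<close>

lemma fixpoint_free_involution:
  assumes "finite S" "even (card S)"
  shows "\<exists>\<pi>. \<forall>i\<in>S. \<pi> i \<in> S \<and> \<pi> i \<noteq> i \<and> \<pi> (\<pi> i) = i"
  using assms
proof (induction "card S" arbitrary: S rule: less_induct)
  case less
  show ?case
  proof (cases "S = {}")
    case False
    then obtain a where a: "a \<in> S" by blast
    then have "0 < card S" using less.prems by (auto simp: card_gt_0_iff)
    then have "1 < card S" using less.prems(2) by (cases "card S = 1") auto
    then have "card (S - {a}) \<noteq> 0" using a less.prems by (simp add: card_Diff_singleton)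
    then obtain b where b: "b \<in> S" "b \<noteq> a" by (metis Diff_iff card.empty equals0I singletonI)
    have c: "card (S - {a, b}) = card S - 2" using a b less.prems by (simp add: card_Diff_subset)
    then obtain \<pi> where p: "\<forall>i\<in>S - {a, b}. \<pi> i \<in> S - {a, b} \<and> \<pi> i \<noteq> i \<and> \<pi> (\<pi> i) = i"
      using less.hyps[of "S - {a, b}"] less.prems \<open>1 < card S\<close> by auto
    have "\<forall>i\<in>S. (\<pi>(a := b, b := a)) i \<in> S \<and> (\<pi>(a := b, b := a)) i \<noteq> i \<and> (\<pi>(a := b, b := a)) ((\<pi>(a := b, b := a)) i) = i"
    proof
      fix i assume i: "i \<in> S"
      show "(\<pi>(a := b, b := a)) i \<in> S \<and> (\<pi>(a := b, b := a)) i \<noteq> i \<and> (\<pi>(a := b, b := a)) ((\<pi>(a := b, b := a)) i) = i"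
      proof (cases "i = a \<or> i = b")
        case True then show ?thesis using a b by auto
      next
        case False
        then have "\<pi> i \<in> S - {a, b} \<and> \<pi> i \<noteq> i \<and> \<pi> (\<pi> i) = i" using p i by blast
        then show ?thesis using False by auto
      qed
    qed
    then show ?thesis by blast
  qed simp
qed

lemma rotation_eq_0:
  fixes u v \<theta> :: real
  assumes "cos \<theta> * u + sin \<theta> * v = 0" "cos \<theta> * v - sin \<theta> * u = 0"
  shows "u = 0" "v = 0"
proof -
  have *: "cos \<theta> * cos \<theta> + sin \<theta> * sin \<theta> = 1" by (rule sin_cos_squared_add3)
  have "cos \<theta> * (cos \<theta> * u + sin \<theta> * v) - sin \<theta> * (cos \<theta> * v - sin \<theta> * u) = (cos \<theta> * cos \<theta> + sin \<theta> * sin \<theta>) * u"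
    "sin \<theta> * (cos \<theta> * u + sin \<theta> * v) + cos \<theta> * (cos \<theta> * v - sin \<theta> * u) = (cos \<theta> * cos \<theta> + sin \<theta> * sin \<theta>) * v"
    by (simp_all only: algebra_simps)
  then show "u = 0" "v = 0" unfolding assms * by simp_all
qed

lemma rotation_le_2:
  fixes u v \<theta> :: real
  assumes "\<bar>u\<bar> \<le> 1" "\<bar>v\<bar> \<le> 1" "\<bar>a\<bar> = 1"
  shows "cos \<theta> * u + a * sin \<theta> * v \<le> 2"
proof -
  have "\<bar>cos \<theta> * u\<bar> \<le> 1 * 1" "\<bar>a * sin \<theta> * v\<bar> \<le> (1 * 1) * 1"
    unfolding abs_mult using assms by (intro mult_mono; simp)+
  then show ?thesis by linarith
qed

definition flip_first :: "nat \<Rightarrow> (nat \<Rightarrow> real) \<Rightarrow> nat \<Rightarrow> real" where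
  "flip_first e t = (if even e then t else t(0 := 1 - t 0))"

lemma loop_sign_alt: "loop_sign e f t = f (flip_first e t)"
  by (simp add: loop_sign_def flip_first_def loop_uminus_def)

lemma cvec_flip_first: "cvec (flip_first e t) i = (if i = 1 \<and> odd e then - cvec t 1 else cvec t i)"
  by (cases i) (auto simp: flip_first_def)

lemma crad_flip_first [simp]: "crad m (flip_first e t) = crad m t"
proof -
  have "\<bar>cvec (flip_first e t) i\<bar> = \<bar>cvec t i\<bar>" for i by (auto simp: cvec_flip_first)
  then show ?thesis by (simp add: crad_def)
qed

lemma flip_first_cube: "0 < m \<Longrightarrow> t \<in> cube m \<Longrightarrow> flip_first e t \<in> cube m"
  by (auto simp: flip_first_def cube_def)

lemma flip_first_open_cube: "0 < m \<Longrightarrow> flip_first e t \<in> open_cube m \<longleftrightarrow> t \<in> open_cube m"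
  by (auto simp: flip_first_def open_cube_def)

lemma flip_first_boundary: "0 < m \<Longrightarrow> t \<in> cube_boundary m \<Longrightarrow> flip_first e t \<in> cube_boundary m"
  using cube_boundary_iff flip_first_open_cube flip_first_cube cube_boundary_subset by metis

lemma homotopic_within_loop_sign:
  assumes "homotopic_within m X x0 E f g" "0 < m"
  shows "homotopic_within m X x0 E (loop_sign e f) (loop_sign e g)"
proof -
  obtain H where H: "continuous_map (top_of_set (cube m \<times> {0..1::real})) X H"
    "\<And>t. t \<in> cube m \<Longrightarrow> H (t, 0) = f t" "\<And>t. t \<in> cube m \<Longrightarrow> H (t, 1) = g t"
    "\<And>t s. t \<in> cube_boundary m \<Longrightarrow> s \<in> {0..1} \<Longrightarrow> H (t, s) = x0"
    "\<And>t s. t \<in> cube m \<Longrightarrow> s \<in> {0..1} \<Longrightarrow> H (t, s) \<in> E"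
    using assms(1) by (rule homotopic_withinE) blast
  show ?thesis
  proof (rule homotopic_withinI[where H = "\<lambda>p. H (flip_first e (fst p), snd p)"])
    have "continuous_on (cube m \<times> {0..1::real}) (\<lambda>p. flip_first e (fst p))"
    proof (rule continuous_on_coordinatewise_then_product)
      have "flip_first e t i = (if i = 0 \<and> odd e then 1 - t 0 else t i)" for t i by (auto simp: flip_first_def)
      then show "continuous_on (cube m \<times> {0..1::real}) (\<lambda>p. flip_first e (fst p) i)" for i
        by (simp only:) (intro continuous_intros)
    qed
    then have "continuous_on (cube m \<times> {0..1::real}) (\<lambda>p. (flip_first e (fst p), snd p))"
      by (intro continuous_on_Pair continuous_on_snd continuous_on_id)
    then show "continuous_map (top_of_set (cube m \<times> {0..1::real})) X (\<lambda>p. H (flip_first e (fst p), snd p))"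
      by (rule continuous_map_compose_on[OF H(1)]) (use flip_first_cube[OF assms(2)] in auto)
  qed (use H flip_first_cube[OF assms(2)] flip_first_boundary[OF assms(2)] in \<open>auto simp: loop_sign_alt\<close>)
qed

text \<open>The height and the entries of \<open>cvec\<close> may be treated as independent
  variables of a linear map: if all of them vanish at a zero of \<open>K\<close>, the height would
  be 6 there. On the boundary the height is -4, so linear terms up to 2 keep the coordinates 1 and n
  + 1 below -1/2.\<close>

lemma homotopic_wedge_ext_kernel:
  assumes K: "continuous_on (cube (2 * n - 1) \<times> {0..1::real}) K" and n: "2 \<le> n"
    and zero: "\<And>t s k. t \<in> cube (2 * n - 1) \<Longrightarrow> s \<in> {0..1} \<Longrightarrow> (\<And>k. k < 2 * n \<Longrightarrow> K (t, s) k = 0) \<Longrightarrow>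
       height (2 * n - 1) t = 0 \<and> (\<forall>k<2 * n. cvec t k = 0)"
    and bd: "\<And>t s. t \<in> cube_boundary (2 * n - 1) \<Longrightarrow> s \<in> {0..1} \<Longrightarrow>
       K (t, s) 1 \<le> height (2 * n - 1) t + 2 \<and> K (t, s) (n + 1) \<le> height (2 * n - 1) t + 2"
    and f: "f \<in> loops n X x0" "f ` cube n \<subseteq> E" and g: "g \<in> loops n X x0" "g ` cube n \<subseteq> E"
    and x0: "x0 \<in> topspace X"
    and K0: "\<And>t k. k < 2 * n \<Longrightarrow> K (t, 0) k = a t k" and K1: "\<And>t k. k < 2 * n \<Longrightarrow> K (t, 1) k = b t k"
  shows "\<forall>\<^sub>F c in at_top. homotopic_within (2 * n - 1) X x0 (insert x0 E)
    (\<lambda>t. wedge_ext n x0 f g (centred c (a t))) (\<lambda>t. wedge_ext n x0 f g (centred c (b t)))"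
proof -
  have "\<forall>\<^sub>F c in at_top. homotopic_within (2 * n - 1) X x0 (insert x0 E)
    (\<lambda>t. wedge_ext n x0 f g (centred c (K (t, 0)))) (\<lambda>t. wedge_ext n x0 f g (centred c (K (t, 1))))"
  proof (rule homotopic_wedge_ext_centred[OF K n _ _ f g x0])
    show "\<exists>k<2 * n. K (t, s) k \<noteq> 0" if ts: "t \<in> cube (2 * n - 1)" "s \<in> {0..1}" for t s
    proof (rule ccontr)
      assume "\<not> ?thesis"
      then have *: "height (2 * n - 1) t = 0" "\<forall>k<2 * n. cvec t k = 0" using zero[OF ts] by auto
      then have "height (2 * n - 1) t = 6" using n by (intro height_eq_6) auto
      then show False using *(1) by simp
    qed
    show "K (t, s) 1 \<le> -1/2 \<and> K (t, s) (n + 1) \<le> -1/2" if ts: "t \<in> cube_boundary (2 * n - 1)" "s \<in> {0..1}" for t s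
      using bd[OF ts] height_boundary[OF ts(1)] by simp
  qed
  then show ?thesis
  proof eventually_elim
    case (elim c)
    have "wedge_ext n x0 f g (centred c (K (t, 0))) = wedge_ext n x0 f g (centred c (a t))"
      "wedge_ext n x0 f g (centred c (K (t, 1))) = wedge_ext n x0 f g (centred c (b t))" for t
      by (rule wedge_ext_cong; simp add: centred_def K0 K1)+
    then show ?case using elim by simp
  qed
qed

text \<open>
  Exchanging the factors composes with the exchange of the coordinates \<open>k\<close> and \<open>n + k\<close>. In terms of
  the coordinates \<open>cvec t k\<close>, \<open>k \<ge> 1\<close>, the identity is joined to this linear map, up to the sign
  \<open>(-1)\<^sup>n\<close> in the first coordinate, by a rotation of the planes \<open>(k, n + k)\<close>, a rotation
  of the planes \<open>(n + i, n + \<pi> i)\<close> that corrects an even number of signs, and a shear.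
\<close>

lemma homotopic_wedge_ext_swap:
  assumes n: "2 \<le> n" and x0: "x0 \<in> topspace X"
    and f: "f \<in> loops n X x0" "f ` cube n \<subseteq> E" and g: "g \<in> loops n X x0" "g ` cube n \<subseteq> E"
  defines "m \<equiv> 2 * n - 1"
  shows "\<forall>\<^sub>F c in at_top. homotopic_within m X x0 (insert x0 E)
      (\<lambda>t. wedge_ext n x0 f g (centred c (\<lambda>k. cvec t k + height m t)))
      (\<lambda>t. wedge_ext n x0 f g (centred c (\<lambda>k. cvec (flip_first n t) (if k < n then n + k else k - n) + height m t)))"
proof -
  have m: "2 * n = Suc m" using n by (simp add: m_def)
  have cv: "\<bar>cvec t k\<bar> \<le> 1" if "t \<in> cube_boundary m" "k < 2 * n" for t k
    using cvec_cube[OF cube_boundary_subset[OF that(1)]] that(2) m by simp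
  \<comment> \<open>The second half after the quarter turn of the planes (k, n + k), 0 < k < n,
    which leaves coordinate n alone.\<close>
  define v where "v t i = (if i = 0 then cvec t n else - cvec t i)" for t and i :: nat
  \<comment> \<open>The entries of \<open>v\<close> whose signs must change. Index 0 belongs to them
    because the final shear starts from - cvec t n at coordinate n; for odd n the entry 1 already
    has the sign of \<open>flip_first n\<close>. So the set has n or n - 1 elements, an even number
    in both cases: this is the origin of the sign (-1)^n.\<close>
  define S where "S = (if even n then {..<n} else {..<n} - {1})"
  have "finite S" "even (card S)" using n by (auto simp: S_def)
  from fixpoint_free_involution[OF this] obtain \<pi> where
    pi: "\<And>i. i \<in> S \<Longrightarrow> \<pi> i \<in> S \<and> \<pi> i \<noteq> i \<and> \<pi> (\<pi> i) = i" by blast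
  have Sn: "i < n" if "i \<in> S" for i using that by (auto simp: S_def split: if_splits)
  \<comment> \<open>Opposite signs on the two members of a pair, so that together they perform one
    rotation.\<close>
  define \<sigma> where "\<sigma> i = (if i < \<pi> i then 1 else - 1 :: real)" for i
  have sig: "\<sigma> (\<pi> i) = - \<sigma> i" "\<bar>\<sigma> i\<bar> = 1" if "i \<in> S" for i using pi[OF that] by (auto simp: \<sigma>_def)
  have cont_v: "continuous_on A (\<lambda>p. v (fst p) i)" for A :: "((nat \<Rightarrow> real) \<times> real) set" and i
    unfolding v_def by (intro continuous_intros)
  define a0 where "a0 t k = cvec t k + height m t" for t k
  define a1 where "a1 t k = (if k = 0 then 0 else if k < n then cvec t (n + k) else v t (k - n)) + height m t" for t k
  define a2 where "a2 t k = (if k = 0 then 0 else if k < n then cvec t (n + k)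
      else if k - n \<in> S then - v t (k - n) else v t (k - n)) + height m t" for t k
  define a3 where "a3 t k = cvec (flip_first n t) (if k < n then n + k else k - n) + height m t" for t k
  define K1 where "K1 p k = (if k = 0 then 0
      else if k < n then cos (snd p * (pi / 2)) * cvec (fst p) k + 1 * sin (snd p * (pi / 2)) * cvec (fst p) (n + k)
      else if k = n then cvec (fst p) n
      else cos (snd p * (pi / 2)) * cvec (fst p) k + -1 * sin (snd p * (pi / 2)) * cvec (fst p) (k - n)) + height m (fst p)"
    for p k
  define K2 where "K2 p k = (if k = 0 then 0 else if k < n then cvec (fst p) (n + k)
      else if k - n \<in> S then cos (snd p * pi) * v (fst p) (k - n) + \<sigma> (k - n) * sin (snd p * pi) * v (fst p) (\<pi> (k - n))
      else v (fst p) (k - n)) + height m (fst p)"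
    for p k
  \<comment> \<open>The difference of the coordinates 0 and n is constantly \<open>cvec t n\<close>,
    so their vanishing forces both \<open>cvec t n\<close> and the height to vanish.\<close>
  define K3 where "K3 p k = (if k = 0 then snd p * cvec (fst p) n
     else if k = n then - (1 - snd p) * cvec (fst p) n
     else a3 (fst p) k - height m (fst p)) + height m (fst p)" for p k
  have h1: "\<forall>\<^sub>F c in at_top. homotopic_within m X x0 (insert x0 E)
    (\<lambda>t. wedge_ext n x0 f g (centred c (a0 t))) (\<lambda>t. wedge_ext n x0 f g (centred c (a1 t)))"
  proof (rule homotopic_wedge_ext_kernel[OF _ n _ _ f g x0, where K = K1, folded m_def])
    show "continuous_on (cube m \<times> {0..1::real}) K1"
      unfolding K1_def[abs_def] by (rule continuous_on_coordinatewise_then_product) (intro continuous_intros)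
    show "height m t = 0 \<and> (\<forall>k<2 * n. cvec t k = 0)"
      if "t \<in> cube m" "s \<in> {0..1}" and 0: "\<And>k. k < 2 * n \<Longrightarrow> K1 (t, s) k = 0" for t s
    proof -
      have h: "height m t = 0" using 0[of 0] n by (simp add: K1_def)
      have z: "cvec t i = 0" "cvec t (n + i) = 0" if "0 < i" "i < n" for i
        using rotation_eq_0[of "s * (pi / 2)" "cvec t i" "cvec t (n + i)"] 0[of i] 0[of "n + i"] that h
        by (auto simp: K1_def)
      have "cvec t n = 0" using 0[of n] n h by (simp add: K1_def)
      moreover have "k = 0 \<or> k < n \<or> k = n \<or> (0 < k - n \<and> k - n < n \<and> k = n + (k - n))" if "k < 2 * n" for k
        using that by auto
      ultimately show ?thesis using z h by (metis cvec_simps(1) gr_zeroI)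
    qed
    show "K1 (t, s) 1 \<le> height m t + 2 \<and> K1 (t, s) (n + 1) \<le> height m t + 2"
      if t: "t \<in> cube_boundary m" "s \<in> {0..1}" for t s
      using rotation_le_2[OF cv[OF t(1), of 1] cv[OF t(1), of "n + 1"], of 1 "s * (pi / 2)"]
        rotation_le_2[OF cv[OF t(1), of "n + 1"] cv[OF t(1), of 1], of "-1" "s * (pi / 2)"] n
      by (simp add: K1_def)
    show "K1 (t, 0) k = a0 t k" if "k < 2 * n" for t k by (auto simp: K1_def a0_def)
    show "K1 (t, 1) k = a1 t k" if "k < 2 * n" for t k by (auto simp: K1_def a1_def v_def)
  qed
  have h2: "\<forall>\<^sub>F c in at_top. homotopic_within m X x0 (insert x0 E)
    (\<lambda>t. wedge_ext n x0 f g (centred c (a1 t))) (\<lambda>t. wedge_ext n x0 f g (centred c (a2 t)))"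
  proof (rule homotopic_wedge_ext_kernel[OF _ n _ _ f g x0, where K = K2, folded m_def])
    show "continuous_on (cube m \<times> {0..1::real}) K2"
      unfolding K2_def[abs_def]
      by (rule continuous_on_coordinatewise_then_product) (intro continuous_intros cont_v)
    show "height m t = 0 \<and> (\<forall>k<2 * n. cvec t k = 0)"
      if "t \<in> cube m" "s \<in> {0..1}" and 0: "\<And>k. k < 2 * n \<Longrightarrow> K2 (t, s) k = 0" for t s
    proof -
      have h: "height m t = 0" using 0[of 0] n by (simp add: K2_def)
      have z1: "cvec t (n + i) = 0" if "0 < i" "i < n" for i
        using 0[of i] that h by (simp add: K2_def)
      have vS: "v t i = 0" if i: "i \<in> S" for i
      proof -
        let ?c = "cos (s * pi)" and ?s = "sin (s * pi)"
        have "?c * v t i + \<sigma> i * ?s * v t (\<pi> i) = 0" "?c * v t (\<pi> i) - \<sigma> i * ?s * v t i = 0"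
          using 0[of "n + i"] 0[of "n + \<pi> i"] Sn[OF i] Sn[of "\<pi> i"] pi[OF i] sig[OF i] i h n by (auto simp: K2_def)
        moreover have "\<sigma> i = 1 \<or> \<sigma> i = -1" by (simp add: \<sigma>_def)
        ultimately show ?thesis
          using rotation_eq_0(1)[of "s * pi" "v t i" "v t (\<pi> i)"] rotation_eq_0(1)[of "- (s * pi)" "v t i" "v t (\<pi> i)"]
          by auto
      qed
      have v: "v t i = 0" if "i < n" for i
        using vS 0[of "n + i"] that h n by (cases "i \<in> S") (auto simp: K2_def)
      have "cvec t n = 0" using v[of 0] n by (simp add: v_def)
      moreover have "cvec t i = 0" if "i < n" for i using v[OF that] by (cases "i = 0") (auto simp: v_def)
      moreover have "k < n \<or> k = n \<or> (0 < k - n \<and> k - n < n \<and> k = n + (k - n))" if "k < 2 * n" for k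
        using that by auto
      ultimately show ?thesis using z1 h by metis
    qed
    show "K2 (t, s) 1 \<le> height m t + 2 \<and> K2 (t, s) (n + 1) \<le> height m t + 2"
      if t: "t \<in> cube_boundary m" "s \<in> {0..1}" for t s
    proof -
      have v1: "\<bar>v t i\<bar> \<le> 1" if "i < n" for i using cv[OF t(1), of n] cv[OF t(1), of i] that by (auto simp: v_def)
      have "K2 (t, s) 1 \<le> height m t + 2" using cv[OF t(1), of "n + 1"] n by (simp add: K2_def)
      moreover have "K2 (t, s) (n + 1) \<le> height m t + 2"
      proof (cases "1 \<in> S")
        case True
        then show ?thesis
          using rotation_le_2[OF v1[of 1] v1[of "\<pi> 1"] sig(2)[OF True], of "s * pi"] n pi[OF True] Sn by (simp add: K2_def)
      next
        case False
        then show ?thesis using v1[of 1] n by (simp add: K2_def)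
      qed
      ultimately show ?thesis by simp
    qed
    show "K2 (t, 0) k = a1 t k" if "k < 2 * n" for t k by (auto simp: K2_def a1_def)
    show "K2 (t, 1) k = a2 t k" if "k < 2 * n" for t k by (auto simp: K2_def a2_def)
  qed
  have h3: "\<forall>\<^sub>F c in at_top. homotopic_within m X x0 (insert x0 E)
    (\<lambda>t. wedge_ext n x0 f g (centred c (a2 t))) (\<lambda>t. wedge_ext n x0 f g (centred c (a3 t)))"
  proof (rule homotopic_wedge_ext_kernel[OF _ n _ _ f g x0, where K = K3, folded m_def])
    show "continuous_on (cube m \<times> {0..1::real}) K3"
      unfolding K3_def[abs_def] a3_def cvec_flip_first
      by (rule continuous_on_coordinatewise_then_product) (intro continuous_intros)
    have a3: "a3 t k - height m t = cvec (flip_first n t) (if k < n then n + k else k - n)" for t k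
      by (simp add: a3_def)
    show "height m t = 0 \<and> (\<forall>k<2 * n. cvec t k = 0)"
      if "t \<in> cube m" "s \<in> {0..1}" and 0: "\<And>k. k < 2 * n \<Longrightarrow> K3 (t, s) k = 0" for t s
    proof -
      have "s * cvec t n + height m t = 0" "- (1 - s) * cvec t n + height m t = 0"
        using 0[of 0] 0[of n] n by (auto simp: K3_def)
      then have zn: "cvec t n = 0" and h: "height m t = 0" by (auto simp: algebra_simps)
      have z1: "cvec t (n + i) = 0" if "0 < i" "i < n" for i
        using 0[of i] that h n by (simp add: K3_def a3_def cvec_flip_first)
      have z2: "cvec t i = 0" if "0 < i" "i < n" for i
        using 0[of "n + i"] that h n by (auto simp: K3_def a3_def cvec_flip_first split: if_splits)
      have "k = 0 \<or> k < n \<or> k = n \<or> (0 < k - n \<and> k - n < n \<and> k = n + (k - n))" if "k < 2 * n" for k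
        using that by auto
      then show ?thesis using z1 z2 zn h by (metis cvec_simps(1) gr_zeroI)
    qed
    show "K3 (t, s) 1 \<le> height m t + 2 \<and> K3 (t, s) (n + 1) \<le> height m t + 2"
      if t: "t \<in> cube_boundary m" "s \<in> {0..1}" for t s
      using cv[OF t(1), of 1] cv[OF t(1), of "n + 1"] n
      by (auto simp: K3_def a3 cvec_flip_first simp del: cvec_simps(2))
    show "K3 (t, 0) k = a2 t k" if "k < 2 * n" for t k
      using that n by (auto simp: K3_def a2_def a3 cvec_flip_first v_def S_def simp del: cvec_simps(2))
    show "K3 (t, 1) k = a3 t k" if "k < 2 * n" for t k
      using n by (auto simp: K3_def a3_def cvec_flip_first simp del: cvec_simps(2))
  qed
  show ?thesis
    unfolding a0_def[symmetric] a3_def[symmetric]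
    using h1 h2 h3
  proof eventually_elim
    case (elim c)
    from homotopic_within_trans[OF homotopic_within_trans[OF elim(1,2)] elim(3)] show ?case .
  qed
qed

lemma wedge_ext_swap:
  assumes "f \<in> loops n X x0" "g \<in> loops n X x0" "q \<notin> open_cube (2 * n)"
  shows "wedge_ext n x0 f g (\<lambda>k. q (if k < n then n + k else k - n)) = wedge_ext n x0 g f q"
proof -
  let ?q = "\<lambda>k. q (if k < n then n + k else k - n)"
  have c: "clamp_cube n ?q = clamp_cube n (\<lambda>i. q (n + i))" "clamp_cube n (\<lambda>i. ?q (n + i)) = clamp_cube n q"
    by (auto simp: clamp_cube_def)
  have "f (clamp_cube n (\<lambda>i. q (n + i))) = x0 \<or> g (clamp_cube n q) = x0"
    using assms loop_clamp_trivial unfolding open_cube_double by metis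
  then show ?thesis unfolding wedge_ext_def c by auto
qed

text \<open>Each stage works for all large scales, so one scale serves all of them. The exchanged
  graph for (f, g) is the graph for (g, f) at the flipped point, because the height is invariant
  under \<open>flip_first\<close>.\<close>

lemma homotopic_tent_swap:
  assumes n: "2 \<le> n" and x0: "x0 \<in> topspace X"
    and f: "f \<in> loops n X x0" "f ` cube n \<subseteq> E" and g: "g \<in> loops n X x0" "g ` cube n \<subseteq> E"
  shows "homotopic_within (2 * n - 1) X x0 (insert x0 E)
    (\<lambda>t. wedge_ext n x0 f g (centred 1 (tent n t))) (loop_sign n (whitehead n n g f))"
proof -
  define m where "m = 2 * n - 1"
  have m: "2 * n = Suc m" "0 < m" using n by (auto simp: m_def)
  \<comment> \<open>Coordinate 0 is the height itself. At scale 10 a point in the cube would have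
    height below 1/20 in absolute value and radius below 1/10, but the latter makes the height
    exceed 5.\<close>
  have off: "\<forall>\<^sub>F c in at_top. \<forall>t\<in>cube m. centred c (\<lambda>k. cvec t k + height m t) \<notin> open_cube (2 * n)"
  proof (rule eventually_mono[OF eventually_ge_at_top[of 10]])
    fix c :: real assume c: "10 \<le> c"
    show "\<forall>t\<in>cube m. centred c (\<lambda>k. cvec t k + height m t) \<notin> open_cube (2 * n)"
    proof (intro ballI notI)
      fix t assume "centred c (\<lambda>k. cvec t k + height m t) \<in> open_cube (2 * n)"
      then have lt: "\<bar>c * (cvec t k + height m t)\<bar> < 1/2" if "k < 2 * n" for k
        using that unfolding open_cube_def centred_def by (auto simp: abs_less_iff dest!: spec[of _ k])
      have lt': "10 * \<bar>cvec t k + height m t\<bar> < 1/2" if "k < 2 * n" for k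
      proof -
        have "10 * \<bar>cvec t k + height m t\<bar> \<le> c * \<bar>cvec t k + height m t\<bar>" using c by (intro mult_right_mono) auto
        then show ?thesis using lt[OF that] c by (simp add: abs_mult)
      qed
      obtain i where i: "i \<le> m" "\<bar>cvec t i\<bar> = crad m t" using crad_attained by blast
      have "10 * \<bar>height m t\<bar> < 1/2" using lt'[of 0] n by simp
      moreover have "10 * \<bar>cvec t i + height m t\<bar> < 1/2" using lt'[of i] i(1) m by simp
      ultimately have "10 * \<bar>cvec t i\<bar> < 1"
        using abs_triangle_ineq4[of "cvec t i + height m t" "height m t"] by simp
      then have "10 * crad m t < 1" using i(2) by simp
      then have "5 < height m t" by (simp add: height_def)
      then show False using \<open>10 * \<bar>height m t\<bar> < 1/2\<close> by linarith
    qed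
  qed
  note start = homotopic_whitehead_cvec[OF n x0, folded m_def]
  have "\<forall>\<^sub>F c in at_top. homotopic_within m X x0 (insert x0 E) (whitehead n n f g)
        (\<lambda>t. wedge_ext n x0 f g (centred c (\<lambda>k. cvec t k + height m t))) \<and>
      homotopic_within m X x0 (insert x0 E) (\<lambda>t. wedge_ext n x0 f g (centred c (\<lambda>k. cvec t k + height m t)))
        (\<lambda>t. wedge_ext n x0 f g (centred c (\<lambda>k. cvec (flip_first n t) (if k < n then n + k else k - n) + height m t))) \<and>
      homotopic_within m X x0 (insert x0 E) (whitehead n n g f)
        (\<lambda>t. wedge_ext n x0 g f (centred c (\<lambda>k. cvec t k + height m t))) \<and>
      (\<forall>t\<in>cube m. centred c (\<lambda>k. cvec t k + height m t) \<notin> open_cube (2 * n))"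
    by (intro eventually_conj start[OF f g] homotopic_wedge_ext_swap[OF n x0 f g, folded m_def] start[OF g f] off)
  then obtain c where elim: "homotopic_within m X x0 (insert x0 E) (whitehead n n f g)
        (\<lambda>t. wedge_ext n x0 f g (centred c (\<lambda>k. cvec t k + height m t)))"
      "homotopic_within m X x0 (insert x0 E) (\<lambda>t. wedge_ext n x0 f g (centred c (\<lambda>k. cvec t k + height m t)))
        (\<lambda>t. wedge_ext n x0 f g (centred c (\<lambda>k. cvec (flip_first n t) (if k < n then n + k else k - n) + height m t)))"
      "homotopic_within m X x0 (insert x0 E) (whitehead n n g f)
        (\<lambda>t. wedge_ext n x0 g f (centred c (\<lambda>k. cvec t k + height m t)))"
      "\<forall>t\<in>cube m. centred c (\<lambda>k. cvec t k + height m t) \<notin> open_cube (2 * n)"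
    using eventually_happens[of _ "at_top :: real filter"] by (auto simp: trivial_limit_at_top_linorder)
  have "homotopic_within m X x0 (insert x0 E) (loop_sign n (whitehead n n g f))
    (loop_sign n (\<lambda>t. wedge_ext n x0 g f (centred c (\<lambda>k. cvec t k + height m t))))"
    by (rule homotopic_within_loop_sign[OF elim(3) m(2)])
  then have "homotopic_within m X x0 (insert x0 E) (loop_sign n (whitehead n n g f))
    (\<lambda>t. wedge_ext n x0 f g (centred c (\<lambda>k. cvec (flip_first n t) (if k < n then n + k else k - n) + height m t)))"
  proof (rule homotopic_within_cong)
    fix t assume t: "t \<in> cube m"
    define q where "q = centred c (\<lambda>k. cvec (flip_first n t) k + height m t)"
    have "q \<notin> open_cube (2 * n)"
      using elim(4) flip_first_cube[OF m(2) t, of n] by (force simp: q_def height_def)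
    from wedge_ext_swap[OF f(1) g(1) this]
    show "loop_sign n (\<lambda>t. wedge_ext n x0 g f (centred c (\<lambda>k. cvec t k + height m t))) t =
      wedge_ext n x0 f g (centred c (\<lambda>k. cvec (flip_first n t) (if k < n then n + k else k - n) + height m t))"
      by (simp add: loop_sign_alt q_def centred_def[abs_def] height_def)
  qed simp
  from homotopic_within_trans[OF homotopic_within_trans[OF elim(1,2)] homotopic_within_sym[OF this]]
  show ?thesis
    using homotopic_within_trans[OF homotopic_within_sym[OF homotopic_whitehead_tent[OF n x0 f g]]]
    by (simp add: m_def)
qed

section \<open>Decomposition of a Whitehead product of infinite sums\<close>

lemma disjoint_intervals_subset:
  "disjoint_intervals J a b \<Longrightarrow> A \<subseteq> J \<Longrightarrow> disjoint_intervals A a b"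
  by (simp add: disjoint_intervals_def subset_iff)

lemma disjoint_intervals_rescale:
  assumes "disjoint_intervals J a b" "l < u" "\<And>j. j \<in> J \<Longrightarrow> l \<le> a j \<and> b j \<le> u"
  shows "disjoint_intervals J (\<lambda>j. (a j - l) / (u - l)) (\<lambda>j. (b j - l) / (u - l))"
proof -
  have "(x - l) / (u - l) \<le> (y - l) / (u - l) \<longleftrightarrow> x \<le> y" "(x - l) / (u - l) < (y - l) / (u - l) \<longleftrightarrow> x < y" for x y
    using assms(2) by (auto simp: divide_le_cancel divide_less_cancel)
  moreover have "(b j - l) / (u - l) \<le> 1" "0 \<le> (a j - l) / (u - l)" if "j \<in> J" for j
    using assms(2) assms(3)[OF that] by (auto simp: divide_le_eq_1)
  ultimately show ?thesis using assms(1) unfolding disjoint_intervals_def by auto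
qed

text \<open>
  The intervals \<open>[slot_lo j, slot_hi j]\<close>, \<open>j \<ge> 1\<close>, converge to \<open>1\<close>. The intervals of twice the
  length with the same centres are disjoint, and so are twice \<open>[slot_lo j, slot_hi j]\<close> and
  twice \<open>[slot_lo (j + 1), 1]\<close>.
\<close>

definition quarter :: "nat \<Rightarrow> real" where "quarter j = (1/4) ^ j"
definition slot_lo :: "nat \<Rightarrow> real" where "slot_lo j = 1 - 9/8 * quarter j"
definition slot_hi :: "nat \<Rightarrow> real" where "slot_hi j = 1 - 7/8 * quarter j"

lemma quarter_props:
  shows quarter_pos: "0 < quarter j" and quarter_Suc: "quarter (Suc j) = quarter j / 4"
    and quarter_mono: "j \<le> k \<Longrightarrow> quarter k \<le> quarter j"
    and quarter_le: "1 \<le> j \<Longrightarrow> quarter j \<le> 1/4"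
    and quarter_less: "j < k \<Longrightarrow> quarter k \<le> quarter j / 4"
proof -
  show 1: "0 < quarter j" "quarter (Suc j) = quarter j / 4" for j by (simp_all add: quarter_def)
  show 2: "quarter k \<le> quarter j" if "j \<le> k" for j k
    unfolding quarter_def using that by (intro power_decreasing) auto
  show "quarter j \<le> 1/4" if "1 \<le> j" using 2[OF that] by (simp add: quarter_def)
  show "quarter k \<le> quarter j / 4" if "j < k" using 2[of "Suc j" k] 1(2)[of j] that by simp
qed

lemma slot_disjoint: "A \<subseteq> {1..} \<Longrightarrow> disjoint_intervals A slot_lo slot_hi"
proof (erule disjoint_intervals_subset[rotated])
  have ord: "slot_hi j \<le> slot_lo k" if "j < k" for j k
    using quarter_pos[of j] quarter_less[OF that] by (simp add: slot_lo_def slot_hi_def)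
  show "disjoint_intervals {1..} slot_lo slot_hi"
    unfolding disjoint_intervals_def
  proof (intro conjI ballI impI)
    fix j k :: nat assume "j \<noteq> k"
    then show "slot_hi j \<le> slot_lo k \<or> slot_hi k \<le> slot_lo j" using ord by (meson linorder_neqE_nat)
  next
    fix j :: nat assume "j \<in> {1..}"
    then show "0 \<le> slot_lo j" "slot_lo j < slot_hi j" "slot_hi j \<le> 1"
      using quarter_pos[of j] quarter_le[of j] by (auto simp: slot_lo_def slot_hi_def)
  qed
qed

lemma slot_less: "slot_lo j < slot_hi j" "slot_hi j < 1" "slot_lo j < 1"
  using quarter_pos[of j] by (auto simp: slot_lo_def slot_hi_def)

lemma slot_lo_mono: "j \<le> k \<Longrightarrow> slot_lo j \<le> slot_lo k"
  using quarter_mono[of j k] by (simp add: slot_lo_def)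

text \<open>The sum over the original slots after j, stretched by the affine map from
  [slot_lo (Suc j), 1] to [0, 1]. Put back over that interval, its terms occupy exactly their own
  slots.\<close>

definition tail_sum :: "'a \<Rightarrow> (nat \<Rightarrow> (nat \<Rightarrow> real) \<Rightarrow> 'a) \<Rightarrow> nat \<Rightarrow> (nat \<Rightarrow> real) \<Rightarrow> 'a" where
  "tail_sum x0 f j = interval_sum {j<..}
     (\<lambda>k. (slot_lo k - slot_lo (Suc j)) / (1 - slot_lo (Suc j)))
     (\<lambda>k. (slot_hi k - slot_lo (Suc j)) / (1 - slot_lo (Suc j))) x0 f"

lemma tail_disjoint:
  "disjoint_intervals {j<..}
     (\<lambda>k. (slot_lo k - slot_lo (Suc j)) / (1 - slot_lo (Suc j)))
     (\<lambda>k. (slot_hi k - slot_lo (Suc j)) / (1 - slot_lo (Suc j)))"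
  by (intro disjoint_intervals_rescale slot_disjoint)
     (use slot_less slot_lo_mono in \<open>auto simp: less_imp_le Suc_le_eq\<close>)

text \<open>
  The square \<open>[0,1]\<^sup>2\<close> of the first coordinates \<open>x\<^sub>0, y\<^sub>0\<close> of \<open>I\<^sup>n \<times> I\<^sup>n\<close> contains the products of slots,
  which are grouped into the rectangles with index \<open>(0, j)\<close>, \<open>(1, j)\<close> and \<open>(2, j)\<close>: slot \<open>j\<close> times
  slot \<open>j\<close>, slot \<open>j\<close> times all later slots, and all later slots times slot \<open>j\<close>. The Boolean
  \<open>b\<close> selects the factor \<open>x\<close> (\<^const>\<open>True\<close>) or \<open>y\<close> (\<^const>\<open>False\<close>).
\<close>

definition tail_kind :: "bool \<Rightarrow> nat" where "tail_kind b = (if b then 2 else 1)"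

text \<open>The coordinate of the (2n-1)-cube that governs the first coordinate of factor
  \<open>b\<close>: on the tent the latter is 2 * t (coord n b) - 1/2.\<close>

definition coord :: "nat \<Rightarrow> bool \<Rightarrow> nat" where "coord n b = (if b then 0 else n - 1)"

definition core_lo :: "bool \<Rightarrow> nat \<times> nat \<Rightarrow> real" where
  "core_lo b = (\<lambda>(c, j). if c = tail_kind b then slot_lo (Suc j) else slot_lo j)"

definition core_hi :: "bool \<Rightarrow> nat \<times> nat \<Rightarrow> real" where
  "core_hi b = (\<lambda>(c, j). if c = tail_kind b then 1 else slot_hi j)"

text \<open>
  The interval of twice the length, in the coordinate \<open>t\<close> with \<open>x = 2t - 1/2\<close> of \<^const>\<open>tent\<close>.
\<close>

definition dbl_lo :: "real \<Rightarrow> real \<Rightarrow> real" where "dbl_lo l u = (3 * l - u + 1) / 4"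
definition dbl_hi :: "real \<Rightarrow> real \<Rightarrow> real" where "dbl_hi l u = (3 * u - l + 1) / 4"

text \<open>The base of the small tent over a rectangle. Since a tent exceeds 1 only over the
  concentric half of its base, the base has twice the length of the rectangle in the two coordinates
  that cut the slots, and full length in the others.\<close>

definition box_lo :: "nat \<Rightarrow> nat \<times> nat \<Rightarrow> nat \<Rightarrow> real" where
  "box_lo n \<alpha> i =
     (if i = 0 then dbl_lo (core_lo True \<alpha>) (core_hi True \<alpha>)
      else if i = n - 1 then dbl_lo (core_lo False \<alpha>) (core_hi False \<alpha>) else 0)"

definition box_hi :: "nat \<Rightarrow> nat \<times> nat \<Rightarrow> nat \<Rightarrow> real" where
  "box_hi n \<alpha> i =
     (if i = 0 then dbl_hi (core_lo True \<alpha>) (core_hi True \<alpha>)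
      else if i = n - 1 then dbl_hi (core_lo False \<alpha>) (core_hi False \<alpha>) else 1)"

definition rects :: "(nat \<times> nat) set" where "rects = {..2} \<times> {1..}"

lemma dbl_slot: "dbl_lo (slot_lo j) (slot_hi j) = 3/4 - 5/8 * quarter j"
    "dbl_hi (slot_lo j) (slot_hi j) = 3/4 - 3/8 * quarter j"
    "dbl_lo (slot_lo (Suc j)) 1 = 3/4 - 27/128 * quarter j"
    "dbl_hi (slot_lo (Suc j)) 1 = 3/4 + 9/128 * quarter j"
  by (auto simp: dbl_lo_def dbl_hi_def slot_lo_def slot_hi_def quarter_Suc field_simps)

lemma core_less: "core_lo b \<alpha> < core_hi b \<alpha>"
  using slot_less by (auto simp: core_lo_def core_hi_def split: prod.splits)

lemma box_coord:
  assumes "2 \<le> n"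
  shows "box_lo n \<alpha> (coord n b) = dbl_lo (core_lo b \<alpha>) (core_hi b \<alpha>)"
    and "box_hi n \<alpha> (coord n b) = dbl_hi (core_lo b \<alpha>) (core_hi b \<alpha>)"
  using assms by (cases b; simp add: box_lo_def box_hi_def coord_def)+

lemma box_bounds:
  assumes "\<alpha> \<in> rects" shows "0 \<le> box_lo n \<alpha> i \<and> box_lo n \<alpha> i < box_hi n \<alpha> i \<and> box_hi n \<alpha> i \<le> 1"
proof -
  obtain c j where \<alpha>: "\<alpha> = (c, j)" "1 \<le> j" using assms by (auto simp: rects_def)
  have "0 \<le> dbl_lo (core_lo b \<alpha>) (core_hi b \<alpha>) \<and> dbl_lo (core_lo b \<alpha>) (core_hi b \<alpha>) < dbl_hi (core_lo b \<alpha>) (core_hi b \<alpha>)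
      \<and> dbl_hi (core_lo b \<alpha>) (core_hi b \<alpha>) \<le> 1" for b
    using quarter_pos[of j] quarter_le[OF \<alpha>(2)]
    by (simp add: \<alpha> core_lo_def core_hi_def dbl_slot)
  then show ?thesis by (simp add: box_lo_def box_hi_def)
qed

lemma boxes_apart:
  assumes n: "2 \<le> n" and ab: "\<alpha> \<in> rects" "\<beta> \<in> rects" "\<alpha> \<noteq> \<beta>"
  shows "\<exists>b. box_hi n \<alpha> (coord n b) \<le> box_lo n \<beta> (coord n b) \<or> box_hi n \<beta> (coord n b) \<le> box_lo n \<alpha> (coord n b)"
proof -
  have less: "\<exists>b. box_hi n (c, j) (coord n b) \<le> box_lo n (d, k) (coord n b)" if "j < k" for c j d k
  proof -
    \<comment> \<open>For j < k separate in a factor where the box (c, j) lies over slot j and not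
      over a tail: that is y if c = 2 and x otherwise.\<close>
    have "box_hi n (c, j) (coord n (c \<noteq> 2)) \<le> box_lo n (d, k) (coord n (c \<noteq> 2))"
      using quarter_pos[of j] quarter_pos[of k] quarter_less[OF that]
      by (simp add: box_coord[OF n] core_lo_def core_hi_def tail_kind_def dbl_slot)
    then show ?thesis by blast
  qed
  have eq: "\<exists>b. box_hi n (c, j) (coord n b) \<le> box_lo n (d, j) (coord n b)" if "c < d" "d \<le> 2" for c j d
  proof -
    \<comment> \<open>For equal indices separate in the factor where (d, j) is a tail; as c < d, the
      box (c, j) lies over slot j there.\<close>
    have "box_hi n (c, j) (coord n (d = 2)) \<le> box_lo n (d, j) (coord n (d = 2))"
      using quarter_pos[of j] that
      by (simp add: box_coord[OF n] core_lo_def core_hi_def tail_kind_def dbl_slot)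
    then show ?thesis by blast
  qed
  obtain c j d k where "\<alpha> = (c, j)" "\<beta> = (d, k)" "c \<le> 2" "d \<le> 2" using ab by (auto simp: rects_def)
  then show ?thesis using less[of j k c d] less[of k j d c] eq[of c d j] eq[of d c j] ab(3)
    by (metis linorder_neqE_nat)
qed

section \<open>Heights of the small tents\<close>

definition box_height :: "nat \<Rightarrow> nat \<times> nat \<Rightarrow> (nat \<Rightarrow> real) \<Rightarrow> real" where
  "box_height n \<alpha> t = height (2 * n - 1) (clamp_cube (2 * n - 1) (rescale (box_lo n \<alpha>) (box_hi n \<alpha>) t))"

lemma height_ge: "t \<in> cube m \<Longrightarrow> -4 \<le> height m t"
  using crad_le_1[of t m] by (simp add: height_def)

lemma box_height_ge: "-4 \<le> box_height n \<alpha> t"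
  unfolding box_height_def by (rule height_ge) simp

lemma box_height_off:
  "rescale (box_lo n \<alpha>) (box_hi n \<alpha>) t \<notin> open_cube (2 * n - 1) \<Longrightarrow> box_height n \<alpha> t = -4"
  unfolding box_height_def by (intro height_boundary clamp_cube_boundary)

lemma continuous_on_box_height:
  assumes "\<alpha> \<in> rects" shows "continuous_on S (box_height n \<alpha>)"
proof -
  have "continuous_on S (\<lambda>t. clamp_cube (2 * n - 1) (rescale (box_lo n \<alpha>) (box_hi n \<alpha>) t))"
  proof (rule continuous_on_clamp_cube)
    fix i
    have "box_hi n \<alpha> i - box_lo n \<alpha> i \<noteq> 0" using box_bounds[OF assms, of n i] by simp
    then show "continuous_on S (\<lambda>t. rescale (box_lo n \<alpha>) (box_hi n \<alpha>) t i)"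
      unfolding rescale_def by (intro continuous_intros) auto
  qed
  from continuous_on_compose2[OF continuous_on_height this subset_UNIV] show ?thesis
    by (simp add: box_height_def[abs_def])
qed

text \<open>The boxes that meet \<open>slot j\<close> in the factor \<open>b\<close>, and the height function seen by it.\<close>

definition slot_rects :: "bool \<Rightarrow> nat \<Rightarrow> (nat \<times> nat) set" where
  "slot_rects b j = (\<lambda>c. (c, j)) ` ({..2} - {tail_kind b}) \<union> {tail_kind b} \<times> {1..<j}"

definition slot_height :: "nat \<Rightarrow> bool \<Rightarrow> nat \<Rightarrow> (nat \<Rightarrow> real) \<Rightarrow> real" where
  "slot_height n b j t = Max ((\<lambda>\<alpha>. box_height n \<alpha> t) ` slot_rects b j)"

text \<open>A slot meets only the boxes of its own index and the tails of smaller index. Their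
  finite number makes \<open>slot_height\<close> continuous.\<close>

lemma slot_rects_props:
  shows finite_slot_rects: "finite (slot_rects b j)"
    and slot_rects_nonempty: "slot_rects b j \<noteq> {}"
    and slot_rects_subset: "1 \<le> j \<Longrightarrow> slot_rects b j \<subseteq> rects"
  by (auto simp: slot_rects_def rects_def tail_kind_def)

lemma slot_rects_iff:
  "(c, j) \<in> rects \<Longrightarrow> (c, j) \<in> slot_rects b k \<longleftrightarrow> (if c = tail_kind b then j < k else j = k)"
  by (auto simp: slot_rects_def rects_def)

lemma slot_height_attained: "\<exists>\<alpha>\<in>slot_rects b j. box_height n \<alpha> t = slot_height n b j t"
proof -
  have "slot_height n b j t \<in> (\<lambda>\<alpha>. box_height n \<alpha> t) ` slot_rects b j"
    unfolding slot_height_def by (rule Max_in) (auto simp: finite_slot_rects slot_rects_nonempty)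
  then show ?thesis by force
qed

text \<open>Every other box is separated from this one in one of the two slot coordinates, so over
  \<open>t\<close> its height has the minimal value -4.\<close>

lemma slot_height_eq:
  assumes n: "2 \<le> n" and j: "1 \<le> j" and \<alpha>: "\<alpha> \<in> slot_rects b j"
    and "in": "\<And>b. box_lo n \<alpha> (coord n b) < t (coord n b) \<and> t (coord n b) < box_hi n \<alpha> (coord n b)"
  shows "slot_height n b j t = box_height n \<alpha> t"
  unfolding slot_height_def
proof (rule Max_eqI)
  fix y assume "y \<in> (\<lambda>\<alpha>. box_height n \<alpha> t) ` slot_rects b j"
  then obtain \<beta> where \<beta>: "\<beta> \<in> slot_rects b j" "y = box_height n \<beta> t" by blast
  show "y \<le> box_height n \<alpha> t"
  proof (cases "\<beta> = \<alpha>")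
    case False
    have rects: "\<alpha> \<in> rects" "\<beta> \<in> rects" using \<alpha> \<beta>(1) slot_rects_subset[OF j] by auto
    obtain b' where b': "box_hi n \<alpha> (coord n b') \<le> box_lo n \<beta> (coord n b') \<or> box_hi n \<beta> (coord n b') \<le> box_lo n \<alpha> (coord n b')"
      using boxes_apart[OF n rects] False by metis
    have c: "coord n b' < 2 * n - 1" using n by (auto simp: coord_def)
    have "rescale (box_lo n \<beta>) (box_hi n \<beta>) t \<notin> open_cube (2 * n - 1)"
      using rescale_in_open_cube[of "2 * n - 1" "box_lo n \<beta>" "box_hi n \<beta>" t] box_bounds[OF rects(2)] b' "in"[of b'] c
      by fastforce
    then show ?thesis using box_height_off box_height_ge \<beta>(2) by simp
  qed (use \<beta> in simp)
qed (use finite_slot_rects \<alpha> in auto)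

text \<open>
  The factor \<open>b\<close> of the point of \<^const>\<open>tent\<close> over \<open>t\<close>, with prescribed height \<open>\<eta>\<close> and first
  coordinate \<open>\<xi>\<close>.
\<close>

definition tent_part :: "nat \<Rightarrow> bool \<Rightarrow> (nat \<Rightarrow> real) \<Rightarrow> real \<Rightarrow> real \<Rightarrow> nat \<Rightarrow> real" where
  "tent_part n b t \<eta> \<xi> i =
     (if i = 0 then \<xi> else if i = 1 then 1/2 + (if b then 1 else -1) * cvec t (n + 1) + \<eta>
      else 1/2 + cvec t ((if b then 0 else n) + i))"

definition tent_map :: "nat \<Rightarrow> 'a \<Rightarrow> (bool \<Rightarrow> (nat \<Rightarrow> real) \<Rightarrow> 'a) \<Rightarrow> (nat \<Rightarrow> real) \<Rightarrow> 'a" where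
  "tent_map n x0 u t = wedge_ext n x0 (u True) (u False) (centred 1 (tent n t))"

lemma tent_map_eq_iff:
  assumes n: "2 \<le> n" and u: "\<And>b. u b \<in> loops n X x0" and v: "v \<noteq> x0"
  shows "tent_map n x0 u t = v \<longleftrightarrow>
    (\<exists>b. u b (clamp_cube n (tent_part n b t (height (2 * n - 1) t) (2 * t (coord n b) - 1/2))) = v)"
proof -
  have "clamp_cube n (centred 1 (tent n t)) = clamp_cube n (tent_part n True t (height (2 * n - 1) t) (2 * t (coord n True) - 1/2))"
    using n by (auto simp: clamp_cube_def centred_def tent_def tent_part_def coord_def fun_eq_iff)
  moreover have "clamp_cube n (\<lambda>i. centred 1 (tent n t) (n + i)) =
      clamp_cube n (tent_part n False t (height (2 * n - 1) t) (2 * t (coord n False) - 1/2))"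
  proof -
    have "cvec t n = 2 * t (n - 1) - 1" using n by (cases n) auto
    then show ?thesis
      using n by (auto simp: clamp_cube_def centred_def tent_def tent_part_def coord_def fun_eq_iff)
  qed
  ultimately show ?thesis
    unfolding tent_map_def
      wedge_ext_eq_iff[OF u u centred_tent_off_cube[OF n order_refl] v]
    by (metis (full_types))
qed

lemma coord_less: "2 \<le> n \<Longrightarrow> coord n b < 2 * n - 1"
  by (cases b) (auto simp: coord_def)

text \<open>The doubling of the intervals cancels the factor 2 of the tent: a tent over the rescaled
  box sees its core as [0, 1].\<close>

lemma rescale_box_coord:
  assumes n: "2 \<le> n"
  shows "2 * rescale (box_lo n \<alpha>) (box_hi n \<alpha>) t (coord n b) - 1/2 =
    (2 * t (coord n b) - 1/2 - core_lo b \<alpha>) / (core_hi b \<alpha> - core_lo b \<alpha>)"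
proof -
  have "rescale (box_lo n \<alpha>) (box_hi n \<alpha>) t (coord n b) = (t (coord n b) - dbl_lo (core_lo b \<alpha>) (core_hi b \<alpha>)) /
      (dbl_hi (core_lo b \<alpha>) (core_hi b \<alpha>) - dbl_lo (core_lo b \<alpha>) (core_hi b \<alpha>))"
    by (simp add: rescale_def box_coord[OF n])
  also have "dbl_hi (core_lo b \<alpha>) (core_hi b \<alpha>) - dbl_lo (core_lo b \<alpha>) (core_hi b \<alpha>) = core_hi b \<alpha> - core_lo b \<alpha>"
    by (simp add: dbl_lo_def dbl_hi_def field_simps)
  finally show ?thesis using core_less[of b \<alpha>] by (simp add: dbl_lo_def field_simps)
qed

lemma cvec_rescale_box:
  assumes "k \<noteq> 1" "k \<noteq> n"
  shows "cvec (rescale (box_lo n \<alpha>) (box_hi n \<alpha>) t) k = cvec t k"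
  using assms by (cases k) (auto simp: rescale_def box_lo_def box_hi_def)

lemma tent_part_rescale:
  assumes n: "2 \<le> n" and \<alpha>: "\<alpha> \<in> rects"
    and r: "rescale (box_lo n \<alpha>) (box_hi n \<alpha>) t \<in> open_cube (2 * n - 1)"
  defines "\<tau> \<equiv> clamp_cube (2 * n - 1) (rescale (box_lo n \<alpha>) (box_hi n \<alpha>) t)"
  shows "clamp_cube n (tent_part n b \<tau> \<eta> (2 * \<tau> (coord n b) - 1/2)) =
    clamp_cube n (tent_part n b t \<eta> ((2 * t (coord n b) - 1/2 - core_lo b \<alpha>) / (core_hi b \<alpha> - core_lo b \<alpha>)))"
proof -
  have \<tau>: "\<tau> i = rescale (box_lo n \<alpha>) (box_hi n \<alpha>) t i" if "i < 2 * n - 1" for i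
    using r that by (auto simp: \<tau>_def clamp_cube_def open_cube_def)
  have z: "cvec \<tau> k = cvec t k" if "k < 2 * n" "k \<noteq> 1" "k \<noteq> n" for k
    using that \<tau>[of "k - 1"] cvec_rescale_box[of k n \<alpha> t] by (cases k) auto
  have c: "2 * \<tau> (coord n b) - 1/2 = (2 * t (coord n b) - 1/2 - core_lo b \<alpha>) / (core_hi b \<alpha> - core_lo b \<alpha>)"
    using rescale_box_coord[OF n, of \<alpha> t b] \<tau>[OF coord_less[OF n]] by simp
  show ?thesis
  proof
    fix i
    show "clamp_cube n (tent_part n b \<tau> \<eta> (2 * \<tau> (coord n b) - 1/2)) i =
      clamp_cube n (tent_part n b t \<eta> ((2 * t (coord n b) - 1/2 - core_lo b \<alpha>) / (core_hi b \<alpha> - core_lo b \<alpha>))) i"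
    proof (cases "i < n \<and> 2 \<le> i")
      case True
      then have "cvec \<tau> ((if b then 0 else n) + i) = cvec t ((if b then 0 else n) + i)" by (intro z) auto
      then show ?thesis using True by (simp add: clamp_cube_def tent_part_def)
    next
      case False
      then have "\<not> i < n \<or> i = 0 \<or> i = 1" by auto
      moreover have "cvec \<tau> (n + 1) = cvec t (n + 1)" using n by (intro z) auto
      ultimately show ?thesis unfolding clamp_cube_def tent_part_def c by auto
    qed
  qed
qed

definition rect_loop :: "'a \<Rightarrow> (bool \<Rightarrow> nat \<Rightarrow> (nat \<Rightarrow> real) \<Rightarrow> 'a) \<Rightarrow> nat \<times> nat \<Rightarrow> bool \<Rightarrow> (nat \<Rightarrow> real) \<Rightarrow> 'a" where
  "rect_loop x0 f = (\<lambda>(c, j) b. if c = tail_kind b then tail_sum x0 (f b) j else f b j)"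

text \<open>For a tail, stretching the core to [0, 1] and then each stretched slot of
  \<open>tail_sum\<close> to [0, 1] composes to the stretching of the slot itself.\<close>

lemma rect_loop_eq_iff:
  assumes n: "2 \<le> n" and \<alpha>: "\<alpha> \<in> rects" and f: "\<And>j. 1 \<le> j \<Longrightarrow> f b j \<in> loops n X x0" and v: "v \<noteq> x0"
  shows "rect_loop x0 f \<alpha> b (clamp_cube n (tent_part n b t \<eta> ((\<xi> - core_lo b \<alpha>) / (core_hi b \<alpha> - core_lo b \<alpha>)))) = v \<longleftrightarrow>
    (\<exists>j\<ge>1. \<alpha> \<in> slot_rects b j \<and>
      f b j (clamp_cube n (tent_part n b t \<eta> ((\<xi> - slot_lo j) / (slot_hi j - slot_lo j)))) = v)"
proof -
  obtain c k where ck: "\<alpha> = (c, k)" "1 \<le> k" using \<alpha> by (auto simp: rects_def)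
  have upd: "(tent_part n b t \<eta> \<xi>')(0 := \<zeta>) = tent_part n b t \<eta> \<zeta>" for \<xi>' \<zeta> by (auto simp: tent_part_def)
  show ?thesis
  proof (cases "c = tail_kind b")
    case True
    define l where "l = slot_lo (Suc k)"
    have l: "l < 1" using slot_less by (simp add: l_def)
    have "((\<xi> - l) / (1 - l) - (slot_lo j - l) / (1 - l)) / ((slot_hi j - l) / (1 - l) - (slot_lo j - l) / (1 - l))
      = (\<xi> - slot_lo j) / (slot_hi j - slot_lo j)" for j
      using l by (simp flip: diff_divide_distrib)
    note resc = this[unfolded l_def]
    have fk: "f b j \<in> loops n X x0" if "j \<in> {k<..}" for j using f that by auto
    have n0: "0 < n" using n by simp
    have "rect_loop x0 f \<alpha> b (clamp_cube n (tent_part n b t \<eta> ((\<xi> - core_lo b \<alpha>) / (core_hi b \<alpha> - core_lo b \<alpha>)))) = v \<longleftrightarrow>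
      (\<exists>j\<in>{k<..}. f b j (clamp_cube n (tent_part n b t \<eta> ((\<xi> - slot_lo j) / (slot_hi j - slot_lo j)))) = v)"
      using interval_sum_clamp_eq_iff[OF tail_disjoint[of k] v fk n0,
          where u = "tent_part n b t \<eta> ((\<xi> - slot_lo (Suc k)) / (1 - slot_lo (Suc k)))"] True
      unfolding upd by (simp add: rect_loop_def ck core_lo_def core_hi_def tail_sum_def tent_part_def[of _ _ _ _ _ 0] resc)
    moreover have "(j \<in> {k<..}) \<longleftrightarrow> 1 \<le> j \<and> \<alpha> \<in> slot_rects b j" for j
      using slot_rects_iff[of c k b j] \<alpha> ck True by auto
    ultimately show ?thesis by (metis (no_types, lifting))
  next
    case False
    then show ?thesis
      using slot_rects_iff[of c k b] \<alpha> ck by (auto simp: rect_loop_def core_lo_def core_hi_def)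
  qed
qed

text \<open>The second coordinate is at most 1/2 + 1 - 4 < 0. This lets the pieces vanish wherever
  the height has its minimal value.\<close>

lemma tent_part_low:
  assumes "\<bar>cvec t (n + 1)\<bar> \<le> 1" "\<eta> \<le> -4" "2 \<le> n"
  shows "tent_part n b t \<eta> \<xi> \<notin> open_cube n"
proof -
  have "tent_part n b t \<eta> \<xi> 1 \<le> 0" using assms by (auto simp: tent_part_def simp del: cvec_simps(2))
  then show ?thesis using assms(3) by (auto simp: open_cube_def not_less intro!: exI[of _ 1])
qed

text \<open>Two descriptions of the end of the lowering: the small tents, indexed by the boxes, and
  the loops, indexed by the slots, each at its own height \<open>slot_height\<close>.\<close>

lemma tent_pieces_eq_iff:
  assumes n: "2 \<le> n" and t: "t \<in> cube (2 * n - 1)" and v: "v \<noteq> x0"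
    and f: "\<And>j. 1 \<le> j \<Longrightarrow> f b j \<in> loops n X x0"
    and rf: "\<And>\<alpha>. \<alpha> \<in> rects \<Longrightarrow> rect_loop x0 f \<alpha> b \<in> loops n X x0"
  defines "\<tau> \<equiv> \<lambda>\<alpha>. clamp_cube (2 * n - 1) (rescale (box_lo n \<alpha>) (box_hi n \<alpha>) t)"
  shows "(\<exists>\<alpha>\<in>rects. rect_loop x0 f \<alpha> b (clamp_cube n (tent_part n b (\<tau> \<alpha>) (box_height n \<alpha> t) (2 * \<tau> \<alpha> (coord n b) - 1/2))) = v)
    \<longleftrightarrow> (\<exists>j\<ge>1. f b j (clamp_cube n (tent_part n b t (slot_height n b j t)
        ((2 * t (coord n b) - 1/2 - slot_lo j) / (slot_hi j - slot_lo j)))) = v)" (is "?L = ?R")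
proof -
  have cvec1: "\<bar>cvec s (n + 1)\<bar> \<le> 1" if "s \<in> cube (2 * n - 1)" for s
    using that n by (intro cvec_cube) auto
  have box: "rect_loop x0 f \<alpha> b (clamp_cube n (tent_part n b (\<tau> \<alpha>) (box_height n \<alpha> t) (2 * \<tau> \<alpha> (coord n b) - 1/2))) = v \<longleftrightarrow>
     (\<exists>j\<ge>1. \<alpha> \<in> slot_rects b j \<and>
      f b j (clamp_cube n (tent_part n b t (slot_height n b j t) ((2 * t (coord n b) - 1/2 - slot_lo j) / (slot_hi j - slot_lo j)))) = v)"
    if \<alpha>: "\<alpha> \<in> rects" and r: "rescale (box_lo n \<alpha>) (box_hi n \<alpha>) t \<in> open_cube (2 * n - 1)" for \<alpha>
  proof -
    have "box_lo n \<alpha> (coord n b') < t (coord n b') \<and> t (coord n b') < box_hi n \<alpha> (coord n b')" for b'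
    proof -
      have "coord n b' < 2 * n - 1" by (rule coord_less[OF n])
      then show ?thesis
        using r rescale_in_open_cube[of "2 * n - 1" "box_lo n \<alpha>" "box_hi n \<alpha>" t] box_bounds[OF \<alpha>] by blast
    qed
    then have "slot_height n b j t = box_height n \<alpha> t" if "1 \<le> j" "\<alpha> \<in> slot_rects b j" for j
      using slot_height_eq[OF n that] by blast
    then have "(\<exists>j\<ge>1. \<alpha> \<in> slot_rects b j \<and>
        f b j (clamp_cube n (tent_part n b t (box_height n \<alpha> t) ((2 * t (coord n b) - 1/2 - slot_lo j) / (slot_hi j - slot_lo j)))) = v) \<longleftrightarrow>
      (\<exists>j\<ge>1. \<alpha> \<in> slot_rects b j \<and>
        f b j (clamp_cube n (tent_part n b t (slot_height n b j t) ((2 * t (coord n b) - 1/2 - slot_lo j) / (slot_hi j - slot_lo j)))) = v)"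
      by (metis (no_types, lifting))
    then show ?thesis
      using rect_loop_eq_iff[where f = f and b = b, OF n \<alpha> f v] unfolding \<tau>_def tent_part_rescale[OF n \<alpha> r] by simp
  qed
  show ?thesis
  proof
    assume ?L
    then obtain \<alpha> where \<alpha>: "\<alpha> \<in> rects" and val: "rect_loop x0 f \<alpha> b (clamp_cube n (tent_part n b (\<tau> \<alpha>) (box_height n \<alpha> t) (2 * \<tau> \<alpha> (coord n b) - 1/2))) = v"
      by blast
    \<comment> \<open>Off the box the height would be -4, where the piece is trivial.\<close>
    have "rescale (box_lo n \<alpha>) (box_hi n \<alpha>) t \<in> open_cube (2 * n - 1)"
    proof (rule ccontr)
      assume "\<not> ?thesis"
      then have "box_height n \<alpha> t = -4" by (rule box_height_off)
      then have "tent_part n b (\<tau> \<alpha>) (box_height n \<alpha> t) (2 * \<tau> \<alpha> (coord n b) - 1/2) \<notin> open_cube n"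
        using n cvec1[of "\<tau> \<alpha>"] by (intro tent_part_low) (auto simp: \<tau>_def)
      then show False using val v loop_clamp_trivial[OF rf[OF \<alpha>]] by metis
    qed
    then show ?R using box[OF \<alpha>] val by blast
  next
    assume ?R
    then obtain j where j: "1 \<le> j" and val: "f b j (clamp_cube n (tent_part n b t (slot_height n b j t)
        ((2 * t (coord n b) - 1/2 - slot_lo j) / (slot_hi j - slot_lo j)))) = v" by blast
    obtain \<alpha> where \<alpha>: "\<alpha> \<in> slot_rects b j" "box_height n \<alpha> t = slot_height n b j t"
      using slot_height_attained by blast
    have "-4 < slot_height n b j t"
    proof (rule ccontr)
      assume "\<not> ?thesis"
      then have "tent_part n b t (slot_height n b j t) ((2 * t (coord n b) - 1/2 - slot_lo j) / (slot_hi j - slot_lo j)) \<notin> open_cube n"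
        using n cvec1[OF t] by (intro tent_part_low) auto
      then show False using val v loop_clamp_trivial[OF f[OF j]] by metis
    qed
    then have "rescale (box_lo n \<alpha>) (box_hi n \<alpha>) t \<in> open_cube (2 * n - 1)"
      using box_height_off[of n \<alpha> t] \<alpha>(2) by fastforce
    moreover have "\<alpha> \<in> rects" using \<alpha>(1) slot_rects_subset[OF j] by blast
    ultimately show ?L using box j val \<alpha>(1) by blast
  qed
qed

lemma clusters_mono:
  assumes "clusters J X x0 E" "K \<subseteq> J" "\<And>j. j \<in> K \<Longrightarrow> E' j \<subseteq> E j"
  shows "clusters K X x0 E'"
  unfolding clusters_def
proof (intro allI impI)
  fix U assume "openin X U \<and> x0 \<in> U"
  then have "finite {j \<in> J. \<not> E j \<subseteq> U}" using assms(1) by (simp add: clusters_def)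
  moreover have "{j \<in> K. \<not> E' j \<subseteq> U} \<subseteq> {j \<in> J. \<not> E j \<subseteq> U}" using assms(2,3) by blast
  ultimately show "finite {j \<in> K. \<not> E' j \<subseteq> U}" by (rule finite_subset[rotated])
qed

lemma interval_sum_loop:
  assumes "2 \<le> m" "countable J" "disjoint_intervals J a b"
    and "\<And>j. j \<in> J \<Longrightarrow> h j \<in> loops m X x0" "\<And>j. j \<in> J \<Longrightarrow> h j ` cube m \<subseteq> E j"
    and "clusters J X x0 E" "x0 \<in> topspace X"
  shows "interval_sum J a b x0 h \<in> loops m X x0"
    and "interval_sum J a b x0 h ` cube m \<subseteq> insert x0 (\<Union>j\<in>J. E j)"
proof -
  have "homotopic_within m X x0 (insert x0 (\<Union>j\<in>J. E j)) (interval_sum J a b x0 h) (interval_sum J a b x0 h)"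
    by (intro homotopic_interval_sums homotopic_within_refl assms)
  then show "interval_sum J a b x0 h \<in> loops m X x0"
    "interval_sum J a b x0 h ` cube m \<subseteq> insert x0 (\<Union>j\<in>J. E j)"
    by (rule homotopic_within_loops1, rule homotopic_within_image1)
qed

lemma homotopic_tent_cong:
  assumes n: "2 \<le> n" and x0: "x0 \<in> topspace X"
    and u: "\<And>b. homotopic_within n X x0 E (u b) (u' b)"
  shows "homotopic_within (2 * n - 1) X x0 (insert x0 E) (tent_map n x0 u) (tent_map n x0 u')"
proof -
  define K where "K p = centred 1 (tent n (fst p))" for p :: "(nat \<Rightarrow> real) \<times> real"
  have "homotopic_within (2 * n - 1) X x0 (insert x0 E)
    (\<lambda>t. wedge_ext n x0 (u True) (u False) (K (t, 0))) (\<lambda>t. wedge_ext n x0 (u' True) (u' False) (K (t, 1)))"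
  proof (rule homotopic_wedge_ext[OF _ _ _ u u x0])
    show "continuous_on (cube (2 * n - 1) \<times> {0..1::real}) K"
      unfolding K_def[abs_def] centred_def[abs_def] tent_def[abs_def]
      by (rule continuous_on_coordinatewise_then_product) (intro continuous_intros)
    show "K (t, s) \<notin> open_cube (2 * n)" for t s
      using centred_tent_off_cube[OF n order_refl] by (simp add: K_def)
    show "K (t, s) \<notin> open_cube n \<and> (\<lambda>i. K (t, s) (n + i)) \<notin> open_cube n"
      if t: "t \<in> cube_boundary (2 * n - 1)" for t s
    proof -
      have "\<bar>cvec t (n + 1)\<bar> \<le> 1"
        by (rule cvec_cube[OF cube_boundary_subset[OF t]]) (use n in simp)
      then have "K (t, s) 1 \<le> 0" "K (t, s) (n + 1) \<le> 0"
        using height_boundary[OF t] n by (auto simp: K_def centred_def tent_def simp del: cvec_simps(2))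
      then show ?thesis using n unfolding open_cube_def by (auto intro!: exI[of _ 1] simp: not_less)
    qed
  qed
  then show ?thesis by (simp add: K_def tent_map_def[abs_def])
qed

text \<open>Loops of different factors never meet during the lowering. If both factors were in their
  cubes, \<open>t\<close> would lie over the core of the rectangle that contains the product of the
  two slots. There both slots see the same height, and the large tent and the small one exceed 1;
  but the second coordinates 1/2 + cvec + height and 1/2 - cvec + height of the factors lie in (0,
  1), which forces the height below 1/2.\<close>

lemma tent_parts_disjoint:
  assumes n: "2 \<le> n" and t: "t \<in> cube (2 * n - 1)" and s: "s \<in> {0..1}" and j: "\<And>b. 1 \<le> j b"
  shows "\<exists>b. tent_part n b t ((1 - s) * height (2 * n - 1) t + s * slot_height n b (j b) t)
     ((2 * t (coord n b) - 1/2 - slot_lo (j b)) / (slot_hi (j b) - slot_lo (j b))) \<notin> open_cube n"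
proof (rule ccontr)
  define m where "m = 2 * n - 1"
  have m: "2 * n = Suc m" using n by (simp add: m_def)
  assume "\<not> ?thesis"
  then have "in": "tent_part n b t ((1 - s) * height m t + s * slot_height n b (j b) t)
     ((2 * t (coord n b) - 1/2 - slot_lo (j b)) / (slot_hi (j b) - slot_lo (j b))) \<in> open_cube n" for b
    by (simp add: m_def)
  define x where "x b = 2 * t (coord n b) - 1/2" for b
  have x: "slot_lo (j b) < x b" "x b < slot_hi (j b)" for b
  proof -
    have "0 < (x b - slot_lo (j b)) / (slot_hi (j b) - slot_lo (j b)) \<and> (x b - slot_lo (j b)) / (slot_hi (j b) - slot_lo (j b)) < 1"
      using "in"[of b] n by (auto simp: open_cube_def tent_part_def x_def dest: spec[of _ 0])
    then show "slot_lo (j b) < x b" "x b < slot_hi (j b)"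
      using slot_less(1)[of "j b"] by (auto simp: zero_less_divide_iff divide_less_eq)
  qed
  \<comment> \<open>The rectangle containing the product of the slots \<open>j True\<close> and
    \<open>j False\<close>.\<close>
  define \<alpha> where "\<alpha> = (if j True = j False then (0, j True) else if j True < j False then (1, j True) else (2, j False) :: nat \<times> nat)"
  have \<alpha>: "\<alpha> \<in> slot_rects b (j b)" for b
    using j[of True] j[of False] by (cases b) (auto simp: \<alpha>_def slot_rects_def tail_kind_def)
  then have \<alpha>r: "\<alpha> \<in> rects" using slot_rects_subset[OF j] by blast
  have core: "core_lo b \<alpha> \<le> slot_lo (j b) \<and> slot_hi (j b) \<le> core_hi b \<alpha>" for b
    using slot_lo_mono[of "Suc (j True)" "j False"] slot_lo_mono[of "Suc (j False)" "j True"] slot_less(2)[of "j b"]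
    by (cases b) (auto simp: \<alpha>_def core_lo_def core_hi_def tail_kind_def)
  have inbox: "box_lo n \<alpha> (coord n b) < t (coord n b) \<and> t (coord n b) < box_hi n \<alpha> (coord n b)" for b
    using x[of b] core[of b] unfolding box_coord[OF n] dbl_lo_def dbl_hi_def x_def by (simp add: field_simps)
  have sh: "slot_height n b (j b) t = box_height n \<alpha> t" for b
    by (rule slot_height_eq[OF n j \<alpha> inbox])
  define \<eta> where "\<eta> = (1 - s) * height m t + s * box_height n \<alpha> t"
  have d: "\<bar>cvec t (n + 1)\<bar> < 1/2" "\<bar>\<eta>\<bar> < 1/2"
  proof -
    have "0 < 1/2 + (if b then 1 else -1) * cvec t (n + 1) + \<eta> \<and> 1/2 + (if b then 1 else -1) * cvec t (n + 1) + \<eta> < 1" for b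
      using "in"[of b] n unfolding open_cube_def sh \<eta>_def[symmetric] tent_part_def by (auto dest!: spec[of _ 1] simp del: cvec_simps(2))
    from this[of True] this[of False] show "\<bar>cvec t (n + 1)\<bar> < 1/2" "\<bar>\<eta>\<bar> < 1/2" by (auto simp: abs_less_iff simp del: cvec_simps(2))
  qed
  have v: "\<bar>cvec t ((if b then 0 else n) + i)\<bar> < 1/2" if "2 \<le> i" "i < n" for b i
    using "in"[of b] that unfolding open_cube_def tent_part_def by (auto simp: abs_less_iff dest!: spec[of _ i])
  have coord: "cvec t' (if b then 1 else n) = 2 * t' (coord n b) - 1" for t' b
    using n by (cases n) (auto simp: coord_def)
  have xb: "\<bar>x b - 1/2\<bar> < 1/2" for b
  proof -
    have "0 \<le> slot_lo (j b)" using disjoint_intervalsD(1)[OF slot_disjoint[OF order_refl], of "j b"] j[of b] by simp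
    then have "0 < x b" "x b < 1" using x[of b] slot_less(2)[of "j b"] by auto
    then show ?thesis unfolding abs_less_iff by auto
  qed
  have small: "crad m t' < 1/2"
    if t': "\<And>k. k < 2 * n \<Longrightarrow> k \<noteq> 1 \<Longrightarrow> k \<noteq> n \<Longrightarrow> cvec t' k = cvec t k" "\<And>b. \<bar>2 * t' (coord n b) - 1\<bar> < 1/2" for t'
  proof -
    have "\<bar>cvec t' k\<bar> < 1/2" if k: "k < 2 * n" for k
    proof (cases "k = 1 \<or> k = n")
      case True
      then show ?thesis using t'(2)[of True] t'(2)[of False] coord[of t' True] coord[of t' False] by auto
    next
      case False
      have "k = 0 \<or> k = n + 1 \<or> (2 \<le> k \<and> k < n) \<or> (2 \<le> k - n \<and> k - n < n \<and> k = n + (k - n))"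
        using False k by auto
      then have "\<bar>cvec t k\<bar> < 1/2" using d(1) v[of k True] v[of "k - n" False] by auto
      then show ?thesis using t'(1)[OF k] False by simp
    qed
    moreover obtain i where "i \<le> m" "\<bar>cvec t' i\<bar> = crad m t'" using crad_attained by blast
    ultimately show ?thesis using m by (metis less_Suc_eq_le)
  qed
  have h1: "1 < height m t"
    using small[of t] xb by (simp add: height_def x_def)
  define r where "r = rescale (box_lo n \<alpha>) (box_hi n \<alpha>) t"
  have r: "crad m r < 1/2"
  proof (rule small)
    show "cvec r k = cvec t k" if "k < 2 * n" "k \<noteq> 1" "k \<noteq> n" for k
      using that by (simp add: r_def cvec_rescale_box)
    show "\<bar>2 * r (coord n b) - 1\<bar> < 1/2" for b
    proof -
      have "0 < (x b - core_lo b \<alpha>) / (core_hi b \<alpha> - core_lo b \<alpha>)" "(x b - core_lo b \<alpha>) / (core_hi b \<alpha> - core_lo b \<alpha>) < 1"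
        using x[of b] core[of b] by auto
      then show ?thesis using rescale_box_coord[OF n, of \<alpha> t b] unfolding r_def x_def abs_less_iff by linarith
    qed
  qed
  \<comment> \<open>A radius below 1/2 keeps \<open>r\<close> inside the cube, so the clamping in
    \<open>box_height\<close> does not change it.\<close>
  have "0 < r i \<and> r i < 1" if "i < m" for i
    using cvec_le_crad[of "Suc i" m r] r that by (auto simp: abs_le_iff)
  then have "clamp_cube m r = (\<lambda>i. if i < m then r i else 0)" by (auto simp: clamp_cube_def)
  then have "cvec (clamp_cube m r) k = cvec r k" if "k \<le> m" for k
    using that by (cases k) auto
  then have "crad m (clamp_cube m r) < 1/2" using r crad_attained[of m "clamp_cube m r"] cvec_le_crad[of _ m r] by force
  then have "1 < box_height n \<alpha> t" unfolding box_height_def height_def m_def[symmetric] r_def[symmetric] by simp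
  \<comment> \<open>Both heights exceed 1, hence so does every convex combination of them.\<close>
  then have "(1 - s) * 1 + s * 1 \<le> \<eta>"
    using h1 s unfolding \<eta>_def by (intro add_mono mult_left_mono) auto
  then show False using d(2) by simp
qed

text \<open>The lowering of the tent. Its pieces are indexed by factor and slot instead of
  rectangle, since a loop may meet many rectangles; the height of each piece runs linearly from the
  common height to the \<open>slot_height\<close> of its slot.\<close>

lemma homotopic_tent_boxes:
  assumes n: "2 \<le> n" and x0: "x0 \<in> topspace X"
    and f: "\<And>b j. 1 \<le> j \<Longrightarrow> f b j \<in> loops n X x0" and fE: "\<And>b j. 1 \<le> j \<Longrightarrow> f b j ` cube n \<subseteq> E j"
    and cl: "clusters {1..} X x0 E"
  shows "homotopic_within (2 * n - 1) X x0 (insert x0 (\<Union>j\<in>{1..}. E j))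
    (tent_map n x0 (\<lambda>b. interval_sum {1..} slot_lo slot_hi x0 (f b)))
    (box_sum (2 * n - 1) rects (box_lo n) (box_hi n) x0 (\<lambda>\<alpha>. tent_map n x0 (rect_loop x0 f \<alpha>)))"
proof -
  define m where "m = 2 * n - 1"
  define J where "J = (UNIV :: bool set) \<times> {1::nat..}"
  define Q where "Q i p = tent_part n (fst i) (fst p)
      ((1 - snd p) * height m (fst p) + snd p * slot_height n (fst i) (snd i) (fst p))
      ((2 * fst p (coord n (fst i)) - 1/2 - slot_lo (snd i)) / (slot_hi (snd i) - slot_lo (snd i)))"
    for i :: "bool \<times> nat" and p :: "(nat \<Rightarrow> real) \<times> real"
  define P where "P i p = f (fst i) (snd i) (clamp_cube n (Q i p))" for i p
  have triv: "P i p = x0" if "i \<in> J" "Q i p \<notin> open_cube n" for i p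
    using that f loop_clamp_trivial unfolding P_def J_def by fastforce
  have dj: "disjoint_at J x0 P (t, s)" if ts: "t \<in> cube m" "s \<in> {0..1}" for t s
    unfolding disjoint_at_def
  proof (intro ballI impI, rule ccontr)
    fix i i' assume i: "i \<in> J" "i' \<in> J" "P i (t, s) \<noteq> x0" "P i' (t, s) \<noteq> x0" "i \<noteq> i'"
    have op: "Q i (t, s) \<in> open_cube n" "Q i' (t, s) \<in> open_cube n" using i triv by blast+
    obtain b j b' j' where ij: "i = (b, j)" "i' = (b', j')" "1 \<le> j" "1 \<le> j'" using i(1,2) by (auto simp: J_def)
    show False
    \<comment> \<open>Within one factor the slots are disjoint; between the factors
      \<open>tent_parts_disjoint\<close> applies.\<close>
    proof (cases "b = b'")
      case True
      then have "j \<noteq> j'" using i(5) ij by auto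
      define x where "x = 2 * t (coord n b) - 1/2"
      have sl: "slot_lo k < x \<and> x < slot_hi k" if "Q (b, k) (t, s) \<in> open_cube n" for k
      proof -
        have "0 < (x - slot_lo k) / (slot_hi k - slot_lo k) \<and> (x - slot_lo k) / (slot_hi k - slot_lo k) < 1"
          using that n by (auto simp: open_cube_def Q_def tent_part_def x_def dest: spec[of _ 0])
        then show ?thesis using slot_less(1)[of k] by (auto simp: zero_less_divide_iff divide_less_eq)
      qed
      have "slot_hi j \<le> slot_lo j' \<or> slot_hi j' \<le> slot_lo j"
        using slot_disjoint[OF order_refl] ij(3,4) \<open>j \<noteq> j'\<close> unfolding disjoint_intervals_def by auto
      then show False using sl[of j] sl[of j'] op ij True by auto
    next
      case False
      define k where "k c = (if c = b then j else j')" for c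
      have k1: "1 \<le> k c" for c using ij by (simp add: k_def)
      obtain c where c: "Q (c, k c) (t, s) \<notin> open_cube n"
        using tent_parts_disjoint[where j = k, OF n _ ts(2) k1] ts(1) unfolding Q_def m_def by auto
      have "c = b \<or> c = b'" using False by auto
      then show False using c op ij False by (auto simp: k_def)
    qed
  qed
  have cont_h: "continuous_on S (\<lambda>p. slot_height n b j (fst p))" if "1 \<le> j" for S :: "((nat \<Rightarrow> real) \<times> real) set" and b j
  proof -
    have "continuous_on UNIV (slot_height n b j)"
      unfolding slot_height_def[abs_def]
      by (intro continuous_on_Max_family finite_slot_rects slot_rects_nonempty continuous_on_box_height
          subsetD[OF slot_rects_subset[OF that]])
    from continuous_on_compose2[OF this continuous_on_fst[OF continuous_on_id] subset_UNIV] show ?thesis .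
  qed
  have slab: "slot_hi j - slot_lo j \<noteq> 0" for j using slot_less(1)[of j] by simp
  have clJ: "clusters J X x0 (\<lambda>i. E (snd i))"
    unfolding clusters_def
  proof (intro allI impI)
    fix U assume "openin X U \<and> x0 \<in> U"
    then have "finite ((UNIV :: bool set) \<times> {j \<in> {1..}. \<not> E j \<subseteq> U})" using cl by (simp add: clusters_def)
    then show "finite {i \<in> J. \<not> E (snd i) \<subseteq> U}" by (rule finite_subset[rotated]) (auto simp: J_def)
  qed
  have Floop: "interval_sum {1..} slot_lo slot_hi x0 (f b) \<in> loops n X x0" for b
    by (rule interval_sum_loop[OF n _ slot_disjoint[OF order_refl] f fE cl x0]) auto
  have rf: "rect_loop x0 f \<alpha> b \<in> loops n X x0" if "\<alpha> \<in> rects" for \<alpha> b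
  proof -
    obtain c j where cj: "\<alpha> = (c, j)" "1 \<le> j" using \<open>\<alpha> \<in> rects\<close> by (auto simp: rects_def)
    have "tail_sum x0 (f b) j \<in> loops n X x0"
      unfolding tail_sum_def
      by (rule interval_sum_loop[where E = E, OF n _ tail_disjoint _ _ clusters_mono[OF cl] x0]) (use f fE in auto)
    then show ?thesis using f[OF cj(2)] by (simp add: cj rect_loop_def)
  qed
  have tl: "tent_map n x0 (rect_loop x0 f \<alpha>) \<in> loops m X x0" if "\<alpha> \<in> rects" for \<alpha>
  proof -
    have "homotopic_within n X x0 UNIV (rect_loop x0 f \<alpha> b) (rect_loop x0 f \<alpha> b)" for b
      by (intro homotopic_within_refl rf that) simp
    from homotopic_within_loops1[OF homotopic_tent_cong[OF n x0 this]] show ?thesis by (simp add: m_def)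
  qed
  have djr: "disjoint_at rects x0 (\<lambda>\<alpha> t. tent_map n x0 (rect_loop x0 f \<alpha>) (clamp_cube m (rescale (box_lo n \<alpha>) (box_hi n \<alpha>) t))) t" for t
  proof (rule disjoint_at_boxes[OF tl])
    show "box_lo n \<alpha> i < box_hi n \<alpha> i" if "\<alpha> \<in> rects" for \<alpha> i using box_bounds[OF that] by simp
    show "\<exists>i<m. box_hi n \<alpha> i \<le> box_lo n \<beta> i \<or> box_hi n \<beta> i \<le> box_lo n \<alpha> i"
      if "\<alpha> \<in> rects" "\<beta> \<in> rects" "\<alpha> \<noteq> \<beta>" for \<alpha> \<beta>
      using boxes_apart[OF n that] coord_less[OF n] unfolding m_def by blast
  qed
  have "homotopic_within m X x0 (insert x0 (\<Union>i\<in>J. E (snd i)))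
    (tent_map n x0 (\<lambda>b. interval_sum {1..} slot_lo slot_hi x0 (f b)))
    (box_sum m rects (box_lo n) (box_hi n) x0 (\<lambda>\<alpha>. tent_map n x0 (rect_loop x0 f \<alpha>)))"
  proof (rule homotopic_within_disjoint_sum[where P = P, OF _ dj _ clJ x0])
    fix i assume i: "i \<in> J"
    then have i1: "1 \<le> snd i" by (auto simp: J_def)
    show "continuous_map (top_of_set (cube m \<times> {0..1::real})) X (P i)"
      unfolding P_def[abs_def]
    proof (rule continuous_map_compose_on[OF loopsD[OF f[OF i1]] continuous_on_clamp_cube])
      show "continuous_on (cube m \<times> {0..1::real}) (\<lambda>p. Q i p k)" for k
        unfolding Q_def tent_part_def by (intro continuous_intros cont_h[OF i1]) (use slab in auto)
    qed simp
    show "P i (t, s) \<in> E (snd i)" for t s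
      using fE[OF i1, of "fst i"] by (auto simp: P_def)
    show "P i (t, s) = x0" if t: "t \<in> cube_boundary m" and s: "s \<in> {0..1}" for t s
    proof (rule triv[OF i])
      have off: "rescale (box_lo n \<alpha>) (box_hi n \<alpha>) t \<notin> open_cube m" if \<alpha>: "\<alpha> \<in> rects" for \<alpha>
      proof
        assume "rescale (box_lo n \<alpha>) (box_hi n \<alpha>) t \<in> open_cube m"
        then have "\<forall>i<m. box_lo n \<alpha> i < t i \<and> t i < box_hi n \<alpha> i"
          using rescale_in_open_cube[of m "box_lo n \<alpha>" "box_hi n \<alpha>" t] box_bounds[OF \<alpha>] by blast
        moreover obtain k where "k < m" "t k = 0 \<or> t k = 1" using t by (auto simp: cube_boundary_def)
        ultimately show False using box_bounds[OF \<alpha>, of n k] by auto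
      qed
      obtain \<alpha> where \<alpha>: "\<alpha> \<in> slot_rects (fst i) (snd i)" "box_height n \<alpha> t = slot_height n (fst i) (snd i) t"
        using slot_height_attained by blast
      have "slot_height n (fst i) (snd i) t = -4"
        using box_height_off[of n \<alpha> t] off[of \<alpha>] \<alpha> slot_rects_subset[OF i1] by (auto simp: m_def)
      then have "(1 - s) * height m t + s * slot_height n (fst i) (snd i) t = -4"
        by (simp add: height_boundary[OF t])
      moreover have "\<bar>cvec t (n + 1)\<bar> \<le> 1"
        by (rule cvec_cube[OF cube_boundary_subset[OF t]]) (use n in \<open>simp add: m_def\<close>)
      ultimately show "Q i (t, s) \<notin> open_cube n"
        unfolding Q_def using n by (intro tent_part_low) auto
    qed
  next
    fix t assume t: "t \<in> cube m"
    have 01: "(0::real) \<in> {0..1}" "(1::real) \<in> {0..1}" by auto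
    have upd: "(tent_part n b t \<eta> \<xi>')(0 := \<zeta>) = tent_part n b t \<eta> \<zeta>" for b \<eta> \<xi>' \<zeta> by (auto simp: tent_part_def)
    show "disjoint_sum J x0 P (t, 0) = tent_map n x0 (\<lambda>b. interval_sum {1..} slot_lo slot_hi x0 (f b)) t"
    proof (rule eq_by_nontrivial_values[where ?x0.0 = x0])
      fix v assume v: "v \<noteq> x0"
      have eq: "interval_sum {1..} slot_lo slot_hi x0 (f b) (clamp_cube n u) = v \<longleftrightarrow>
          (\<exists>j\<in>{1..}. f b j (clamp_cube n (u(0 := (u 0 - slot_lo j) / (slot_hi j - slot_lo j)))) = v)" for b u
        by (rule interval_sum_clamp_eq_iff[OF slot_disjoint[OF order_refl] v]) (use f n in auto)
      have "interval_sum {1..} slot_lo slot_hi x0 (f b)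
          (clamp_cube n (tent_part n b t (height m t) (2 * t (coord n b) - 1/2))) = v \<longleftrightarrow>
        (\<exists>j\<in>{1..}. P (b, j) (t, 0) = v)" for b
        unfolding eq upd by (simp add: P_def Q_def tent_part_def[of _ _ _ _ _ 0])
      then show "disjoint_sum J x0 P (t, 0) = v \<longleftrightarrow> tent_map n x0 (\<lambda>b. interval_sum {1..} slot_lo slot_hi x0 (f b)) t = v"
        unfolding disjoint_sum_eq_iff[OF dj[OF t 01(1)] v] tent_map_eq_iff[OF n Floop v] m_def[symmetric]
        by (auto simp: J_def)
    qed
    show "disjoint_sum J x0 P (t, 1) = box_sum m rects (box_lo n) (box_hi n) x0 (\<lambda>\<alpha>. tent_map n x0 (rect_loop x0 f \<alpha>)) t"
    proof (rule eq_by_nontrivial_values[where ?x0.0 = x0])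
      fix v assume v: "v \<noteq> x0"
      have "(\<exists>\<alpha>\<in>rects. tent_map n x0 (rect_loop x0 f \<alpha>) (clamp_cube m (rescale (box_lo n \<alpha>) (box_hi n \<alpha>) t)) = v) \<longleftrightarrow>
        (\<exists>b. \<exists>\<alpha>\<in>rects. rect_loop x0 f \<alpha> b (clamp_cube n (tent_part n b (clamp_cube m (rescale (box_lo n \<alpha>) (box_hi n \<alpha>) t))
          (box_height n \<alpha> t) (2 * clamp_cube m (rescale (box_lo n \<alpha>) (box_hi n \<alpha>) t) (coord n b) - 1/2))) = v)"
        using tent_map_eq_iff[OF n rf v] by (auto simp: box_height_def m_def)
      also have "\<dots> \<longleftrightarrow> (\<exists>b. \<exists>j\<ge>1. P (b, j) (t, 1) = v)"
        using tent_pieces_eq_iff[OF n t[unfolded m_def] v, of f, OF f rf] by (simp add: P_def Q_def m_def)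
      finally show "disjoint_sum J x0 P (t, 1) = v \<longleftrightarrow>
          box_sum m rects (box_lo n) (box_hi n) x0 (\<lambda>\<alpha>. tent_map n x0 (rect_loop x0 f \<alpha>)) t = v"
        unfolding box_sum_def disjoint_sum_eq_iff[OF dj[OF t 01(2)] v] disjoint_sum_eq_iff[OF djr v]
        by (auto simp: J_def)
    qed
  qed
  moreover have "(\<Union>i\<in>J. E (snd i)) = (\<Union>j\<in>{1..}. E j)" by (auto simp: J_def)
  ultimately show ?thesis by (simp add: m_def)
qed

section \<open>Regrouping of the terms\<close>

text \<open>Disjoint intervals inside the first extents of the boxes. The kinds 0 and 1 share the
  doubled slot and get one half of it each; kind 2 gets the part of the doubled tail before the next
  doubled slot, which begins at 3/4 - 5/8 * quarter (Suc j) = 3/4 - 20/128 * quarter j.\<close>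

definition rect_left :: "nat \<times> nat \<Rightarrow> real" where
  "rect_left = (\<lambda>(c, j). 3/4 - (if c = 0 then 5/8 else if c = 1 then 1/2 else 27/128) * quarter j)"

definition rect_right :: "nat \<times> nat \<Rightarrow> real" where
  "rect_right = (\<lambda>(c, j). 3/4 - (if c = 0 then 1/2 else if c = 1 then 3/8 else 20/128) * quarter j)"

lemma rect_intervals_in_box:
  assumes "\<alpha> \<in> rects"
  shows "box_lo n \<alpha> 0 \<le> rect_left \<alpha>" "rect_left \<alpha> < rect_right \<alpha>" "rect_right \<alpha> \<le> box_hi n \<alpha> 0"
proof -
  obtain c j where "\<alpha> = (c, j)" "c = 0 \<or> c = 1 \<or> c = 2" using assms by (auto simp: rects_def le_Suc_eq numeral_2_eq_2)
  then show "box_lo n \<alpha> 0 \<le> rect_left \<alpha>" "rect_left \<alpha> < rect_right \<alpha>" "rect_right \<alpha> \<le> box_hi n \<alpha> 0"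
    using quarter_pos[of j]
    by (auto simp: box_lo_def box_hi_def core_lo_def core_hi_def tail_kind_def dbl_slot rect_left_def rect_right_def)
qed

lemma rect_intervals_disjoint: "disjoint_intervals rects rect_left rect_right"
  unfolding disjoint_intervals_def
proof (intro conjI ballI impI)
  fix \<alpha> \<beta> :: "nat \<times> nat" assume ab: "\<alpha> \<in> rects" "\<beta> \<in> rects" "\<alpha> \<noteq> \<beta>"
  have less: "rect_right (c, j) \<le> rect_left (d, k)" if "j < k" for c j d k
    using quarter_pos[of j] quarter_pos[of k] quarter_less[OF that] by (auto simp: rect_left_def rect_right_def)
  have eq: "rect_right (c, j) \<le> rect_left (d, j)" if "c < d" "d \<le> 2" for c j d
    using quarter_pos[of j] that by (auto simp: rect_left_def rect_right_def)
  obtain c j d k where "\<alpha> = (c, j)" "\<beta> = (d, k)" "c \<le> 2" "d \<le> 2" using ab by (auto simp: rects_def)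
  then show "rect_right \<alpha> \<le> rect_left \<beta> \<or> rect_right \<beta> \<le> rect_left \<alpha>"
    using less[of j k c d] less[of k j d c] eq[of c d j] eq[of d c j] ab(3)
    by (metis linorder_neqE_nat)
next
  fix \<alpha> assume "\<alpha> \<in> rects"
  then show "0 \<le> rect_left \<alpha>" "rect_left \<alpha> < rect_right \<alpha>" "rect_right \<alpha> \<le> 1"
    using rect_intervals_in_box(1)[of \<alpha> 0] rect_intervals_in_box(2)[of \<alpha>] rect_intervals_in_box(3)[of \<alpha> 0] box_bounds[of \<alpha> 0 0] by auto
qed

lemma countable_rects: "countable rects"
  by (simp add: rects_def)

text \<open>Shrinking the boxes keeps the old separation and creates a separation in coordinate 0.
  This allows widening them to full slabs in the other coordinates, after which the intervals are
  rearranged.\<close>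

lemma homotopic_box_sum_interval_sum:
  assumes n: "2 \<le> n" and x0: "x0 \<in> topspace X"
    and hom: "\<And>\<alpha>. \<alpha> \<in> rects \<Longrightarrow> homotopic_within (2 * n - 1) X x0 (E \<alpha>) (h \<alpha>) (h' \<alpha>)"
    and cl: "clusters rects X x0 E" and ab: "disjoint_intervals rects a b"
  shows "homotopic_within (2 * n - 1) X x0 (insert x0 (\<Union>\<alpha>\<in>rects. E \<alpha>))
    (box_sum (2 * n - 1) rects (box_lo n) (box_hi n) x0 h) (interval_sum rects a b x0 h')"
proof -
  define m where "m = 2 * n - 1"
  have m: "2 \<le> m" using n by (simp add: m_def)
  define lo where "lo \<alpha> i = (if i = 0 then rect_left \<alpha> else box_lo n \<alpha> i)" for \<alpha> and i :: nat
  define hi where "hi \<alpha> i = (if i = 0 then rect_right \<alpha> else box_hi n \<alpha> i)" for \<alpha> and i :: nat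
  have h: "homotopic_within m X x0 (E \<alpha>) (h \<alpha>) (h \<alpha>)" if "\<alpha> \<in> rects" for \<alpha>
    using homotopic_within_trans[OF hom homotopic_within_sym[OF hom]] that by (simp add: m_def)
  have h': "homotopic_within m X x0 (E \<alpha>) (h' \<alpha>) (h' \<alpha>)" if "\<alpha> \<in> rects" for \<alpha>
    using homotopic_within_trans[OF homotopic_within_sym[OF hom] hom] that by (simp add: m_def)
  have sub: "box_lo n \<alpha> i \<le> lo \<alpha> i" "hi \<alpha> i \<le> box_hi n \<alpha> i" if "\<alpha> \<in> rects" for \<alpha> i
    using rect_intervals_in_box[OF that] by (auto simp: lo_def hi_def)
  have bounds: "0 \<le> lo \<alpha> i \<and> lo \<alpha> i < hi \<alpha> i \<and> hi \<alpha> i \<le> 1" if "\<alpha> \<in> rects" for \<alpha> i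
    using box_bounds[OF that, of n i] disjoint_intervalsD[OF rect_intervals_disjoint that] by (auto simp: lo_def hi_def)
  have slab: "0 \<le> slab_lo rect_left \<alpha> i \<and> slab_lo rect_left \<alpha> i < slab_hi rect_right \<alpha> i \<and> slab_hi rect_right \<alpha> i \<le> 1"
    if "\<alpha> \<in> rects" for \<alpha> i
    using disjoint_intervalsD[OF rect_intervals_disjoint that] by (auto simp: slab_lo_def slab_hi_def)
  let ?E = "insert x0 (\<Union>\<alpha>\<in>rects. E \<alpha>)"
  have "homotopic_within m X x0 ?E (box_sum m rects (box_lo n) (box_hi n) x0 h) (box_sum m rects lo hi x0 h)"
  proof (rule homotopic_box_sums[OF h cl x0 box_bounds bounds])
    fix \<alpha> \<beta> assume ab: "\<alpha> \<in> rects" "\<beta> \<in> rects" "\<alpha> \<noteq> \<beta>"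
    obtain b where "box_hi n \<alpha> (coord n b) \<le> box_lo n \<beta> (coord n b) \<or> box_hi n \<beta> (coord n b) \<le> box_lo n \<alpha> (coord n b)"
      using boxes_apart[OF n ab] by blast
    moreover have "coord n b < m" using coord_less[OF n] by (simp add: m_def)
    ultimately show "\<exists>i<m. (box_hi n \<alpha> i \<le> box_lo n \<beta> i \<and> hi \<alpha> i \<le> lo \<beta> i) \<or> (box_hi n \<beta> i \<le> box_lo n \<alpha> i \<and> hi \<beta> i \<le> lo \<alpha> i)"
      using sub[OF ab(1)] sub[OF ab(2)] by (meson order_trans)
  qed auto
  also have "homotopic_within m X x0 ?E (box_sum m rects lo hi x0 h) (box_sum m rects (slab_lo rect_left) (slab_hi rect_right) x0 h')"
  proof (rule homotopic_box_sums[OF _ cl x0 bounds slab])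
    fix \<alpha> \<beta> assume ab: "\<alpha> \<in> rects" "\<beta> \<in> rects" "\<alpha> \<noteq> \<beta>"
    then have "rect_right \<alpha> \<le> rect_left \<beta> \<or> rect_right \<beta> \<le> rect_left \<alpha>"
      using rect_intervals_disjoint by (simp add: disjoint_intervals_def)
    then show "\<exists>i<m. (hi \<alpha> i \<le> lo \<beta> i \<and> slab_hi rect_right \<alpha> i \<le> slab_lo rect_left \<beta> i) \<or>
        (hi \<beta> i \<le> lo \<alpha> i \<and> slab_hi rect_right \<beta> i \<le> slab_lo rect_left \<alpha> i)"
      using m by (intro exI[of _ 0]) (auto simp: lo_def hi_def slab_lo_def slab_hi_def)
  qed (use hom in \<open>auto simp: m_def\<close>)
  finally have "homotopic_within m X x0 ?E (box_sum m rects (box_lo n) (box_hi n) x0 h) (interval_sum rects rect_left rect_right x0 h')"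
    by (rule homotopic_within_cong)
       (use interval_sum_eq_box_sum[OF rect_intervals_disjoint homotopic_within_loops1[OF h']] m in auto)
  also have "homotopic_within m X x0 ?E (interval_sum rects rect_left rect_right x0 h') (interval_sum rects a b x0 h')"
    by (rule homotopic_interval_sums[OF m countable_rects rect_intervals_disjoint ab h' cl x0])
  finally show ?thesis by (simp add: m_def)
qed

lemma infinite_sum_intervals:
  "disjoint_intervals {1..} (\<lambda>j. (real j - 1) / real j) (\<lambda>j. real j / (real j + 1))"
  unfolding disjoint_intervals_def
proof (intro conjI ballI impI)
  have less: "real j / (real j + 1) \<le> (real k - 1) / real k" if "j < k" for j k
  proof -
    have "real j + 1 \<le> real k" using that by linarith
    then show ?thesis using that by (simp add: field_simps)
  qed
  fix j k :: nat assume "j \<noteq> k"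
  then show "real j / (real j + 1) \<le> (real k - 1) / real k \<or> real k / (real k + 1) \<le> (real j - 1) / real j"
    using less by (meson linorder_neqE_nat)
qed (auto simp: field_simps)

section \<open>Expansion of a single row\<close>

definition whitehead_terms ::
    "nat \<Rightarrow> 'a \<Rightarrow> (nat \<Rightarrow> nat \<Rightarrow> real) \<Rightarrow> (nat \<Rightarrow> nat \<Rightarrow> real) \<Rightarrow> (nat \<Rightarrow> (nat \<Rightarrow> real) \<Rightarrow> 'a) \<Rightarrow>
      (nat \<Rightarrow> (nat \<Rightarrow> real) \<Rightarrow> 'a) \<Rightarrow> nat \<times> nat \<Rightarrow> (nat \<Rightarrow> real) \<Rightarrow> 'a" where
  "whitehead_terms n x0 c d f g = (\<lambda>(k, j).
     if k = 0 then whitehead n n (f j) (g j)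
     else if k = 1 then whitehead n n (f j) (interval_sum {j<..} (c j) (d j) x0 g)
     else loop_sign (n\<^sup>2) (whitehead n n (g j) (interval_sum {j<..} (c j) (d j) x0 f)))"

text \<open>The row \<open>i\<close> of the theorem, as a chain: infinite sums moved to the slots,
  tent, lowering to the small tents, small tents turned into brackets.\<close>

lemma homotopic_whitehead_sums:
  assumes n: "2 \<le> n" and x0: "x0 \<in> topspace X"
    and f: "\<And>j. 1 \<le> j \<Longrightarrow> f j \<in> loops n X x0" "\<And>j. 1 \<le> j \<Longrightarrow> f j ` cube n \<subseteq> E j"
    and g: "\<And>j. 1 \<le> j \<Longrightarrow> g j \<in> loops n X x0" "\<And>j. 1 \<le> j \<Longrightarrow> g j ` cube n \<subseteq> E j"
    and cl: "clusters {1..} X x0 E" and x0E: "\<And>j. 1 \<le> j \<Longrightarrow> x0 \<in> E j"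
    and cd: "\<And>j. 1 \<le> j \<Longrightarrow> disjoint_intervals {j<..} (c j) (d j)"
    and ab: "disjoint_intervals rects a b"
  shows "homotopic_within (2 * n - 1) X x0 (\<Union>j\<in>{1..}. E j)
      (whitehead n n (infinite_sum x0 f) (infinite_sum x0 g))
      (interval_sum rects a b x0 (whitehead_terms n x0 c d f g))"
    and "\<alpha> \<in> rects \<Longrightarrow> whitehead_terms n x0 c d f g \<alpha> \<in> loops (2 * n - 1) X x0"
    and "\<alpha> \<in> rects \<Longrightarrow> whitehead_terms n x0 c d f g \<alpha> ` cube (2 * n - 1) \<subseteq> (\<Union>k\<in>{snd \<alpha>..}. E k)"
proof -
  define m where "m = 2 * n - 1"
  have m: "2 \<le> m" using n by (simp add: m_def)
  define u where "u b = (if b then f else g)" for b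
  have u: "u b j \<in> loops n X x0" "u b j ` cube n \<subseteq> E j" if "1 \<le> j" for b j
    using f[OF that] g[OF that] by (simp_all add: u_def)
  \<comment> \<open>A term with index j uses loops with index j and tails after j, so its image
    leaves a neighbourhood of \<open>x0\<close> for only finitely many j.\<close>
  define E' where "E' \<alpha> = (\<Union>k\<in>{snd \<alpha>..}. E k)" for \<alpha> :: "nat \<times> nat"
  let ?E = "\<Union>j\<in>{1..}. E j"
  have insE: "insert x0 ?E = ?E" using x0E[of 1] by auto
  have insE': "insert x0 (E' \<alpha>) = E' \<alpha>" if "\<alpha> \<in> rects" for \<alpha>
    using x0E[of "snd \<alpha>"] that by (auto simp: E'_def rects_def)
  have clE': "clusters rects X x0 E'"
    unfolding clusters_def
  proof (intro allI impI)
    fix U assume "openin X U \<and> x0 \<in> U"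
    then have "finite {j \<in> {1..}. \<not> E j \<subseteq> U}" using cl by (simp add: clusters_def)
    then obtain N where N: "\<And>j. 1 \<le> j \<Longrightarrow> \<not> E j \<subseteq> U \<Longrightarrow> j \<le> N"
      unfolding finite_nat_set_iff_bounded_le by auto
    have "{\<alpha> \<in> rects. \<not> E' \<alpha> \<subseteq> U} \<subseteq> {..2} \<times> {..N}"
    proof
      fix \<alpha> assume "\<alpha> \<in> {\<alpha> \<in> rects. \<not> E' \<alpha> \<subseteq> U}"
      then obtain k where "\<alpha> \<in> rects" "snd \<alpha> \<le> k" "\<not> E k \<subseteq> U" by (auto simp: E'_def)
      then show "\<alpha> \<in> {..2} \<times> {..N}" using N[of k] by (auto simp: rects_def)
    qed
    then show "finite {\<alpha> \<in> rects. \<not> E' \<alpha> \<subseteq> U}" by (rule finite_subset) simp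
  qed
  have refl: "homotopic_within n X x0 (E j) (u b j) (u b j)" if "1 \<le> j" for b j
    by (intro homotopic_within_refl u that)
  have sums: "homotopic_within n X x0 ?E (infinite_sum x0 (u b)) (interval_sum {1..} slot_lo slot_hi x0 (u b))" for b
    using homotopic_interval_sums[OF n _ infinite_sum_intervals slot_disjoint[OF order_refl] refl cl x0]
    unfolding insE infinite_sum_def by auto
  have tails: "homotopic_within n X x0 (E' (k, j)) (tail_sum x0 (u b) j) (interval_sum {j<..} (c j) (d j) x0 (u b))"
    if j: "1 \<le> j" for k j b
  proof -
    have "homotopic_within n X x0 (insert x0 (\<Union>k\<in>{j<..}. E k)) (tail_sum x0 (u b) j) (interval_sum {j<..} (c j) (d j) x0 (u b))"
      unfolding tail_sum_def
      by (rule homotopic_interval_sums[OF n _ tail_disjoint cd[OF j] refl clusters_mono[OF cl] x0]) auto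
    then show ?thesis by (rule homotopic_within_mono) (use x0E[OF j] in \<open>force simp: E'_def\<close>)
  qed
  have single: "homotopic_within n X x0 (E' (k, j)) (u b j) (u b j)" if "1 \<le> j" for k j b
    by (rule homotopic_within_mono[OF refl[OF that]]) (auto simp: E'_def)
  have wt: "homotopic_within m X x0 (insert x0 F) (tent_map n x0 w) (whitehead n n (w True) (w False))"
    if "\<And>b. homotopic_within n X x0 F (w b) (w b)" for w :: "bool \<Rightarrow> (nat \<Rightarrow> real) \<Rightarrow> 'a" and F
  proof -
    have w: "w b \<in> loops n X x0" "w b ` cube n \<subseteq> F" for b
      using homotopic_within_loops1[OF that] homotopic_within_image1[OF that] by auto
    show ?thesis
      using homotopic_within_sym[OF homotopic_whitehead_tent[OF n x0 w(1) w(2) w(1) w(2)]]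
      by (simp add: tent_map_def[abs_def] m_def)
  qed
  have terms: "homotopic_within m X x0 (E' \<alpha>) (tent_map n x0 (rect_loop x0 u \<alpha>)) (whitehead_terms n x0 c d f g \<alpha>)"
    if \<alpha>: "\<alpha> \<in> rects" for \<alpha>
  proof -
    obtain k j where kj: "\<alpha> = (k, j)" "1 \<le> j" "k \<le> 2" using \<alpha> by (auto simp: rects_def)
    define w where "w b = (if k = tail_kind b then interval_sum {j<..} (c j) (d j) x0 (u b) else u b j)" for b
    have hw: "homotopic_within n X x0 (E' \<alpha>) (rect_loop x0 u \<alpha> b) (w b)" for b
      using tails[OF kj(2), of k b] single[OF kj(2), of k b]
      by (cases "k = tail_kind b") (simp_all add: kj rect_loop_def w_def)
    have hww: "homotopic_within n X x0 (E' \<alpha>) (w b) (w b)" for b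
      by (rule homotopic_within_trans[OF homotopic_within_sym[OF hw] hw])
    have 1: "homotopic_within m X x0 (E' \<alpha>) (tent_map n x0 (rect_loop x0 u \<alpha>)) (tent_map n x0 w)"
      using homotopic_tent_cong[OF n x0 hw] by (simp add: insE'[OF \<alpha>] m_def)
    have 2: "homotopic_within m X x0 (E' \<alpha>) (tent_map n x0 w) (whitehead_terms n x0 c d f g \<alpha>)"
    proof (cases "k = 2")
      case False
      then have "k = 0 \<or> k = 1" using kj(3) by auto
      then have "whitehead_terms n x0 c d f g \<alpha> = whitehead n n (w True) (w False)"
        by (auto simp: kj whitehead_terms_def w_def tail_kind_def u_def)
      then show ?thesis using wt[OF hww] by (simp add: insE'[OF \<alpha>])
    next
      case True
      \<comment> \<open>The sign of the exchange is (-1)^n, and n has the parity of its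
        square.\<close>
      then have "whitehead_terms n x0 c d f g \<alpha> = loop_sign n (whitehead n n (w False) (w True))"
        by (simp add: kj whitehead_terms_def w_def tail_kind_def u_def loop_sign_def)
      then show ?thesis
        using homotopic_tent_swap[OF n x0 homotopic_within_loops1[OF hww] homotopic_within_image1[OF hww]
            homotopic_within_loops1[OF hww] homotopic_within_image1[OF hww], of True False]
        by (simp add: tent_map_def[abs_def] insE'[OF \<alpha>] m_def)
    qed
    show ?thesis by (rule homotopic_within_trans[OF 1 2])
  qed
  show "\<alpha> \<in> rects \<Longrightarrow> whitehead_terms n x0 c d f g \<alpha> \<in> loops (2 * n - 1) X x0"
    "\<alpha> \<in> rects \<Longrightarrow> whitehead_terms n x0 c d f g \<alpha> ` cube (2 * n - 1) \<subseteq> (\<Union>k\<in>{snd \<alpha>..}. E k)"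
    using homotopic_within_loops2[OF terms] homotopic_within_image2[OF terms] unfolding m_def E'_def by blast+
  have sums': "homotopic_within n X x0 ?E (infinite_sum x0 (u b)) (infinite_sum x0 (u b))" for b
    by (rule homotopic_within_trans[OF sums homotopic_within_sym[OF sums]])
  have "homotopic_within m X x0 ?E (whitehead n n (infinite_sum x0 f) (infinite_sum x0 g)) (tent_map n x0 (\<lambda>b. infinite_sum x0 (u b)))"
    using homotopic_within_sym[OF wt[where w = "\<lambda>b. infinite_sum x0 (u b)", OF sums']] unfolding insE by (simp add: u_def)
  also have "homotopic_within m X x0 ?E (tent_map n x0 (\<lambda>b. infinite_sum x0 (u b)))
      (tent_map n x0 (\<lambda>b. interval_sum {1..} slot_lo slot_hi x0 (u b)))"
    using homotopic_tent_cong[OF n x0 sums] unfolding insE by (simp add: m_def)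
  also have "homotopic_within m X x0 ?E (tent_map n x0 (\<lambda>b. interval_sum {1..} slot_lo slot_hi x0 (u b)))
      (box_sum m rects (box_lo n) (box_hi n) x0 (\<lambda>\<alpha>. tent_map n x0 (rect_loop x0 u \<alpha>)))"
    using homotopic_tent_boxes[OF n x0 u cl] unfolding insE by (simp add: m_def)
  also have "homotopic_within m X x0 ?E (box_sum m rects (box_lo n) (box_hi n) x0 (\<lambda>\<alpha>. tent_map n x0 (rect_loop x0 u \<alpha>)))
      (interval_sum rects a b x0 (whitehead_terms n x0 c d f g))"
  proof (rule homotopic_within_mono)
    show "homotopic_within m X x0 (insert x0 (\<Union>\<alpha>\<in>rects. E' \<alpha>))
      (box_sum m rects (box_lo n) (box_hi n) x0 (\<lambda>\<alpha>. tent_map n x0 (rect_loop x0 u \<alpha>)))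
      (interval_sum rects a b x0 (whitehead_terms n x0 c d f g))"
      using homotopic_box_sum_interval_sum[OF n x0 terms[unfolded m_def] clE' ab] by (simp add: m_def)
    show "insert x0 (\<Union>\<alpha>\<in>rects. E' \<alpha>) \<subseteq> ?E" using x0E[of 1] by (fastforce simp: E'_def rects_def)
  qed
  finally show "homotopic_within (2 * n - 1) X x0 ?E
      (whitehead n n (infinite_sum x0 f) (infinite_sum x0 g))
      (interval_sum rects a b x0 (whitehead_terms n x0 c d f g))"
    by (simp add: m_def)
qed

section \<open>Nested, reindexed, concatenated and reversed interval sums\<close>

lemma interval_sum_nested:
  assumes ab: "disjoint_intervals I a b" and pq: "disjoint_intervals J p q"
  defines "lo \<equiv> \<lambda>(i, j). a i + (b i - a i) * p j" and "hi \<equiv> \<lambda>(i, j). a i + (b i - a i) * q j"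
  shows "disjoint_intervals (I \<times> J) lo hi"
    and "interval_sum I a b x0 (\<lambda>i. interval_sum J p q x0 (h i)) t = interval_sum (I \<times> J) lo hi x0 (\<lambda>(i, j). h i j) t"
proof -
  have D: "0 < b i - a i" if "i \<in> I" for i using disjoint_intervalsD[OF ab that] by simp
  have bounds: "a i \<le> lo (i, j) \<and> lo (i, j) < hi (i, j) \<and> hi (i, j) \<le> b i" if "i \<in> I" "j \<in> J" for i j
  proof -
    have "(b i - a i) * q j \<le> (b i - a i) * 1" "0 \<le> (b i - a i) * p j" "(b i - a i) * p j < (b i - a i) * q j"
      using disjoint_intervalsD[OF pq that(2)] D[OF that(1)] by (auto intro!: mult_left_mono)
    then show ?thesis by (auto simp: lo_def hi_def)
  qed
  show dj: "disjoint_intervals (I \<times> J) lo hi"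
    unfolding disjoint_intervals_def
  proof (intro conjI ballI impI)
    fix x y assume xy: "x \<in> I \<times> J" "y \<in> I \<times> J" "x \<noteq> y"
    obtain i j k l where x: "x = (i, j)" and y: "y = (k, l)" by (metis surj_pair)
    show "hi x \<le> lo y \<or> hi y \<le> lo x"
    proof (cases "i = k")
      case True
      then have "q j \<le> p l \<or> q l \<le> p j" using pq xy x y unfolding disjoint_intervals_def by auto
      then show ?thesis
        using D[of i] xy x y True mult_left_mono[of "q j" "p l" "b i - a i"] mult_left_mono[of "q l" "p j" "b i - a i"]
        by (auto simp: lo_def hi_def)
    next
      case False
      then have "b i \<le> a k \<or> b k \<le> a i" using ab xy x y unfolding disjoint_intervals_def by auto
      then show ?thesis using bounds[of i j] bounds[of k l] xy x y by force
    qed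
  next
    fix x assume "x \<in> I \<times> J"
    then obtain i j where x: "x = (i, j)" "i \<in> I" "j \<in> J" by auto
    then show "0 \<le> lo x" "lo x < hi x" "hi x \<le> 1"
      using bounds[of i j] disjoint_intervalsD[OF ab, of i] by auto
  qed
  show "interval_sum I a b x0 (\<lambda>i. interval_sum J p q x0 (h i)) t = interval_sum (I \<times> J) lo hi x0 (\<lambda>(i, j). h i j) t"
  proof (rule eq_by_nontrivial_values[where ?x0.0 = x0])
    fix v assume v: "v \<noteq> x0"
    have "a i < t 0 \<and> t 0 < b i \<and> (\<exists>j\<in>J. p j < (t 0 - a i) / (b i - a i) \<and> (t 0 - a i) / (b i - a i) < q j \<and>
        h i j (t(0 := ((t 0 - a i) / (b i - a i) - p j) / (q j - p j))) = v) \<longleftrightarrow>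
      (\<exists>j\<in>J. lo (i, j) < t 0 \<and> t 0 < hi (i, j) \<and> h i j (t(0 := (t 0 - lo (i, j)) / (hi (i, j) - lo (i, j)))) = v)"
      if i: "i \<in> I" for i
    proof -
      have 1: "(t 0 - a i) / (b i - a i) < r \<longleftrightarrow> t 0 < a i + (b i - a i) * r"
        "r < (t 0 - a i) / (b i - a i) \<longleftrightarrow> a i + (b i - a i) * r < t 0" for r
        using D[OF i] by (auto simp: divide_less_eq less_divide_eq mult.commute)
      have 2: "((t 0 - a i) / (b i - a i) - p j) / (q j - p j) = (t 0 - lo (i, j)) / (hi (i, j) - lo (i, j))" for j
      proof -
        have "hi (i, j) - lo (i, j) = (b i - a i) * (q j - p j)" by (simp add: lo_def hi_def algebra_simps)
        moreover have "t 0 - lo (i, j) = (b i - a i) * ((t 0 - a i) / (b i - a i) - p j)"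
        proof -
          define r where "r = (t 0 - a i) / (b i - a i)"
          have "t 0 - a i = (b i - a i) * r" using D[OF i] by (simp add: r_def)
          then show ?thesis unfolding r_def[symmetric] right_diff_distrib by (simp add: lo_def)
        qed
        ultimately show ?thesis using D[OF i] by simp
      qed
      have 3: "a i < t 0 \<and> t 0 < b i" if "j \<in> J" "lo (i, j) < t 0" "t 0 < hi (i, j)" for j
        using bounds[OF i that(1)] that(2,3) by linarith
      have lohi: "lo (i, j) = a i + (b i - a i) * p j" "hi (i, j) = a i + (b i - a i) * q j" for j
        by (simp_all add: lo_def hi_def)
      show ?thesis unfolding 1 2 lohi[symmetric] using 3 by blast
    qed
    then show "interval_sum I a b x0 (\<lambda>i. interval_sum J p q x0 (h i)) t = v \<longleftrightarrow>
        interval_sum (I \<times> J) lo hi x0 (\<lambda>(i, j). h i j) t = v"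
      unfolding interval_sum_eq_iff[OF ab v] interval_sum_eq_iff[OF pq v] interval_sum_eq_iff[OF dj v]
      by (simp add: Bex_def)
  qed
qed

lemma interval_sum_reindex:
  assumes ab: "disjoint_intervals T a b" and \<psi>: "bij_betw \<psi> S T"
  shows "disjoint_intervals S (\<lambda>s. a (\<psi> s)) (\<lambda>s. b (\<psi> s))"
    and "interval_sum T a b x0 f t = interval_sum S (\<lambda>s. a (\<psi> s)) (\<lambda>s. b (\<psi> s)) x0 (\<lambda>s. f (\<psi> s)) t"
proof -
  have T: "T = \<psi> ` S" and inj: "inj_on \<psi> S" using \<psi> by (auto simp: bij_betw_def)
  show dj: "disjoint_intervals S (\<lambda>s. a (\<psi> s)) (\<lambda>s. b (\<psi> s))"
    using ab inj unfolding disjoint_intervals_def T by (auto simp: inj_on_eq_iff)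
  show "interval_sum T a b x0 f t = interval_sum S (\<lambda>s. a (\<psi> s)) (\<lambda>s. b (\<psi> s)) x0 (\<lambda>s. f (\<psi> s)) t"
  proof (rule eq_by_nontrivial_values[where ?x0.0 = x0])
    fix v assume v: "v \<noteq> x0"
    show "interval_sum T a b x0 f t = v \<longleftrightarrow> interval_sum S (\<lambda>s. a (\<psi> s)) (\<lambda>s. b (\<psi> s)) x0 (\<lambda>s. f (\<psi> s)) t = v"
      unfolding interval_sum_eq_iff[OF ab v] interval_sum_eq_iff[OF dj v] unfolding T by simp
  qed
qed

definition join :: "'j set \<Rightarrow> ('j \<Rightarrow> real) \<Rightarrow> ('j \<Rightarrow> real) \<Rightarrow> 'j \<Rightarrow> real" where
  "join J a c j = (if j \<in> J then a j / 2 else (1 + c j) / 2)"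

lemma loop_add_interval_sums:
  assumes ab: "disjoint_intervals J a b" and cd: "disjoint_intervals K c d" and JK: "J \<inter> K = {}"
  shows "disjoint_intervals (J \<union> K) (join J a c) (join J b d)"
    and "loop_add (interval_sum J a b x0 f) (interval_sum K c d x0 g) t =
      interval_sum (J \<union> K) (join J a c) (join J b d) x0 (\<lambda>j. if j \<in> J then f j else g j) t"
proof -
  show dj: "disjoint_intervals (J \<union> K) (join J a c) (join J b d)"
    unfolding disjoint_intervals_def
  proof (intro conjI ballI impI)
    fix j k assume jk: "j \<in> J \<union> K" "k \<in> J \<union> K" "j \<noteq> k"
    show "join J b d j \<le> join J a c k \<or> join J b d k \<le> join J a c j"
    proof (cases "j \<in> J \<longleftrightarrow> k \<in> J")
      case True
      then show ?thesis using jk ab cd unfolding disjoint_intervals_def join_def by auto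
    next
      case False
      then consider "j \<in> J" "k \<notin> J" "k \<in> K" | "k \<in> J" "j \<notin> J" "j \<in> K" using jk by blast
      then show ?thesis
      proof cases
        case 1
        then show ?thesis using disjoint_intervalsD(3)[OF ab 1(1)] disjoint_intervalsD(1)[OF cd 1(3)] by (simp add: join_def)
      next
        case 2
        then show ?thesis using disjoint_intervalsD(3)[OF ab 2(1)] disjoint_intervalsD(1)[OF cd 2(3)] by (simp add: join_def)
      qed
    qed
  next
    fix j assume "j \<in> J \<union> K"
    then show "0 \<le> join J a c j" "join J a c j < join J b d j" "join J b d j \<le> 1"
      using disjoint_intervalsD[OF ab, of j] disjoint_intervalsD[OF cd, of j] by (auto simp: join_def)
  qed
  show "loop_add (interval_sum J a b x0 f) (interval_sum K c d x0 g) t =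
      interval_sum (J \<union> K) (join J a c) (join J b d) x0 (\<lambda>j. if j \<in> J then f j else g j) t"
  proof (rule eq_by_nontrivial_values[where ?x0.0 = x0])
    fix v assume v: "v \<noteq> x0"
    have J: "(2 * t 0 - a j) / (b j - a j) = (t 0 - a j / 2) / (b j / 2 - a j / 2)" for j
    proof -
      have "t 0 - a j / 2 = (2 * t 0 - a j) / 2" "b j / 2 - a j / 2 = (b j - a j) / 2"
        by (simp_all add: field_simps)
      moreover have "x / y = x / 2 / (y / 2)" for x y :: real by simp
      ultimately show ?thesis by metis
    qed
    have K: "(2 * t 0 - 1 - c j) / (d j - c j) = (t 0 - (1 + c j) / 2) / ((1 + d j) / 2 - (1 + c j) / 2)" for j
    proof -
      have "t 0 - (1 + c j) / 2 = (2 * t 0 - 1 - c j) / 2" "(1 + d j) / 2 - (1 + c j) / 2 = (d j - c j) / 2"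
        by (simp_all add: field_simps)
      moreover have "x / y = x / 2 / (y / 2)" for x y :: real by simp
      ultimately show ?thesis by metis
    qed
    have "interval_sum (J \<union> K) (join J a c) (join J b d) x0 (\<lambda>j. if j \<in> J then f j else g j) t = v \<longleftrightarrow>
      (\<exists>j\<in>J. a j / 2 < t 0 \<and> t 0 < b j / 2 \<and> f j (t(0 := (t 0 - a j / 2) / (b j / 2 - a j / 2))) = v) \<or>
      (\<exists>j\<in>K. (1 + c j) / 2 < t 0 \<and> t 0 < (1 + d j) / 2 \<and> g j (t(0 := (t 0 - (1 + c j) / 2) / ((1 + d j) / 2 - (1 + c j) / 2))) = v)"
    proof -
      have "j \<notin> J" if "j \<in> K" for j using JK that by blast
      then show ?thesis unfolding interval_sum_eq_iff[OF dj v] bex_Un join_def by (simp cong: bex_cong)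
    qed
    moreover have "loop_add (interval_sum J a b x0 f) (interval_sum K c d x0 g) t = v \<longleftrightarrow>
      (if t 0 \<le> 1/2 then (\<exists>j\<in>J. a j < 2 * t 0 \<and> 2 * t 0 < b j \<and> f j (t(0 := (2 * t 0 - a j) / (b j - a j))) = v)
       else (\<exists>j\<in>K. c j < 2 * t 0 - 1 \<and> 2 * t 0 - 1 < d j \<and> g j (t(0 := (2 * t 0 - 1 - c j) / (d j - c j))) = v))"
      unfolding loop_add_def by (simp add: interval_sum_eq_iff[OF ab v] interval_sum_eq_iff[OF cd v])
    moreover have "a j < 2 * t 0 \<and> 2 * t 0 < b j \<longleftrightarrow> a j / 2 < t 0 \<and> t 0 < b j / 2" for j by auto
    moreover have "c j < 2 * t 0 - 1 \<and> 2 * t 0 - 1 < d j \<longleftrightarrow> (1 + c j) / 2 < t 0 \<and> t 0 < (1 + d j) / 2" for j by auto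
    moreover have "t 0 \<le> 1/2" if "j \<in> J" "t 0 < b j / 2" for j using disjoint_intervalsD[OF ab that(1)] that(2) by simp
    moreover have "\<not> t 0 \<le> 1/2" if "j \<in> K" "(1 + c j) / 2 < t 0" for j using disjoint_intervalsD[OF cd that(1)] that(2) by simp
    ultimately show "loop_add (interval_sum J a b x0 f) (interval_sum K c d x0 g) t = v \<longleftrightarrow>
        interval_sum (J \<union> K) (join J a c) (join J b d) x0 (\<lambda>j. if j \<in> J then f j else g j) t = v"
      unfolding J K by (smt (verit, ccfv_threshold))
  qed
qed

text \<open>Reversing the first coordinate reverses every term and also the order of the terms; the
  latter is invisible to \<open>disjoint_intervals\<close>.\<close>

lemma loop_sign_interval_sum:
  fixes e :: nat
  assumes ab: "disjoint_intervals J a b"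
  defines "lo \<equiv> \<lambda>j. if even e then a j else 1 - b j" and "hi \<equiv> \<lambda>j. if even e then b j else 1 - a j"
  shows "disjoint_intervals J lo hi"
    and "loop_sign e (interval_sum J a b x0 f) t = interval_sum J lo hi x0 (\<lambda>j. loop_sign e (f j)) t"
proof -
  show dj: "disjoint_intervals J lo hi"
    using ab unfolding disjoint_intervals_def lo_def hi_def by auto
  show "loop_sign e (interval_sum J a b x0 f) t = interval_sum J lo hi x0 (\<lambda>j. loop_sign e (f j)) t"
  proof (cases "even e")
    case False
    show ?thesis
    proof (rule eq_by_nontrivial_values[where ?x0.0 = x0])
      fix v assume v: "v \<noteq> x0"
      have "lo j < t 0 \<and> t 0 < hi j \<and> loop_sign e (f j) (t(0 := (t 0 - lo j) / (hi j - lo j))) = v \<longleftrightarrow>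
          a j < 1 - t 0 \<and> 1 - t 0 < b j \<and> f j (t(0 := (1 - t 0 - a j) / (b j - a j))) = v" if "j \<in> J" for j
      proof -
        have "1 - (t 0 - (1 - b j)) / (b j - a j) = (1 - t 0 - a j) / (b j - a j)"
          using disjoint_intervalsD(2)[OF ab that] by (simp add: field_simps)
        then have "loop_sign e (f j) (t(0 := (t 0 - lo j) / (hi j - lo j))) = f j (t(0 := (1 - t 0 - a j) / (b j - a j)))"
          using False by (simp add: loop_sign_def loop_uminus_def lo_def hi_def)
        moreover have "lo j < t 0 \<and> t 0 < hi j \<longleftrightarrow> a j < 1 - t 0 \<and> 1 - t 0 < b j"
          using False by (auto simp: lo_def hi_def)
        ultimately show ?thesis by metis
      qed
      then show "loop_sign e (interval_sum J a b x0 f) t = v \<longleftrightarrow> interval_sum J lo hi x0 (\<lambda>j. loop_sign e (f j)) t = v"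
        using False unfolding interval_sum_eq_iff[OF dj v]
        by (simp add: loop_sign_def[of e "interval_sum J a b x0 f"] loop_uminus_def interval_sum_eq_iff[OF ab v])
    qed
  qed (simp add: loop_sign_def lo_def hi_def)
qed

section \<open>Values attained by sums and brackets\<close>

lemma interval_sum_attains:
  assumes ab: "disjoint_intervals J a b" and j: "j \<in> J" and h: "h j \<in> loops m X x0"
    and u: "u \<in> cube m" and ne: "h j u \<noteq> x0" and m: "0 < m"
  shows "h j u \<in> interval_sum J a b x0 h ` cube m"
proof -
  have "u \<in> open_cube m" using ne h u cube_not_open loops_boundary by metis
  then have u0: "0 < u 0" "u 0 < 1" using m by (auto simp: open_cube_def)
  note D = disjoint_intervalsD[OF ab j]
  define t where "t = u(0 := a j + (b j - a j) * u 0)"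
  have t0: "a j < t 0" "t 0 < b j"
  proof -
    have "0 < (b j - a j) * u 0" "(b j - a j) * u 0 < (b j - a j) * 1" using D u0 by (auto intro!: mult_strict_left_mono)
    then show "a j < t 0" "t 0 < b j" by (auto simp: t_def)
  qed
  have tc: "t \<in> cube m" using u t0 D m by (auto simp: cube_def t_def)
  have "t(0 := (t 0 - a j) / (b j - a j)) = u" using D by (auto simp: t_def)
  then have "interval_sum J a b x0 h t = h j u" using interval_sum_eq_iff[OF ab ne, of h t] t0 j by auto
  then show ?thesis using tc by (metis imageI)
qed

text \<open>The value \<open>f y\<close> occurs at the point (y, 1, ..., 1) of the boundary of the
  2n-cube and \<open>g y\<close> at (1, ..., 1, y); the other half lies in the boundary of its cube,
  where the other loop is trivial.\<close>

lemma whitehead_attains: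
  assumes n: "0 < n" and f: "f \<in> loops n X x0" and g: "g \<in> loops n X x0" and y: "y \<in> cube n"
  shows "f y \<noteq> x0 \<Longrightarrow> f y \<in> whitehead n n f g ` cube (2 * n - 1)"
    and "g y \<noteq> x0 \<Longrightarrow> g y \<in> whitehead n n f g ` cube (2 * n - 1)"
proof -
  have m: "Suc (2 * n - 1) = 2 * n" using n by simp
  have op: "y \<in> open_cube n" if "f y \<noteq> x0 \<or> g y \<noteq> x0"
    using that y cube_not_open loops_boundary[OF f] loops_boundary[OF g] by metis
  show "f y \<in> whitehead n n f g ` cube (2 * n - 1)" if ne: "f y \<noteq> x0"
  proof -
    define c where "c k = (if k < n then y k else if k < 2 * n then 1 else 0)" for k
    have "c \<in> cube (Suc (2 * n - 1))" using y unfolding m by (auto simp: cube_def c_def)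
    moreover have "c n = 1" "c 0 < 1" "n \<le> 2 * n - 1" using n op ne by (auto simp: c_def open_cube_def)
    ultimately obtain t where t: "t \<in> cube (2 * n - 1)" "collapse (2 * n - 1) t = c"
      using collapse_onto_upper[of c "2 * n - 1" n 0] by blast
    have "clamp_cube n c = y" using y by (auto simp: clamp_cube_def c_def cube_def fun_eq_iff)
    then have "whitehead n n f g t = f y"
      using whitehead_eq_wedge_ext[OF f g t(1) n] t(2) ne by (simp add: wedge_ext_def)
    then show ?thesis using t(1) by (metis imageI)
  qed
  show "g y \<in> whitehead n n f g ` cube (2 * n - 1)" if ne: "g y \<noteq> x0"
  proof -
    define c where "c k = (if k < n then 1 else if k < 2 * n then y (k - n) else 0)" for k
    have "c \<in> cube (Suc (2 * n - 1))" using y unfolding m by (auto simp: cube_def c_def)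
    moreover have "c 0 = 1" "c n < 1" "n \<le> 2 * n - 1" using n op ne by (auto simp: c_def open_cube_def)
    ultimately obtain t where t: "t \<in> cube (2 * n - 1)" "collapse (2 * n - 1) t = c"
      using collapse_onto_upper[of c "2 * n - 1" 0 n] by blast
    have "clamp_cube n (\<lambda>i. c (n + i)) = y" using y by (auto simp: clamp_cube_def c_def cube_def fun_eq_iff)
    moreover have "c \<notin> open_cube n" using n by (auto simp: open_cube_def c_def)
    ultimately have "whitehead n n f g t = g y"
      using whitehead_eq_wedge_ext[OF f g t(1) n] t(2) loop_clamp_trivial[OF f] by (simp add: wedge_ext_def)
    then show ?thesis using t(1) by (metis imageI)
  qed
qed

lemma image_relative_homotopicI:
  assumes "homotopic_within m X x0 E f g" "E \<subseteq> f ` cube m"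
  shows "image_relative_homotopic m X x0 f g"
proof -
  obtain H where H: "continuous_map (top_of_set (cube m \<times> {0..1::real})) X H"
    "\<And>t. t \<in> cube m \<Longrightarrow> H (t, 0) = f t" "\<And>t. t \<in> cube m \<Longrightarrow> H (t, 1) = g t"
    "\<And>t s. t \<in> cube_boundary m \<Longrightarrow> s \<in> {0..1} \<Longrightarrow> H (t, s) = x0"
    "\<And>t s. t \<in> cube m \<Longrightarrow> s \<in> {0..1} \<Longrightarrow> H (t, s) \<in> E"
    using assms(1) by (rule homotopic_withinE) blast
  have "H ` (cube m \<times> {0..1}) = f ` cube m \<union> g ` cube m"
  proof
    show "H ` (cube m \<times> {0..1}) \<subseteq> f ` cube m \<union> g ` cube m" using H(5) assms(2) by fastforce
    have "f t \<in> H ` (cube m \<times> {0..1}) \<and> g t \<in> H ` (cube m \<times> {0..1})" if "t \<in> cube m" for t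
      using imageI[of "(t, 0)" "cube m \<times> {0..1}" H] imageI[of "(t, 1)" "cube m \<times> {0..1}" H] H(2,3)[OF that] that by simp
    then show "f ` cube m \<union> g ` cube m \<subseteq> H ` (cube m \<times> {0..1})" by blast
  qed
  then show ?thesis unfolding image_relative_homotopic_def using H by (intro exI[of _ H]) simp
qed

theorem theorem3p12:
  fixes X :: "'a topology" and x0 :: 'a and n :: nat
    and f g :: "nat \<times> nat \<Rightarrow> (nat \<Rightarrow> real) \<Rightarrow> 'a"
    and a b :: "nat \<times> nat \<Rightarrow> real"
    and c d :: "nat \<Rightarrow> nat \<Rightarrow> real"
  assumes "n \<ge> 2"
    and "Hausdorff_space X" and "x0 \<in> topspace X"
    and "f \<in> loop_families n ({1..} \<times> {1..}) X x0"
    and "g \<in> loop_families n ({1..} \<times> {1..}) X x0"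
    and "interval_system ({1..} \<times> {1..}) (less_than <*lex*> less_than) a b"
    and "\<And>j. j \<ge> 1 \<Longrightarrow> interval_system {j<..} less_than (c j) (d j)"
  defines "L \<equiv> infinite_sum x0 (\<lambda>i. whitehead n n
                  (infinite_sum x0 (\<lambda>j. f (i, j))) (infinite_sum x0 (\<lambda>j. g (i, j))))"
    and "A \<equiv> interval_sum ({1..} \<times> {1..}) a b x0 (\<lambda>(i, j). whitehead n n (f (i, j)) (g (i, j)))"
    and "B \<equiv> interval_sum ({1..} \<times> {1..}) a b x0 (\<lambda>(i, j). whitehead n n (f (i, j))
                  (interval_sum {j<..} (c j) (d j) x0 (\<lambda>k. g (i, k))))"
    and "C \<equiv> interval_sum ({1..} \<times> {1..}) a b x0 (\<lambda>(i, j). whitehead n n (g (i, j))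
                  (interval_sum {j<..} (c j) (d j) x0 (\<lambda>k. f (i, k))))"
  shows "L \<in> loops (2 * n - 1) X x0 \<and>
         image_relative_homotopic (2 * n - 1) X x0 L
           (loop_add (loop_add A B) (loop_sign (n\<^sup>2) C))"
proof -
  define m where "m = 2 * n - 1"
  have n: "2 \<le> n" "0 < n" and m: "2 \<le> m" "0 < m" using assms(1) by (auto simp: m_def)
  note x0 = \<open>x0 \<in> topspace X\<close>
  have f: "f (i, j) \<in> loops n X x0" and g: "g (i, j) \<in> loops n X x0" if "1 \<le> i" "1 \<le> j" for i j
    using assms(4,5) that by (auto simp: loop_families_def)
  define E where "E i j = insert x0 (f (i, j) ` cube n \<union> g (i, j) ` cube n)" for i j
  define EE where "EE i = (\<Union>j\<in>{1..}. E i j)" for i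
  define E' where "E' p = (\<Union>k\<in>{snd (snd p)..}. E (fst p) k)" for p :: "nat \<times> nat \<times> nat"
  \<comment> \<open>The common index set of both sides: the row i together with kind and index of a
    rectangle.\<close>
  define K where "K = {1::nat..} \<times> rects"
  have fin: "finite {p \<in> {1..} \<times> {1..}. \<not> E (fst p) (snd p) \<subseteq> U}" if U: "openin X U" "x0 \<in> U" for U
  proof (rule finite_subset)
    show "{p \<in> {1..} \<times> {1..}. \<not> E (fst p) (snd p) \<subseteq> U} \<subseteq>
        {p \<in> {1..} \<times> {1..}. \<not> f p ` cube n \<subseteq> U} \<union> {p \<in> {1..} \<times> {1..}. \<not> g p ` cube n \<subseteq> U}"
      using U(2) by (auto simp: E_def)
    show "finite ({p \<in> {1..} \<times> {1..}. \<not> f p ` cube n \<subseteq> U} \<union> {p \<in> {1..} \<times> {1..}. \<not> g p ` cube n \<subseteq> U})"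
      using assms(4,5) U by (simp add: loop_families_def)
  qed
  have cl_row: "clusters {1..} X x0 (E i)" if "1 \<le> i" for i
    unfolding clusters_def
  proof (intro allI impI)
    fix U assume "openin X U \<and> x0 \<in> U"
    then have "finite (snd ` {p \<in> {1..} \<times> {1..}. \<not> E (fst p) (snd p) \<subseteq> U})" using fin by simp
    then show "finite {j \<in> {1..}. \<not> E i j \<subseteq> U}" by (rule finite_subset[rotated]) (use that in force)
  qed
  \<comment> \<open>Clustering over all pairs leaves only finitely many rows that do not lie in a
    given neighbourhood as a whole.\<close>
  have cl_EE: "clusters {1..} X x0 EE"
    unfolding clusters_def
  proof (intro allI impI)
    fix U assume "openin X U \<and> x0 \<in> U"
    then have "finite (fst ` {p \<in> {1..} \<times> {1..}. \<not> E (fst p) (snd p) \<subseteq> U})" using fin by simp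
    then show "finite {i \<in> {1..}. \<not> EE i \<subseteq> U}" by (rule finite_subset[rotated]) (force simp: EE_def)
  qed
  have cl_E': "clusters K X x0 E'"
    unfolding clusters_def
  proof (intro allI impI)
    fix U assume U: "openin X U \<and> x0 \<in> U"
    let ?B = "{p \<in> {1..} \<times> {1..}. \<not> E (fst p) (snd p) \<subseteq> U}"
    have "finite (fst ` ?B)" "finite (snd ` ?B)" using fin U by simp_all
    then obtain M N where MN: "\<forall>i\<in>fst ` ?B. i \<le> M" "\<forall>k\<in>snd ` ?B. k \<le> N"
      unfolding finite_nat_set_iff_bounded_le by blast
    have "{p \<in> K. \<not> E' p \<subseteq> U} \<subseteq> {..M} \<times> {..2} \<times> {..N}"
    proof
      fix p assume "p \<in> {p \<in> K. \<not> E' p \<subseteq> U}"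
      then obtain i k j where p: "p = (i, k, j)" "1 \<le> i" "k \<le> 2" "1 \<le> j" and "\<not> E' p \<subseteq> U"
        by (auto simp: K_def rects_def)
      moreover from this obtain l where l: "j \<le> l" "\<not> E i l \<subseteq> U" unfolding E'_def by auto
      ultimately have "(i, l) \<in> ?B" by simp
      from bspec[OF MN(1) imageI[OF this]] bspec[OF MN(2) imageI[OF this]] have "i \<le> M" "l \<le> N" by simp_all
      then show "p \<in> {..M} \<times> {..2} \<times> {..N}" using p l by auto
    qed
    then show "finite {p \<in> K. \<not> E' p \<subseteq> U}" by (rule finite_subset) simp
  qed
  have cd: "disjoint_intervals {j<..} (c j) (d j)" if "1 \<le> j" for j
    using assms(7)[OF that] by (rule interval_system_disjoint)
  have ab: "disjoint_intervals ({1..} \<times> {1..}) a b"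
    using assms(6) by (rule interval_system_disjoint)
  define F where "F i j = f (i, j)" for i j
  define G where "G i j = g (i, j)" for i j
  have F: "F i j \<in> loops n X x0" "F i j ` cube n \<subseteq> E i j" and G: "G i j \<in> loops n X x0" "G i j ` cube n \<subseteq> E i j"
    and x0E: "x0 \<in> E i j" if "1 \<le> i" "1 \<le> j" for i j
    using f[OF that] g[OF that] by (auto simp: F_def G_def E_def)
  define H where "H = (\<lambda>(i, \<alpha>). whitehead_terms n x0 c d (F i) (G i) \<alpha>)"
  have expand: "homotopic_within m X x0 (EE i) (whitehead n n (infinite_sum x0 (F i)) (infinite_sum x0 (G i)))
        (interval_sum rects rect_left rect_right x0 (whitehead_terms n x0 c d (F i) (G i)))"
      "\<And>\<alpha>. \<alpha> \<in> rects \<Longrightarrow> whitehead_terms n x0 c d (F i) (G i) \<alpha> \<in> loops m X x0"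
      "\<And>\<alpha>. \<alpha> \<in> rects \<Longrightarrow> whitehead_terms n x0 c d (F i) (G i) \<alpha> ` cube m \<subseteq> (\<Union>k\<in>{snd \<alpha>..}. E i k)"
    if i: "1 \<le> i" for i
    unfolding m_def EE_def
    by (rule homotopic_whitehead_sums[where E = "E i", OF n(1) x0 F[OF i] G[OF i] cl_row[OF i] x0E[OF i] cd rect_intervals_disjoint];
        assumption)+
  let ?E = "insert x0 (\<Union>i\<in>{1..}. EE i)"
  define W where "W i = whitehead n n (infinite_sum x0 (F i)) (infinite_sum x0 (G i))" for i
  define V where "V i = interval_sum rects rect_left rect_right x0 (whitehead_terms n x0 c d (F i) (G i))" for i
  have L_eq: "L = interval_sum {1..} (\<lambda>j. (real j - 1) / real j) (\<lambda>j. real j / (real j + 1)) x0 W"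
    by (simp add: L_def W_def[abs_def] F_def[abs_def] G_def[abs_def] infinite_sum_def)
  have WV: "homotopic_within m X x0 (EE i) (W i) (V i)" if "1 \<le> i" for i
    using expand(1)[OF that] by (simp add: W_def V_def)
  have H_loop: "homotopic_within m X x0 (E' p) (H p) (H p)" if "p \<in> K" for p
  proof -
    obtain i \<alpha> where p: "p = (i, \<alpha>)" "1 \<le> i" "\<alpha> \<in> rects" using \<open>p \<in> K\<close> by (auto simp: K_def)
    show ?thesis
      using homotopic_within_refl[OF expand(2,3)[OF p(2,3)]]
      by (simp add: H_def E'_def p)
  qed
  \<comment> \<open>The sum over the rows of their expansions, flattened to a single sum over
    \<open>K\<close>.\<close>
  obtain lo hi where lohi: "disjoint_intervals K lo hi"
    and nested: "\<And>t. interval_sum {1..} (\<lambda>j. (real j - 1) / real j) (\<lambda>j. real j / (real j + 1)) x0 V t =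
      interval_sum K lo hi x0 H t"
    by (rule that; unfold V_def K_def H_def)
       (rule interval_sum_nested[OF infinite_sum_intervals rect_intervals_disjoint])+
  have "homotopic_within m X x0 ?E L
      (interval_sum {1..} (\<lambda>j. (real j - 1) / real j) (\<lambda>j. real j / (real j + 1)) x0 V)"
    unfolding L_eq
    by (rule homotopic_interval_sums[OF m(1) _ infinite_sum_intervals infinite_sum_intervals _ cl_EE x0])
       (auto intro: WV)
  then have L_hom: "homotopic_within m X x0 ?E L (interval_sum K lo hi x0 H)"
    by (rule homotopic_within_cong) (use nested in auto)

  \<comment> \<open>The terms of kind \<open>k\<close>; the sums A, B and the signed C become the
    partial sums of \<open>H\<close> over the kinds 0, 1 and 2.\<close>
  define S where "S k = {1::nat..} \<times> {k::nat} \<times> {1::nat..}" for k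
  define \<psi> where "\<psi> = (\<lambda>(i::nat, k::nat, j::nat). (i, j))"
  have \<psi>: "bij_betw \<psi> (S k) ({1..} \<times> {1..})" for k
    unfolding bij_betw_def S_def \<psi>_def by (auto simp: inj_on_def image_iff)
  \<comment> \<open>The intervals of the third sum after the sign has been moved into its
    terms.\<close>
  define lo2 where "lo2 p = (if even (n\<^sup>2) then a p else 1 - b p)" for p
  define hi2 where "hi2 p = (if even (n\<^sup>2) then b p else 1 - a p)" for p
  have dj2: "disjoint_intervals ({1..} \<times> {1..}) lo2 hi2"
    using loop_sign_interval_sum(1)[OF ab, of "n\<^sup>2"] by (simp add: lo2_def[abs_def] hi2_def[abs_def])
  have eqA: "A = interval_sum (S 0) (\<lambda>s. a (\<psi> s)) (\<lambda>s. b (\<psi> s)) x0 H"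
    unfolding A_def interval_sum_reindex(2)[OF ab \<psi>[of 0]]
    by (rule ext, rule interval_sum_cong[OF interval_sum_reindex(1)[OF ab \<psi>]])
       (auto simp: S_def \<psi>_def H_def F_def G_def whitehead_terms_def)
  have eqB: "B = interval_sum (S 1) (\<lambda>s. a (\<psi> s)) (\<lambda>s. b (\<psi> s)) x0 H"
    unfolding B_def interval_sum_reindex(2)[OF ab \<psi>[of 1]]
    by (rule ext, rule interval_sum_cong[OF interval_sum_reindex(1)[OF ab \<psi>]])
       (auto simp: S_def \<psi>_def H_def F_def[abs_def] G_def[abs_def] whitehead_terms_def)
  have eqC: "loop_sign (n\<^sup>2) C = interval_sum (S 2) (\<lambda>s. lo2 (\<psi> s)) (\<lambda>s. hi2 (\<psi> s)) x0 H"
  proof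
    fix t
    have "loop_sign (n\<^sup>2) C t = interval_sum ({1..} \<times> {1..}) lo2 hi2 x0
        (\<lambda>p. loop_sign (n\<^sup>2) (case p of (i, j) \<Rightarrow> whitehead n n (g (i, j)) (interval_sum {j<..} (c j) (d j) x0 (\<lambda>k. f (i, k))))) t"
      unfolding C_def loop_sign_interval_sum(2)[OF ab] lo2_def[abs_def] hi2_def[abs_def] by simp
    also have "\<dots> = interval_sum (S 2) (\<lambda>s. lo2 (\<psi> s)) (\<lambda>s. hi2 (\<psi> s)) x0 H t"
      unfolding interval_sum_reindex(2)[OF dj2 \<psi>[of 2]]
      by (rule interval_sum_cong[OF interval_sum_reindex(1)[OF dj2 \<psi>]])
         (auto simp: S_def \<psi>_def H_def F_def[abs_def] G_def[abs_def] whitehead_terms_def)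
    finally show "loop_sign (n\<^sup>2) C t = interval_sum (S 2) (\<lambda>s. lo2 (\<psi> s)) (\<lambda>s. hi2 (\<psi> s)) x0 H t" .
  qed
  have disj: "S 0 \<inter> S 1 = {}" "(S 0 \<union> S 1) \<inter> S 2 = {}" by (auto simp: S_def)
  note AB = loop_add_interval_sums[OF interval_sum_reindex(1)[OF ab \<psi>[of 0]] interval_sum_reindex(1)[OF ab \<psi>[of 1]] disj(1)]
  note ABC = loop_add_interval_sums[OF AB(1) interval_sum_reindex(1)[OF dj2 \<psi>[of 2]] disj(2)]
  have KS: "K = (S 0 \<union> S 1) \<union> S 2"
    by (auto simp: K_def S_def rects_def le_Suc_eq numeral_2_eq_2)
  have eqAB: "loop_add A B = interval_sum (S 0 \<union> S 1) (join (S 0) (\<lambda>s. a (\<psi> s)) (\<lambda>s. a (\<psi> s)))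
      (join (S 0) (\<lambda>s. b (\<psi> s)) (\<lambda>s. b (\<psi> s))) x0 H"
    unfolding eqA eqB by (rule ext) (simp only: AB(2) if_cancel)
  obtain lo' hi' where lohi': "disjoint_intervals K lo' hi'"
    and R: "loop_add (loop_add A B) (loop_sign (n\<^sup>2) C) = interval_sum K lo' hi' x0 H"
  proof
    show "disjoint_intervals K (join (S 0 \<union> S 1) (join (S 0) (\<lambda>s. a (\<psi> s)) (\<lambda>s. a (\<psi> s))) (\<lambda>s. lo2 (\<psi> s)))
      (join (S 0 \<union> S 1) (join (S 0) (\<lambda>s. b (\<psi> s)) (\<lambda>s. b (\<psi> s))) (\<lambda>s. hi2 (\<psi> s)))"
      unfolding KS by (rule ABC(1))
    show "loop_add (loop_add A B) (loop_sign (n\<^sup>2) C) = interval_sum K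
      (join (S 0 \<union> S 1) (join (S 0) (\<lambda>s. a (\<psi> s)) (\<lambda>s. a (\<psi> s))) (\<lambda>s. lo2 (\<psi> s)))
      (join (S 0 \<union> S 1) (join (S 0) (\<lambda>s. b (\<psi> s)) (\<lambda>s. b (\<psi> s))) (\<lambda>s. hi2 (\<psi> s))) x0 H"
      unfolding KS eqAB eqC by (rule ext) (simp only: ABC(2) if_cancel)
  qed
  \<comment> \<open>Both sides are now sums of the same loops over \<open>K\<close>; only the
    intervals differ.\<close>
  have "homotopic_within m X x0 (insert x0 (\<Union>p\<in>K. E' p)) (interval_sum K lo hi x0 H) (interval_sum K lo' hi' x0 H)"
    by (rule homotopic_interval_sums[OF m(1) _ lohi lohi' H_loop cl_E' x0]) (simp add: K_def rects_def)
  then have "homotopic_within m X x0 ?E (interval_sum K lo hi x0 H) (interval_sum K lo' hi' x0 H)"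
    by (rule homotopic_within_mono) (fastforce simp: K_def rects_def E'_def EE_def)
  with L_hom have hom: "homotopic_within m X x0 ?E L (loop_add (loop_add A B) (loop_sign (n\<^sup>2) C))"
    unfolding R by (rule homotopic_within_trans)
  have L_loop: "L \<in> loops m X x0" by (rule homotopic_within_loops1[OF hom])

  \<comment> \<open>Every value of a loop occurs in the infinite sum of its row, hence in the
    bracket of that row, hence in \<open>L\<close>. The bound \<open>?E\<close> thus lies in the
    image of \<open>L\<close>, which makes the homotopy image-relative.\<close>
  have attained: "v \<in> L ` cube m" if v: "v \<noteq> x0" and ij: "1 \<le> i" "1 \<le> j" and vE: "v \<in> E i j" for v i j
  proof -
    have Fl: "infinite_sum x0 (F i) \<in> loops n X x0" and Gl: "infinite_sum x0 (G i) \<in> loops n X x0"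
      unfolding infinite_sum_def
      by (rule interval_sum_loop(1)[where E = "E i", OF n(1) _ infinite_sum_intervals _ _ cl_row[OF ij(1)] x0];
          use F[OF ij(1)] G[OF ij(1)] in simp)+
    have j: "j \<in> {1..}" and i: "i \<in> {1..}" using ij by auto
    have "v \<in> F i j ` cube n \<or> v \<in> G i j ` cube n" using vE v by (auto simp: E_def F_def G_def)
    then have "v \<in> infinite_sum x0 (F i) ` cube n \<or> v \<in> infinite_sum x0 (G i) ` cube n"
      unfolding infinite_sum_def
      using interval_sum_attains[where h = "F i", OF infinite_sum_intervals j F(1)[OF ij] _ _ n(2)]
        interval_sum_attains[where h = "G i", OF infinite_sum_intervals j G(1)[OF ij] _ _ n(2)] v by blast
    then have "v \<in> W i ` cube m"
      using whitehead_attains[OF n(2) Fl Gl] v unfolding m_def W_def by blast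
    moreover have "W i \<in> loops m X x0" using homotopic_within_loops1[OF WV[OF ij(1)]] .
    ultimately show ?thesis
      unfolding L_eq using interval_sum_attains[OF infinite_sum_intervals i, where h = W] v m(2) by blast
  qed
  have "(\<lambda>_. 0) \<in> cube_boundary m" using m(2) by (auto simp: cube_boundary_def cube_def)
  then have "x0 \<in> L ` cube m" using loops_boundary[OF L_loop] cube_boundary_subset by force
  then have "?E \<subseteq> L ` cube m" using attained by (fastforce simp: EE_def)
  with L_loop hom show ?thesis by (simp add: image_relative_homotopicI m_def)
qed

end
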